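(* Let $\Gamma$ and $\Lambda$ be countable discrete groups, and let $m_\Gamma\in\ell^1(\Gamma)$, $m_\Lambda\in\ell^1(\Lambda)$ be finite complex measures such that the convolution operators $A=L_{m_\Gamma}$ on $\ell^2(\Gamma)$ and $B=L_{m_\Lambda}$ on $\ell^2(\Lambda)$ are self-adjoint. Let $(v(x,\omega))_{x\in\Gamma}$ be an i.i.d. family of real random variables, each distributed according to the spectral measure $\mu_B^{e_\Lambda}$, and let $H(\omega)=A+V(\omega)$ be the random Schrödinger operator on $\ell^2(\Gamma)$, where $V(\omega)=\operatorname{Diag}(v(x,\omega))_{x\in\Gamma}$. On the wreath product $\Lambda\wr\Gamma$ consider the convolution operator $M=L_{m_{\Lambda\wr\Gamma}}$ on $\ell^2(\Lambda\wr\Gamma)$ with $m_{\Lambda\wr\Gamma}=\hat m_\Gamma+\hat m_\Lambda$. Then $$\mathbb{E}\,\mu_{H(\omega)}^{e_\Gamma}=\mu_M^{e_{\Lambda\wr\Gamma}}$$ as Borel measures on $\mathbb{R}$.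
   Context: For a countable discrete group $G$ with identity $e_G$, $\delta_x$ ($x\in G$) is the canonical basis of $\ell^2(G)$. The left regular representation is $(L_xf)(y)=f(x^{-1}y)$. For a finite complex measure $m\in\ell^1(G)$, the convolution operator is $L_m=\sum_{x\in G}m(x)L_x$; it is self-adjoint iff $m(g^{-1})=\overline{m(g)}$ for all $g$. For a bounded self-adjoint operator $L$ with spectral resolution $E_L$, the spectral measure at $x$ is $\mu_L^x(\cdot)=\langle\delta_x,E_L(\cdot)\delta_x\rangle$. The measure $\mathbb{E}\mu_{H(\omega)}^{e_\Gamma}$ is defined by averaging: $S\mapsto\mathbb{E}[\mu_{H(\omega)}^{e_\Gamma}(S)]$. $\operatorname{Diag}(v_x)_{x\in\Gamma}$ is the multiplication operator $\delta_x\mapsto v_x\delta_x$. Wreath product: $\Lambda\wr\Gamma=(\bigoplus_\Gamma\Lambda)\rtimes\Gamma$ is the set of pairs $(f,g)$ with $g\in\Gamma$ and $f:\Gamma\to\Lambda$ finitely supported (i.e. $f(x)=e_\Lambda$ for all but finitely many $x$), with product $(f,g)(f',g')=(f\cdot(f'\circ g^{-1}),gg')$, where $(f'\circ g^{-1})(h)=f'(g^{-1}h)$ and the product of functions is pointwise. The groups embed by $\Gamma\ni g\mapsto\hat g=(e,g)$, with $e$ the constant function $e_\Lambda$, and $\Lambda\ni l\mapsto\hat l=(1_l,e_\Gamma)$, with $1_l(e_\Gamma)=l$ and $1_l(x)=e_\Lambda$ for $x\neq e_\Gamma$. For a measure $m$ on $\Gamma$ or $\Lambda$, $\hat m$ denotes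 its push-forward to $\Lambda\wr\Gamma$ under the corresponding embedding. *)

theory Defs
  imports "HOL-Probability.Probability" "HOL-Algebra.Group"
begin

section \<open>The Hilbert space of square summable functions on a set\<close>

text \<open>
  Elements of the space are functions on the whole type that vanish outside the index set, so that
  equality of functions is equality of vectors. The inner product is linear in the second argument.
\<close>

definition ell2 :: "'a set \<Rightarrow> ('a \<Rightarrow> complex) set" where
  "ell2 I = {f. (\<forall>x. x \<notin> I \<longrightarrow> f x = 0) \<and> (\<lambda>x. (cmod (f x))\<^sup>2) summable_on I}"

definition ell2_inner :: "'a set \<Rightarrow> ('a \<Rightarrow> complex) \<Rightarrow> ('a \<Rightarrow> complex) \<Rightarrow> complex" where
  "ell2_inner I f g = (\<Sum>\<^sub>\<infinity>x\<in>I. cnj (f x) * g x)"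

definition ell2_norm :: "'a set \<Rightarrow> ('a \<Rightarrow> complex) \<Rightarrow> real" where
  "ell2_norm I f = sqrt (\<Sum>\<^sub>\<infinity>x\<in>I. (cmod (f x))\<^sup>2)"

definition delta :: "'a \<Rightarrow> 'a \<Rightarrow> complex" where
  "delta x = (\<lambda>y. if y = x then 1 else 0)"

definition bounded_op :: "'a set \<Rightarrow> (('a \<Rightarrow> complex) \<Rightarrow> ('a \<Rightarrow> complex)) \<Rightarrow> bool" where
  "bounded_op I L \<longleftrightarrow>
     (\<forall>f\<in>ell2 I. L f \<in> ell2 I) \<and>
     (\<forall>f\<in>ell2 I. \<forall>g\<in>ell2 I. L (\<lambda>x. f x + g x) = (\<lambda>x. L f x + L g x)) \<and>
     (\<forall>c. \<forall>f\<in>ell2 I. L (\<lambda>x. c * f x) = (\<lambda>x. c * L f x)) \<and>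
     (\<exists>K. \<forall>f\<in>ell2 I. ell2_norm I (L f) \<le> K * ell2_norm I f)"

definition selfadjoint_op :: "'a set \<Rightarrow> (('a \<Rightarrow> complex) \<Rightarrow> ('a \<Rightarrow> complex)) \<Rightarrow> bool" where
  "selfadjoint_op I L \<longleftrightarrow>
     bounded_op I L \<and>
     (\<forall>f\<in>ell2 I. \<forall>g\<in>ell2 I. ell2_inner I f (L g) = ell2_inner I (L f) g)"

section \<open>Spectral resolutions and spectral measures\<close>

definition projection_valued_measure ::
    "'a set \<Rightarrow> (real set \<Rightarrow> ('a \<Rightarrow> complex) \<Rightarrow> ('a \<Rightarrow> complex)) \<Rightarrow> bool" where
  "projection_valued_measure I E \<longleftrightarrow>
     (\<forall>S\<in>sets borel. selfadjoint_op I (E S) \<and> (\<forall>f\<in>ell2 I. E S (E S f) = E S f)) \<and>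
     (\<forall>f\<in>ell2 I. E UNIV f = f) \<and>
     (\<forall>S\<in>sets borel. \<forall>T\<in>sets borel. \<forall>f\<in>ell2 I. E (S \<inter> T) f = E S (E T f)) \<and>
     (\<forall>A :: nat \<Rightarrow> real set. range A \<subseteq> sets borel \<longrightarrow> disjoint_family A \<longrightarrow>
        (\<forall>f\<in>ell2 I. \<forall>g\<in>ell2 I.
           (\<lambda>n. ell2_inner I f (E (A n) g)) sums ell2_inner I f (E (\<Union>n. A n) g)))"

text \<open>The Borel measure \<open>S \<mapsto> \<langle>f, E(S) f\<rangle>\<close>, which is real and nonnegative as \<open>E(S)\<close> is a projection.\<close>

definition quadratic_measure ::
    "'a set \<Rightarrow> (real set \<Rightarrow> ('a \<Rightarrow> complex) \<Rightarrow> ('a \<Rightarrow> complex)) \<Rightarrow> ('a \<Rightarrow> complex) \<Rightarrow> real measure" where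
  "quadratic_measure I E f =
     measure_of UNIV (sets borel) (\<lambda>S. ennreal (Re (ell2_inner I f (E S f))))"

text \<open>
  \<open>E\<close> has bounded support and \<open>L = \<integral> t dE(t)\<close>; the operator integral is taken in the weak sense, through
  its quadratic form \<open>\<langle>f, L f\<rangle> = \<integral> t d\<langle>f, E(t) f\<rangle>\<close>, which by polarization determines the operator.
\<close>

definition is_spectral_resolution ::
    "'a set \<Rightarrow> (('a \<Rightarrow> complex) \<Rightarrow> ('a \<Rightarrow> complex)) \<Rightarrow>
     (real set \<Rightarrow> ('a \<Rightarrow> complex) \<Rightarrow> ('a \<Rightarrow> complex)) \<Rightarrow> bool" where
  "is_spectral_resolution I L E \<longleftrightarrow>
     projection_valued_measure I E \<and>
     (\<exists>R. \<forall>f\<in>ell2 I. E {-R..R} f = f) \<and>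
     (\<forall>f\<in>ell2 I. ell2_inner I f (L f) = of_real (\<integral>t. t \<partial>quadratic_measure I E f))"

text \<open>
  A bounded self-adjoint operator has a spectral resolution, and \<open>E S f\<close> is uniquely determined for
  Borel \<open>S\<close> and square summable \<open>f\<close>; the choice only concerns other arguments.
\<close>

definition spectral_resolution ::
    "'a set \<Rightarrow> (('a \<Rightarrow> complex) \<Rightarrow> ('a \<Rightarrow> complex)) \<Rightarrow>
     real set \<Rightarrow> ('a \<Rightarrow> complex) \<Rightarrow> ('a \<Rightarrow> complex)" where
  "spectral_resolution I L = (SOME E. is_spectral_resolution I L E)"

text \<open>
  The spectral measure at \<open>x\<close> is set to the zero measure for maps that are not bounded self-adjoint
  operators. For a random Schroedinger operator with almost surely bounded potential this
  concerns only a null set of realizations.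
\<close>

definition spectral_measure ::
    "'a set \<Rightarrow> (('a \<Rightarrow> complex) \<Rightarrow> ('a \<Rightarrow> complex)) \<Rightarrow> 'a \<Rightarrow> real measure" where
  "spectral_measure I L x =
     (if selfadjoint_op I L then quadratic_measure I (spectral_resolution I L) (delta x)
      else null_measure borel)"

definition expected_measure :: "'w measure \<Rightarrow> ('w \<Rightarrow> real measure) \<Rightarrow> real measure" where
  "expected_measure P \<mu> =
     measure_of UNIV (sets borel) (\<lambda>S. ennreal (prob_space.expectation P (\<lambda>\<omega>. measure (\<mu> \<omega>) S)))"

section \<open>Convolution and multiplication operators\<close>

definition left_regular :: "('a, 'b) monoid_scheme \<Rightarrow> 'a \<Rightarrow> ('a \<Rightarrow> complex) \<Rightarrow> ('a \<Rightarrow> complex)" where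
  "left_regular G x f = (\<lambda>y. if y \<in> carrier G then f (inv\<^bsub>G\<^esub> x \<otimes>\<^bsub>G\<^esub> y) else 0)"

text \<open>
  A finite complex measure on \<open>G\<close> is a function that is absolutely summable over \<open>carrier G\<close>. The
  norm convergent series \<open>\<Sum>x. m(x) L\<^sub>x\<close> is evaluated pointwise.
\<close>

definition finite_complex_measure :: "('a, 'b) monoid_scheme \<Rightarrow> ('a \<Rightarrow> complex) \<Rightarrow> bool" where
  "finite_complex_measure G m \<longleftrightarrow> (\<lambda>x. cmod (m x)) summable_on carrier G"

definition convolution_op ::
    "('a, 'b) monoid_scheme \<Rightarrow> ('a \<Rightarrow> complex) \<Rightarrow> ('a \<Rightarrow> complex) \<Rightarrow> ('a \<Rightarrow> complex)" where
  "convolution_op G m f = (\<lambda>y. \<Sum>\<^sub>\<infinity>x\<in>carrier G. m x * left_regular G x f y)"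

definition push_forward ::
    "('a, 'c) monoid_scheme \<Rightarrow> ('a \<Rightarrow> 'b) \<Rightarrow> ('a \<Rightarrow> complex) \<Rightarrow> 'b \<Rightarrow> complex" where
  "push_forward G \<phi> m z = (\<Sum>\<^sub>\<infinity>x\<in>{x \<in> carrier G. \<phi> x = z}. m x)"

definition diag_op :: "('a \<Rightarrow> real) \<Rightarrow> ('a \<Rightarrow> complex) \<Rightarrow> ('a \<Rightarrow> complex)" where
  "diag_op v f = (\<lambda>x. of_real (v x) * f x)"

definition schroedinger_op ::
    "(('a \<Rightarrow> complex) \<Rightarrow> ('a \<Rightarrow> complex)) \<Rightarrow> ('a \<Rightarrow> real) \<Rightarrow> ('a \<Rightarrow> complex) \<Rightarrow> ('a \<Rightarrow> complex)" where
  "schroedinger_op A v f = (\<lambda>x. A f x + diag_op v f x)"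

section \<open>Wreath products\<close>

definition lamp_configs ::
    "('l, 'c) monoid_scheme \<Rightarrow> ('g, 'd) monoid_scheme \<Rightarrow> ('g \<Rightarrow> 'l) set" where
  "lamp_configs \<Lambda> \<Gamma> =
     {f \<in> carrier \<Gamma> \<rightarrow>\<^sub>E carrier \<Lambda>. finite {x \<in> carrier \<Gamma>. f x \<noteq> \<one>\<^bsub>\<Lambda>\<^esub>}}"

definition wreath ::
    "('l, 'c) monoid_scheme \<Rightarrow> ('g, 'd) monoid_scheme \<Rightarrow> (('g \<Rightarrow> 'l) \<times> 'g) monoid" where
  "wreath \<Lambda> \<Gamma> =
     \<lparr>carrier = lamp_configs \<Lambda> \<Gamma> \<times> carrier \<Gamma>,
      mult = (\<lambda>(f, g) (f', g').
        (\<lambda>h\<in>carrier \<Gamma>. f h \<otimes>\<^bsub>\<Lambda>\<^esub> f' (inv\<^bsub>\<Gamma>\<^esub> g \<otimes>\<^bsub>\<Gamma>\<^esub> h), g \<otimes>\<^bsub>\<Gamma>\<^esub> g')),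
      one = (\<lambda>h\<in>carrier \<Gamma>. \<one>\<^bsub>\<Lambda>\<^esub>, \<one>\<^bsub>\<Gamma>\<^esub>)\<rparr>"

definition embed_base ::
    "('l, 'c) monoid_scheme \<Rightarrow> ('g, 'd) monoid_scheme \<Rightarrow> 'g \<Rightarrow> ('g \<Rightarrow> 'l) \<times> 'g" where
  "embed_base \<Lambda> \<Gamma> g = (\<lambda>h\<in>carrier \<Gamma>. \<one>\<^bsub>\<Lambda>\<^esub>, g)"

definition embed_lamp ::
    "('l, 'c) monoid_scheme \<Rightarrow> ('g, 'd) monoid_scheme \<Rightarrow> 'l \<Rightarrow> ('g \<Rightarrow> 'l) \<times> 'g" where
  "embed_lamp \<Lambda> \<Gamma> l =
     (\<lambda>h\<in>carrier \<Gamma>. if h = \<one>\<^bsub>\<Gamma>\<^esub> then l else \<one>\<^bsub>\<Lambda>\<^esub>, \<one>\<^bsub>\<Gamma>\<^esub>)"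

lemma lamp_configsI:
  assumes "f \<in> carrier \<Gamma> \<rightarrow>\<^sub>E carrier \<Lambda>" "finite F"
    and "\<And>x. x \<in> carrier \<Gamma> \<Longrightarrow> x \<notin> F \<Longrightarrow> f x = \<one>\<^bsub>\<Lambda>\<^esub>"
  shows "f \<in> lamp_configs \<Lambda> \<Gamma>"
proof -
  have "{x \<in> carrier \<Gamma>. f x \<noteq> \<one>\<^bsub>\<Lambda>\<^esub>} \<subseteq> F" using assms(3) by blast
  then show ?thesis using assms(1,2) finite_subset by (auto simp: lamp_configs_def)
qed

lemma group_wreath:
  fixes \<Lambda> :: "('l, 'c) monoid_scheme" and \<Gamma> :: "('g, 'd) monoid_scheme"
  assumes "group \<Lambda>" "group \<Gamma>"
  shows "group (wreath \<Lambda> \<Gamma>)"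
proof -
  interpret L: group \<Lambda> by fact
  interpret G: group \<Gamma> by fact
  have val: "f x \<in> carrier \<Lambda>" if "f \<in> lamp_configs \<Lambda> \<Gamma>" "x \<in> carrier \<Gamma>" for f x
    using that by (auto simp: lamp_configs_def)
  have fin: "finite {x \<in> carrier \<Gamma>. f x \<noteq> \<one>\<^bsub>\<Lambda>\<^esub>}" if "f \<in> lamp_configs \<Lambda> \<Gamma>" for f
    using that by (auto simp: lamp_configs_def)
  have supp: "h \<in> (\<lambda>x. g \<otimes>\<^bsub>\<Gamma>\<^esub> x) ` {x \<in> carrier \<Gamma>. f x \<noteq> \<one>\<^bsub>\<Lambda>\<^esub>}"
    if "g \<in> carrier \<Gamma>" "h \<in> carrier \<Gamma>" "f (inv\<^bsub>\<Gamma>\<^esub> g \<otimes>\<^bsub>\<Gamma>\<^esub> h) \<noteq> \<one>\<^bsub>\<Lambda>\<^esub>" for f g h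
  proof -
    have "h = g \<otimes>\<^bsub>\<Gamma>\<^esub> (inv\<^bsub>\<Gamma>\<^esub> g \<otimes>\<^bsub>\<Gamma>\<^esub> h)" using that by (simp add: G.m_assoc[symmetric])
    then show ?thesis using that by blast
  qed
  have mul: "(\<lambda>h\<in>carrier \<Gamma>. f h \<otimes>\<^bsub>\<Lambda>\<^esub> f' (inv\<^bsub>\<Gamma>\<^esub> g \<otimes>\<^bsub>\<Gamma>\<^esub> h)) \<in> lamp_configs \<Lambda> \<Gamma>"
    if "f \<in> lamp_configs \<Lambda> \<Gamma>" "f' \<in> lamp_configs \<Lambda> \<Gamma>" "g \<in> carrier \<Gamma>" for f f' g
    by (rule lamp_configsI[where F = "{x \<in> carrier \<Gamma>. f x \<noteq> \<one>\<^bsub>\<Lambda>\<^esub>}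
          \<union> (\<lambda>x. g \<otimes>\<^bsub>\<Gamma>\<^esub> x) ` {x \<in> carrier \<Gamma>. f' x \<noteq> \<one>\<^bsub>\<Lambda>\<^esub>}"])
       (use that fin[OF that(1)] fin[OF that(2)] val supp[OF that(3), of _ f'] in auto)
  have one: "(\<lambda>h\<in>carrier \<Gamma>. \<one>\<^bsub>\<Lambda>\<^esub>) \<in> lamp_configs \<Lambda> \<Gamma>"
    by (rule lamp_configsI[where F = "{}"]) auto
  have invc: "(\<lambda>h\<in>carrier \<Gamma>. inv\<^bsub>\<Lambda>\<^esub> f (g \<otimes>\<^bsub>\<Gamma>\<^esub> h)) \<in> lamp_configs \<Lambda> \<Gamma>"
    if "f \<in> lamp_configs \<Lambda> \<Gamma>" "g \<in> carrier \<Gamma>" for f g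
  proof (rule lamp_configsI[where F = "(\<lambda>x. inv\<^bsub>\<Gamma>\<^esub> g \<otimes>\<^bsub>\<Gamma>\<^esub> x) ` {x \<in> carrier \<Gamma>. f x \<noteq> \<one>\<^bsub>\<Lambda>\<^esub>}"])
    fix h assume h: "h \<in> carrier \<Gamma>"
      "h \<notin> (\<lambda>x. inv\<^bsub>\<Gamma>\<^esub> g \<otimes>\<^bsub>\<Gamma>\<^esub> x) ` {x \<in> carrier \<Gamma>. f x \<noteq> \<one>\<^bsub>\<Lambda>\<^esub>}"
    then have "f (g \<otimes>\<^bsub>\<Gamma>\<^esub> h) = \<one>\<^bsub>\<Lambda>\<^esub>"
      using supp[of "inv\<^bsub>\<Gamma>\<^esub> g" h f] that by auto
    then show "(\<lambda>h\<in>carrier \<Gamma>. inv\<^bsub>\<Lambda>\<^esub> f (g \<otimes>\<^bsub>\<Gamma>\<^esub> h)) h = \<one>\<^bsub>\<Lambda>\<^esub>" using h by simp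
  qed (use that fin val in auto)
  show ?thesis
  proof (rule groupI)
    fix x y assume "x \<in> carrier (wreath \<Lambda> \<Gamma>)" "y \<in> carrier (wreath \<Lambda> \<Gamma>)"
    then show "x \<otimes>\<^bsub>wreath \<Lambda> \<Gamma>\<^esub> y \<in> carrier (wreath \<Lambda> \<Gamma>)"
      by (auto simp: wreath_def intro: mul)
  next
    show "\<one>\<^bsub>wreath \<Lambda> \<Gamma>\<^esub> \<in> carrier (wreath \<Lambda> \<Gamma>)" using one by (simp add: wreath_def)
  next
    fix x y z assume "x \<in> carrier (wreath \<Lambda> \<Gamma>)" "y \<in> carrier (wreath \<Lambda> \<Gamma>)" "z \<in> carrier (wreath \<Lambda> \<Gamma>)"
    then show "x \<otimes>\<^bsub>wreath \<Lambda> \<Gamma>\<^esub> y \<otimes>\<^bsub>wreath \<Lambda> \<Gamma>\<^esub> z = x \<otimes>\<^bsub>wreath \<Lambda> \<Gamma>\<^esub> (y \<otimes>\<^bsub>wreath \<Lambda> \<Gamma>\<^esub> z)"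
      by (auto simp: wreath_def fun_eq_iff val L.m_assoc G.m_assoc G.inv_mult_group)
  next
    fix x assume "x \<in> carrier (wreath \<Lambda> \<Gamma>)"
    then obtain f g where x: "x = (f, g)" "f \<in> lamp_configs \<Lambda> \<Gamma>" "g \<in> carrier \<Gamma>"
      by (auto simp: wreath_def)
    have "(\<lambda>h\<in>carrier \<Gamma>. \<one>\<^bsub>\<Lambda>\<^esub> \<otimes>\<^bsub>\<Lambda>\<^esub> f h) = f"
      using x(2) val[OF x(2)] by (intro PiE_ext[of _ "carrier \<Gamma>" "\<lambda>_. carrier \<Lambda>"])
        (auto simp: lamp_configs_def)
    then show "\<one>\<^bsub>wreath \<Lambda> \<Gamma>\<^esub> \<otimes>\<^bsub>wreath \<Lambda> \<Gamma>\<^esub> x = x"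
      using x by (simp add: wreath_def restrict_def cong: if_cong)
  next
    fix x assume "x \<in> carrier (wreath \<Lambda> \<Gamma>)"
    then obtain f g where x: "x = (f, g)" "f \<in> lamp_configs \<Lambda> \<Gamma>" "g \<in> carrier \<Gamma>"
      by (auto simp: wreath_def)
    have "(\<lambda>h\<in>carrier \<Gamma>. inv\<^bsub>\<Lambda>\<^esub> f (g \<otimes>\<^bsub>\<Gamma>\<^esub> h), inv\<^bsub>\<Gamma>\<^esub> g) \<otimes>\<^bsub>wreath \<Lambda> \<Gamma>\<^esub> x = \<one>\<^bsub>wreath \<Lambda> \<Gamma>\<^esub>"
      using x by (auto simp: wreath_def fun_eq_iff val)
    then show "\<exists>y\<in>carrier (wreath \<Lambda> \<Gamma>). y \<otimes>\<^bsub>wreath \<Lambda> \<Gamma>\<^esub> x = \<one>\<^bsub>wreath \<Lambda> \<Gamma>\<^esub>"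
      using x invc by (intro bexI[of _ "(\<lambda>h\<in>carrier \<Gamma>. inv\<^bsub>\<Lambda>\<^esub> f (g \<otimes>\<^bsub>\<Gamma>\<^esub> h), inv\<^bsub>\<Gamma>\<^esub> g)"])
        (auto simp: wreath_def)
  qed
qed

end

theory Submission
  imports Defs "HOL-Computational_Algebra.Polynomial"
begin

text \<open>
  Both sides are Borel measures with bounded support, and such measures are determined by their
  moments. The \<open>n\<close>-th moment of the spectral measure of \<open>L\<close> at \<open>x\<close> is \<open>\<langle>\<delta>\<^sub>x, L\<^sup>n \<delta>\<^sub>x\<rangle>\<close>, so the
  statement reduces to the identity \<open>\<E>\<langle>\<delta>, H\<^sup>n \<delta>\<rangle> = \<langle>\<delta>, M\<^sup>n \<delta>\<rangle>\<close> for all \<open>n\<close>.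

  To see why it holds, read an element \<open>(f, g)\<close> of the wreath product as a walker at \<open>g\<close> together
  with a lamp \<open>f (g x\<^sup>-\<^sup>1)\<close> for every site \<open>x\<close>. In these coordinates the part of \<open>M\<close> that comes from
  the base group moves the walker as \<open>A\<close> does and leaves the lamps alone, and the part that comes
  from the lamp group applies \<open>B\<close> to the lamp at the site of the walker. Hence \<open>M\<close> arises from
  \<open>H = A + V\<close> by replacing the number \<open>v(g)\<close> with the operator \<open>B\<close> on lamp \<open>g\<close>. Operators on different
  lamps commute and factorize on the vector \<open>\<delta>\<close>, just as the \<open>v(g)\<close> are independent, and
  \<open>\<langle>\<delta>, B\<^sup>k \<delta>\<rangle> = \<E> v(g)\<^sup>k\<close> by the choice of the distribution of \<open>v(g)\<close>. In formulas: a multiset \<open>k\<close>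
  of sites stands for the monomial \<open>\<Prod>\<^sub>x v(x)\<^bsup>k(x)\<^esup>\<close> on one side and for the vector \<open>tensor k g\<close>, with
  \<open>B\<^bsup>k(x)\<^esup> \<delta>\<close> in the lamp at \<open>x\<close> and the walker at \<open>g\<close>, on the other. The numbers
  \<open>\<E>[\<Prod>\<^sub>x v(x)\<^bsup>k(x)\<^esup> (H\<^sup>n \<delta>)(g)]\<close> and \<open>\<langle>tensor k g, M\<^sup>n \<delta>\<rangle>\<close> satisfy the same recursion in \<open>n\<close> (lemmas
  \<open>S_Suc\<close> and \<open>T_Suc\<close>) with the same initial values (\<open>S_0\<close>, \<open>expectation_V\<close>, \<open>T_0\<close>); this is lemma \<open>S_eq_T\<close>.

  The link between spectral measures and moments is the spectral theorem for bounded self-adjoint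
  operators, which is proved here in two halves. Existence (\<open>is_spectral_resolution_E\<close>): for
  \<open>-K \<le> L \<le> K\<close> the functional \<open>p \<mapsto> \<langle>f, p(L) f\<rangle>\<close> is nonnegative on the products \<open>(K + t)\<^sup>k (K - t)\<^sup>m\<close>,
  so the weights of the Bernstein polynomials give discrete measures, and a weak limit of them
  represents the functional by a measure \<open>\<mu>\<^sub>f\<close>. Linear relations between moments are inherited by
  measures, so \<open>f \<mapsto> \<mu>\<^sub>f(S)\<close> is a bounded quadratic form, and \<open>E(S)\<close> is its operator. Uniqueness
  (\<open>represents_powers_\<nu>\<close>): for every resolution \<open>E\<close> of \<open>L\<close> the measure \<open>\<langle>f, E(\<cdot>) f\<rangle>\<close> has the moments
  \<open>\<langle>f, L\<^sup>n f\<rangle>\<close>.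

  As the potential is only almost surely bounded, it is first cut off at a norm bound of \<open>B\<close>,
  which changes it on a null set. Measurability of the moments in \<open>\<omega>\<close> makes the spectral measure a
  probability kernel, and its average is a bind in the Giry monad (\<open>expected_measure_eq_bind\<close>).
\<close>

section \<open>The space of square summable functions\<close>

lemma ell2D: "f \<in> ell2 I \<Longrightarrow> (\<lambda>x. (cmod (f x))\<^sup>2) summable_on I"
  and ell2_outside: "f \<in> ell2 I \<Longrightarrow> x \<notin> I \<Longrightarrow> f x = 0"
  by (auto simp: ell2_def)

lemma ell2_product_summable:
  assumes "f \<in> ell2 I" "g \<in> ell2 I"
  shows "(\<lambda>x. cmod (cnj (f x) * g x)) summable_on I"
proof (rule summable_on_comparison_test)
  show "(\<lambda>x. (cmod (f x))\<^sup>2 + (cmod (g x))\<^sup>2) summable_on I"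
    using assms[THEN ell2D] by (rule summable_on_add)
  show "cmod (cnj (f x) * g x) \<le> (cmod (f x))\<^sup>2 + (cmod (g x))\<^sup>2" for x
  proof -
    have "0 \<le> cmod (f x) * cmod (g x)" by simp
    then have "cmod (f x) * cmod (g x) \<le> (cmod (f x))\<^sup>2 + (cmod (g x))\<^sup>2"
      using sum_squares_bound[of "cmod (f x)" "cmod (g x)"] by linarith
    then show ?thesis by (simp add: norm_mult)
  qed
qed auto

lemma ell2_inner_summable:
  "f \<in> ell2 I \<Longrightarrow> g \<in> ell2 I \<Longrightarrow> (\<lambda>x. cnj (f x) * g x) summable_on I"
  by (rule abs_summable_summable) (rule ell2_product_summable)

lemma ell2_zero [simp]: "(\<lambda>_. 0) \<in> ell2 I"
  by (auto simp: ell2_def)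

lemma ell2_add [intro]:
  assumes "f \<in> ell2 I" "g \<in> ell2 I"
  shows "(\<lambda>x. f x + g x) \<in> ell2 I"
proof -
  have "(\<lambda>x. (cmod (f x + g x))\<^sup>2) summable_on I"
  proof (rule summable_on_comparison_test)
    show "(\<lambda>x. 2 * ((cmod (f x))\<^sup>2 + (cmod (g x))\<^sup>2)) summable_on I"
      using assms[THEN ell2D] by (intro summable_on_cmult_right summable_on_add)
    fix x
    have "(cmod (f x + g x))\<^sup>2 \<le> (cmod (f x) + cmod (g x))\<^sup>2"
      by (simp add: norm_triangle_ineq power_mono)
    also have "\<dots> \<le> 2 * ((cmod (f x))\<^sup>2 + (cmod (g x))\<^sup>2)"
      using sum_squares_bound[of "cmod (f x)" "cmod (g x)"] by (simp add: power2_sum)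
    finally show "(cmod (f x + g x))\<^sup>2 \<le> 2 * ((cmod (f x))\<^sup>2 + (cmod (g x))\<^sup>2)" .
  qed auto
  then show ?thesis using assms by (auto simp: ell2_def)
qed

lemma ell2_scale [intro]: "f \<in> ell2 I \<Longrightarrow> (\<lambda>x. c * f x) \<in> ell2 I"
  by (auto simp: ell2_def norm_mult power_mult_distrib intro!: summable_on_cmult_right)

lemma ell2_uminus [intro]: "f \<in> ell2 I \<Longrightarrow> (\<lambda>x. - f x) \<in> ell2 I"
  using ell2_scale[of f I "-1"] by simp

lemma ell2_diff [intro]: "f \<in> ell2 I \<Longrightarrow> g \<in> ell2 I \<Longrightarrow> (\<lambda>x. f x - g x) \<in> ell2 I"
  using ell2_add[of f I "\<lambda>x. - g x"] by auto

lemma ell2_sum: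
  "(\<And>i. i \<in> J \<Longrightarrow> f i \<in> ell2 I) \<Longrightarrow> (\<lambda>x. \<Sum>i\<in>J. f i x) \<in> ell2 I"
  by (induction J rule: infinite_finite_induct) (auto intro!: ell2_add)

lemma ell2_finite_support:
  assumes "finite F" "F \<subseteq> I" "\<And>x. x \<notin> F \<Longrightarrow> f x = 0"
  shows "f \<in> ell2 I"
proof -
  have "(\<lambda>x. (cmod (f x))\<^sup>2) summable_on I"
    using assms by (intro finite_nonzero_values_imp_summable_on)
      (auto intro: finite_subset[of _ F])
  then show ?thesis using assms by (auto simp: ell2_def)
qed

lemma ell2_delta: "x \<in> I \<Longrightarrow> delta x \<in> ell2 I"
  by (rule ell2_finite_support[of "{x}"]) (auto simp: delta_def)

lemma ell2_cut: "finite F \<Longrightarrow> F \<subseteq> I \<Longrightarrow> (\<lambda>x. if x \<in> F then f x else 0) \<in> ell2 I"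
  by (rule ell2_finite_support[of F]) auto

lemma ell2_inner_add_right:
  "f \<in> ell2 I \<Longrightarrow> g \<in> ell2 I \<Longrightarrow> h \<in> ell2 I \<Longrightarrow>
   ell2_inner I f (\<lambda>x. g x + h x) = ell2_inner I f g + ell2_inner I f h"
  unfolding ell2_inner_def distrib_left by (intro infsum_add ell2_inner_summable)

lemma ell2_inner_scale_right: "ell2_inner I f (\<lambda>x. c * g x) = c * ell2_inner I f g"
  by (simp add: ell2_inner_def mult.left_commute infsum_cmult_right')

lemma ell2_inner_cnj: "cnj (ell2_inner I f g) = ell2_inner I g f"
  by (simp add: ell2_inner_def mult.commute flip: infsum_cnj)

lemma Re_ell2_inner_commute: "Re (ell2_inner I f g) = Re (ell2_inner I g f)"
  by (subst ell2_inner_cnj[symmetric]) simp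

lemma ell2_inner_add_left:
  "f \<in> ell2 I \<Longrightarrow> g \<in> ell2 I \<Longrightarrow> h \<in> ell2 I \<Longrightarrow>
   ell2_inner I (\<lambda>x. f x + g x) h = ell2_inner I f h + ell2_inner I g h"
  unfolding ell2_inner_def complex_cnj_add distrib_right by (intro infsum_add ell2_inner_summable)

lemma ell2_inner_scale_left: "ell2_inner I (\<lambda>x. c * f x) g = cnj c * ell2_inner I f g"
  by (simp add: ell2_inner_def mult.assoc infsum_cmult_right')

lemma infsum_of_real:
  "(\<Sum>\<^sub>\<infinity>x\<in>I. of_real (h x) :: complex) = of_real (\<Sum>\<^sub>\<infinity>x\<in>I. h x)"
proof (cases "h summable_on I")
  case True
  then show ?thesis by (intro infsumI has_sum_of_real) simp
next
  case False
  then have "\<not> (\<lambda>x. of_real (h x) :: complex) summable_on I"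
    using summable_on_Re[of "\<lambda>x. of_real (h x)" I] by auto
  with False show ?thesis by (simp add: infsum_not_exists)
qed

lemma ell2_inner_self: "ell2_inner I f f = of_real ((ell2_norm I f)\<^sup>2)"
proof -
  have "ell2_inner I f f = (\<Sum>\<^sub>\<infinity>x\<in>I. of_real ((cmod (f x))\<^sup>2))"
    unfolding ell2_inner_def by (simp add: complex_norm_square[symmetric] mult.commute)
  also have "\<dots> = of_real (\<Sum>\<^sub>\<infinity>x\<in>I. (cmod (f x))\<^sup>2)"
    by (rule infsum_of_real)
  finally show ?thesis
    by (simp add: ell2_norm_def infsum_nonneg)
qed

lemma ell2_inner_delta_left: "x \<in> I \<Longrightarrow> ell2_inner I (delta x) f = f x"
proof -
  assume "x \<in> I"
  have "ell2_inner I (delta x) f = (\<Sum>\<^sub>\<infinity>y\<in>{x}. cnj (delta x y) * f y)"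
    unfolding ell2_inner_def using \<open>x \<in> I\<close>
    by (intro infsum_cong_neutral) (auto simp: delta_def)
  then show ?thesis by (simp add: delta_def)
qed

lemma ell2_norm_nonneg [simp]: "0 \<le> ell2_norm I f"
  by (simp add: ell2_norm_def infsum_nonneg)

lemma ell2_norm_cut:
  assumes "finite F" "F \<subseteq> I"
  shows "(ell2_norm I (\<lambda>x. if x \<in> F then f x else 0))\<^sup>2 = (\<Sum>x\<in>F. (cmod (f x))\<^sup>2)"
proof -
  have "(\<Sum>\<^sub>\<infinity>x\<in>I. (cmod (if x \<in> F then f x else 0))\<^sup>2) = (\<Sum>\<^sub>\<infinity>x\<in>F. (cmod (f x))\<^sup>2)"
    using assms by (intro infsum_cong_neutral) auto
  then show ?thesis using assms by (simp add: ell2_norm_def sum_nonneg)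
qed

text \<open>
  A positive semidefinite quadratic polynomial has nonpositive discriminant; this is the source of
  every Cauchy--Schwarz inequality below.
\<close>

lemma discriminant_bound:
  fixes a b c :: real
  assumes "\<And>t. 0 \<le> a + 2 * t * b + t\<^sup>2 * c" "0 \<le> a" "0 \<le> c"
  shows "\<bar>b\<bar> \<le> sqrt a * sqrt c"
proof -
  have "b\<^sup>2 \<le> a * c"
  proof (cases "c = 0")
    case True
    have "b = 0"
    proof (rule ccontr)
      assume "b \<noteq> 0"
      then show False using assms(1)[of "- (a + 1) / (2 * b)"] assms(2) True
        by (simp add: field_simps)
    qed
    then show ?thesis using assms by simp
  next
    case False
    then show ?thesis using assms(1)[of "- b / c"] assms(3)
      by (simp add: power2_eq_square field_simps)
  qed
  then have "sqrt (b\<^sup>2) \<le> sqrt (a * c)" by (rule real_sqrt_le_mono)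
  then show ?thesis by (simp add: real_sqrt_mult)
qed

lemma Re_ell2_inner_bound:
  assumes "f \<in> ell2 I" "g \<in> ell2 I"
  shows "\<bar>Re (ell2_inner I f g)\<bar> \<le> ell2_norm I f * ell2_norm I g"
proof -
  have "0 \<le> (ell2_norm I f)\<^sup>2 + 2 * t * Re (ell2_inner I f g) + t\<^sup>2 * (ell2_norm I g)\<^sup>2" for t
  proof -
    have g: "(\<lambda>x. of_real t * g x) \<in> ell2 I" using assms by blast
    have sym: "Re (ell2_inner I g f) = Re (ell2_inner I f g)" by (rule Re_ell2_inner_commute)
    have "0 \<le> (ell2_norm I (\<lambda>x. f x + of_real t * g x))\<^sup>2" by simp
    also have "\<dots> = Re (ell2_inner I (\<lambda>x. f x + of_real t * g x) (\<lambda>x. f x + of_real t * g x))"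
      by (subst ell2_inner_self) simp
    also have "\<dots> = Re (ell2_inner I f f) + t * Re (ell2_inner I f g)
        + t * Re (ell2_inner I g f) + t\<^sup>2 * Re (ell2_inner I g g)"
      using assms g by (simp add: ell2_inner_add_left ell2_inner_add_right ell2_add
        ell2_inner_scale_right ell2_inner_scale_left power2_eq_square algebra_simps)
    finally show ?thesis using sym by (simp add: ell2_inner_self)
  qed
  from discriminant_bound[OF this] show ?thesis by simp
qed

text \<open>Rotating the first argument turns the inner product into its modulus.\<close>

lemma ell2_inner_bound:
  assumes "f \<in> ell2 I" "g \<in> ell2 I"
  shows "cmod (ell2_inner I f g) \<le> ell2_norm I f * ell2_norm I g"
proof (cases "ell2_inner I f g = 0")
  case False
  define c where "c = sgn (ell2_inner I f g)"
  have c: "cnj c * c = 1"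
    using False by (simp add: c_def mult.commute complex_norm_square[symmetric] norm_sgn)
  have "cmod c = 1" using False by (simp add: c_def norm_sgn)
  then have n: "ell2_norm I (\<lambda>x. c * f x) = ell2_norm I f"
    by (simp add: ell2_norm_def norm_mult)
  have "ell2_inner I (\<lambda>x. c * f x) g = of_real (cmod (ell2_inner I f g))"
  proof -
    have "ell2_inner I f g = c * of_real (cmod (ell2_inner I f g))"
      using False by (simp add: c_def sgn_eq)
    then have "cnj c * ell2_inner I f g = (cnj c * c) * of_real (cmod (ell2_inner I f g))"
      by (metis mult.assoc)
    then show ?thesis using c by (simp add: ell2_inner_scale_left)
  qed
  then show ?thesis
    using Re_ell2_inner_bound[of "\<lambda>x. c * f x" I g] assms n by (simp add: ell2_scale)
qed simp

lemma ell2_norm_delta: "x \<in> I \<Longrightarrow> ell2_norm I (delta x) = 1"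
proof -
  assume x: "x \<in> I"
  have "(\<Sum>\<^sub>\<infinity>y\<in>I. (cmod (delta x y))\<^sup>2) = (\<Sum>\<^sub>\<infinity>y\<in>{x}. (cmod (delta x y))\<^sup>2)"
    using x by (intro infsum_cong_neutral) (auto simp: delta_def)
  then show ?thesis by (simp add: ell2_norm_def) (simp add: delta_def)
qed

lemma cmod_le_ell2_norm: "f \<in> ell2 I \<Longrightarrow> x \<in> I \<Longrightarrow> cmod (f x) \<le> ell2_norm I f"
  using ell2_inner_bound[OF ell2_delta, of x I f] by (simp add: ell2_inner_delta_left ell2_norm_delta)

lemma ell2_inner_eq_Complex:
  "ell2_inner I f g = Complex (Re (ell2_inner I f g)) (Re (ell2_inner I (\<lambda>x. \<i> * f x) g))"
  by (simp add: ell2_inner_scale_left complex_eq_iff)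

text \<open>
  The hypothesis is what results from pairing \<open>u\<close> with its own restriction to \<open>F\<close> when such pairings
  are bounded by \<open>C\<close> times the norm of the restriction. Cancelling the norm leaves a bound that is
  uniform in \<open>F\<close>.
\<close>

lemma ell2I_finite_bound:
  assumes "\<And>x. x \<notin> I \<Longrightarrow> u x = 0" "0 \<le> C"
    and "\<And>F. finite F \<Longrightarrow> F \<subseteq> I \<Longrightarrow>
      (\<Sum>x\<in>F. (cmod (u x))\<^sup>2) \<le> C * sqrt (\<Sum>x\<in>F. (cmod (u x))\<^sup>2)"
  shows "u \<in> ell2 I" and "ell2_norm I u \<le> C"
proof -
  have b: "(\<Sum>x\<in>F. (cmod (u x))\<^sup>2) \<le> C\<^sup>2" if "finite F" "F \<subseteq> I" for F
  proof -
    define s where "s = sqrt (\<Sum>x\<in>F. (cmod (u x))\<^sup>2)"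
    have s: "s \<ge> 0" "s\<^sup>2 = (\<Sum>x\<in>F. (cmod (u x))\<^sup>2)" by (auto simp: s_def sum_nonneg)
    have "s * s \<le> C * s" using assms(3)[OF that] s by (simp add: s_def power2_eq_square)
    then have "s \<le> C" using s(1) assms(2) by (cases "s = 0") auto
    then show ?thesis using s by (metis power_mono)
  qed
  have sm: "(\<lambda>x. (cmod (u x))\<^sup>2) summable_on I"
    by (rule nonneg_bdd_above_summable_on) (auto intro!: bdd_aboveI[of _ "C\<^sup>2"] b)
  then show "u \<in> ell2 I" using assms by (auto simp: ell2_def)
  have "(\<Sum>\<^sub>\<infinity>x\<in>I. (cmod (u x))\<^sup>2) \<le> C\<^sup>2"
    by (rule infsum_le_finite_sums[OF sm b])
  then show "ell2_norm I u \<le> C"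
    unfolding ell2_norm_def using assms(2) real_le_lsqrt by (simp add: infsum_nonneg)
qed

section \<open>Operators from bounded quadratic forms\<close>

text \<open>
  \<open>r f g\<close> is the real part of a bounded positive sesquilinear form; invariance under simultaneous
  rotation by \<open>\<i>\<close> is what distinguishes it from a merely real bilinear form. Its operator is written
  down by coordinates, since the value at \<open>y\<close> has to be the pairing with \<open>delta y\<close>.
\<close>

locale bounded_form =
  fixes I :: "'a set" and r :: "('a \<Rightarrow> complex) \<Rightarrow> ('a \<Rightarrow> complex) \<Rightarrow> real"
  assumes sym: "f \<in> ell2 I \<Longrightarrow> g \<in> ell2 I \<Longrightarrow> r f g = r g f"
    and add: "f \<in> ell2 I \<Longrightarrow> g \<in> ell2 I \<Longrightarrow> h \<in> ell2 I \<Longrightarrow> r f (\<lambda>x. g x + h x) = r f g + r f h"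
    and scale: "f \<in> ell2 I \<Longrightarrow> g \<in> ell2 I \<Longrightarrow> r f (\<lambda>x. of_real c * g x) = c * r f g"
    and rot: "f \<in> ell2 I \<Longrightarrow> g \<in> ell2 I \<Longrightarrow> r (\<lambda>x. \<i> * f x) (\<lambda>x. \<i> * g x) = r f g"
    and pos: "f \<in> ell2 I \<Longrightarrow> 0 \<le> r f f"
    and bound: "f \<in> ell2 I \<Longrightarrow> r f f \<le> (ell2_norm I f)\<^sup>2"
begin

lemma zero: "f \<in> ell2 I \<Longrightarrow> r f (\<lambda>_. 0) = 0"
  using scale[of f f 0] by simp

lemma add_left:
  "f \<in> ell2 I \<Longrightarrow> g \<in> ell2 I \<Longrightarrow> h \<in> ell2 I \<Longrightarrow> r (\<lambda>x. f x + g x) h = r f h + r g h"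
  by (simp add: sym[of _ h] ell2_add add)

lemma scale_left: "f \<in> ell2 I \<Longrightarrow> g \<in> ell2 I \<Longrightarrow> r (\<lambda>x. of_real c * f x) g = c * r f g"
  by (simp add: sym[of _ g] ell2_scale scale)

lemma sum_left:
  assumes "finite J" "\<And>i. i \<in> J \<Longrightarrow> h i \<in> ell2 I" "g \<in> ell2 I"
  shows "r (\<lambda>x. \<Sum>i\<in>J. h i x) g = (\<Sum>i\<in>J. r (h i) g)"
  using assms
  by (induction J rule: finite_induct) (auto simp: add_left ell2_sum sym[of _ g] zero)

lemma rot_swap:
  assumes "f \<in> ell2 I" "g \<in> ell2 I"
  shows "r f (\<lambda>x. \<i> * g x) = - r (\<lambda>x. \<i> * f x) g"
proof -
  have "r (\<lambda>x. \<i> * f x) (\<lambda>x. \<i> * (\<i> * g x)) = r f (\<lambda>x. \<i> * g x)"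
    using assms by (intro rot) auto
  moreover have "(\<lambda>x. \<i> * (\<i> * g x)) = (\<lambda>x. of_real (-1) * g x)" by auto
  ultimately show ?thesis using assms scale[of "\<lambda>x. \<i> * f x" g "-1"] by auto
qed

lemma cauchy_schwarz:
  assumes "f \<in> ell2 I" "g \<in> ell2 I"
  shows "\<bar>r f g\<bar> \<le> ell2_norm I f * ell2_norm I g"
proof -
  have "0 \<le> r f f + 2 * t * r f g + t\<^sup>2 * r g g" for t
  proof -
    have g: "(\<lambda>x. of_real t * g x) \<in> ell2 I" using assms by blast
    have "0 \<le> r (\<lambda>x. f x + of_real t * g x) (\<lambda>x. f x + of_real t * g x)"
      using assms g by (intro pos ell2_add)
    also have "\<dots> = r f f + 2 * t * r f g + t\<^sup>2 * r g g"
      using assms g by (simp add: add_left add ell2_add scale scale_left sym[of g f]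
          power2_eq_square algebra_simps)
    finally show ?thesis .
  qed
  from discriminant_bound[OF this] have "\<bar>r f g\<bar> \<le> sqrt (r f f) * sqrt (r g g)"
    using pos assms by auto
  also have "\<dots> \<le> ell2_norm I f * ell2_norm I g"
    using assms bound by (intro mult_mono) (auto intro: real_le_lsqrt simp: pos)
  finally show ?thesis .
qed

definition op :: "('a \<Rightarrow> complex) \<Rightarrow> 'a \<Rightarrow> complex" where
  "op g = (\<lambda>y. if y \<in> I then Complex (r (delta y) g) (r (\<lambda>x. \<i> * delta y x) g) else 0)"

text \<open>
  On finitely supported vectors the form is represented by \<open>op\<close> because of bilinearity alone.
\<close>

lemma op_cut:
  assumes "finite F" "F \<subseteq> I" "g \<in> ell2 I"
  shows "r (\<lambda>x. if x \<in> F then c x else 0) g = Re (\<Sum>y\<in>F. cnj (c y) * op g y)"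
proof -
  have d: "delta y \<in> ell2 I" if "y \<in> F" for y using that assms by (auto intro: ell2_delta)
  have e: "r (\<lambda>x. c y * delta y x) g = Re (cnj (c y) * op g y)" if y: "y \<in> F" for y
  proof -
    have "(\<lambda>x. c y * delta y x) =
        (\<lambda>x. of_real (Re (c y)) * delta y x + of_real (Im (c y)) * (\<i> * delta y x))"
      by (auto simp: complex_eq_iff delta_def)
    then have "r (\<lambda>x. c y * delta y x) g
        = Re (c y) * r (delta y) g + Im (c y) * r (\<lambda>x. \<i> * delta y x) g"
      using d[OF y] assms(3) by (simp add: add_left ell2_scale scale_left)
    then show ?thesis using y assms by (auto simp: op_def)
  qed
  have "(\<lambda>x. if x \<in> F then c x else 0) = (\<lambda>x. \<Sum>y\<in>F. c y * delta y x)"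
    using assms(1) by (auto simp: delta_def if_distrib cong: if_cong)
  then have "r (\<lambda>x. if x \<in> F then c x else 0) g = (\<Sum>y\<in>F. r (\<lambda>x. c y * delta y x) g)"
    using assms d by (simp add: sum_left ell2_scale)
  then show ?thesis using e by simp
qed

lemma op_ell2: "g \<in> ell2 I \<Longrightarrow> op g \<in> ell2 I"
  and op_norm: "g \<in> ell2 I \<Longrightarrow> ell2_norm I (op g) \<le> ell2_norm I g"
proof -
  assume g: "g \<in> ell2 I"
  have "(\<Sum>x\<in>F. (cmod (op g x))\<^sup>2) \<le> ell2_norm I g * sqrt (\<Sum>x\<in>F. (cmod (op g x))\<^sup>2)"
    if F: "finite F" "F \<subseteq> I" for F
  proof -
    have "(\<Sum>x\<in>F. (cmod (op g x))\<^sup>2) = Re (\<Sum>x\<in>F. cnj (op g x) * op g x)"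
      by (simp add: cmod_power2) (simp add: power2_eq_square)
    also have "\<dots> = r (\<lambda>x. if x \<in> F then op g x else 0) g"
      using op_cut[OF F g] by simp
    also have "\<dots> \<le> ell2_norm I (\<lambda>x. if x \<in> F then op g x else 0) * ell2_norm I g"
      using cauchy_schwarz[OF ell2_cut[OF F] g] by (simp add: abs_le_iff)
    also have "ell2_norm I (\<lambda>x. if x \<in> F then op g x else 0) = sqrt (\<Sum>x\<in>F. (cmod (op g x))\<^sup>2)"
      by (subst ell2_norm_cut[OF F, symmetric]) simp
    finally show ?thesis by (simp add: mult.commute)
  qed
  note b = this
  show "op g \<in> ell2 I" "ell2_norm I (op g) \<le> ell2_norm I g"
    by (rule ell2I_finite_bound[where C = "ell2_norm I g"]; use b in \<open>auto simp: op_def\<close>)+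
qed

text \<open>Both sides are continuous in \<open>f\<close>, and finitely supported functions are dense.\<close>

lemma op_represents:
  assumes f: "f \<in> ell2 I" and g: "g \<in> ell2 I"
  shows "Re (ell2_inner I f (op g)) = r f g"
proof -
  let ?c = "\<lambda>F x. if x \<in> F then f x else 0"
  have ev: "\<forall>\<^sub>F F in finite_subsets_at_top I. finite F \<and> F \<subseteq> I"
    by (auto intro: eventually_finite_subsets_at_top_weakI)
  have "((\<lambda>F. Re (\<Sum>y\<in>F. cnj (f y) * op g y)) \<longlongrightarrow> Re (ell2_inner I f (op g))) (finite_subsets_at_top I)"
    unfolding ell2_inner_def
    by (intro tendsto_Re infsum_tendsto ell2_inner_summable f op_ell2 g)
  then have 1: "((\<lambda>F. r (?c F) g) \<longlongrightarrow> Re (ell2_inner I f (op g))) (finite_subsets_at_top I)"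
    by (rule Lim_transform_eventually) (use ev in \<open>eventually_elim, auto simp: op_cut g\<close>)
  have n: "(ell2_norm I (\<lambda>x. f x - ?c F x))\<^sup>2 = (ell2_norm I f)\<^sup>2 - (\<Sum>x\<in>F. (cmod (f x))\<^sup>2)"
    if F: "finite F" "F \<subseteq> I" for F
  proof -
    have s: "(\<lambda>x. (cmod (f x))\<^sup>2) summable_on I" using f by (rule ell2D)
    have "(\<Sum>\<^sub>\<infinity>x\<in>I. (cmod (f x - ?c F x))\<^sup>2) = (\<Sum>\<^sub>\<infinity>x\<in>I - F. (cmod (f x))\<^sup>2)"
      by (intro infsum_cong_neutral) auto
    also have "\<dots> = (\<Sum>\<^sub>\<infinity>x\<in>I. (cmod (f x))\<^sup>2) - (\<Sum>\<^sub>\<infinity>x\<in>F. (cmod (f x))\<^sup>2)"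
      using s F by (intro infsum_Diff) auto
    finally show ?thesis using F finite_sum_le_infsum[OF s, of F]
      by (simp add: ell2_norm_def infsum_nonneg)
  qed
  have "((\<lambda>F. (ell2_norm I f)\<^sup>2 - (\<Sum>x\<in>F. (cmod (f x))\<^sup>2)) \<longlongrightarrow> (ell2_norm I f)\<^sup>2 - (ell2_norm I f)\<^sup>2)
      (finite_subsets_at_top I)"
    using infsum_tendsto[OF ell2D[OF f]]
    by (intro tendsto_diff tendsto_const) (simp add: ell2_norm_def infsum_nonneg)
  moreover have "\<forall>\<^sub>F F in finite_subsets_at_top I.
      (ell2_norm I f)\<^sup>2 - (\<Sum>x\<in>F. (cmod (f x))\<^sup>2) = (ell2_norm I (\<lambda>x. f x - ?c F x))\<^sup>2"
    using ev by eventually_elim (simp add: n)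
  ultimately have "((\<lambda>F. (ell2_norm I (\<lambda>x. f x - ?c F x))\<^sup>2) \<longlongrightarrow> (ell2_norm I f)\<^sup>2 - (ell2_norm I f)\<^sup>2)
      (finite_subsets_at_top I)"
    by (rule Lim_transform_eventually)
  then have "((\<lambda>F. (ell2_norm I (\<lambda>x. f x - ?c F x))\<^sup>2) \<longlongrightarrow> 0) (finite_subsets_at_top I)"
    by simp
  then have "((\<lambda>F. sqrt ((ell2_norm I (\<lambda>x. f x - ?c F x))\<^sup>2) * ell2_norm I g) \<longlongrightarrow> sqrt 0 * ell2_norm I g)
      (finite_subsets_at_top I)"
    by (intro tendsto_mult tendsto_real_sqrt tendsto_const)
  then have z: "((\<lambda>F. ell2_norm I (\<lambda>x. f x - ?c F x) * ell2_norm I g) \<longlongrightarrow> 0) (finite_subsets_at_top I)"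
    by simp
  have "((\<lambda>F. r f g - r (?c F) g) \<longlongrightarrow> 0) (finite_subsets_at_top I)"
  proof (rule Lim_null_comparison[OF _ z], use ev in eventually_elim)
    fix F assume "finite F \<and> F \<subseteq> I"
    then have c: "?c F \<in> ell2 I" by (intro ell2_cut) auto
    have "r f g = r (\<lambda>x. (f x - ?c F x) + ?c F x) g" by simp
    also have "\<dots> = r (\<lambda>x. f x - ?c F x) g + r (?c F) g"
      by (rule add_left[OF ell2_diff[OF f c] c g])
    finally show "norm (r f g - r (?c F) g) \<le> ell2_norm I (\<lambda>x. f x - ?c F x) * ell2_norm I g"
      using cauchy_schwarz[OF ell2_diff[OF f c] g] by simp
  qed
  then have "((\<lambda>F. r f g - (r f g - r (?c F) g)) \<longlongrightarrow> r f g - 0) (finite_subsets_at_top I)"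
    by (intro tendsto_diff tendsto_const)
  then have "((\<lambda>F. r (?c F) g) \<longlongrightarrow> r f g) (finite_subsets_at_top I)" by simp
  from tendsto_unique[OF _ 1 this] show ?thesis by simp
qed

lemma op_selfadjoint: "selfadjoint_op I op"
  unfolding selfadjoint_op_def bounded_op_def
proof (intro conjI ballI allI)
  fix f g assume f: "f \<in> ell2 I" and g: "g \<in> ell2 I"
  show "op (\<lambda>x. f x + g x) = (\<lambda>x. op f x + op g x)"
    using f g by (auto simp: op_def fun_eq_iff complex_eq_iff add ell2_delta ell2_scale)
  have *: "Re (ell2_inner I h (op g)) = Re (ell2_inner I (op h) g)" if "h \<in> ell2 I" for h
    using that g sym[of h g] op_represents[of h g] op_represents[of g h]
    by (subst ell2_inner_cnj[symmetric, of I "op h" g]) simp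
  have i: "op (\<lambda>x. \<i> * f x) = (\<lambda>x. \<i> * op f x)"
    using f rot[OF ell2_delta f] rot_swap[OF ell2_delta f]
    by (auto simp: op_def fun_eq_iff complex_eq_iff)
  show "ell2_inner I f (op g) = ell2_inner I (op f) g"
    using *[OF f] *[of "\<lambda>x. \<i> * f x"] f i
    by (subst (1 2) ell2_inner_eq_Complex) (simp add: ell2_scale)
next
  fix c f assume f: "f \<in> ell2 I"
  have i: "op (\<lambda>x. \<i> * f x) = (\<lambda>x. \<i> * op f x)"
    using f rot[OF ell2_delta f] rot_swap[OF ell2_delta f]
    by (auto simp: op_def fun_eq_iff complex_eq_iff)
  have re: "op (\<lambda>x. of_real a * h x) = (\<lambda>x. of_real a * op h x)" if "h \<in> ell2 I" for a h
    using that by (auto simp: op_def fun_eq_iff complex_eq_iff scale ell2_delta ell2_scale)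
  have "(\<lambda>x. c * f x) = (\<lambda>x. of_real (Re c) * f x + of_real (Im c) * (\<i> * f x))"
    by (auto simp: complex_eq_iff)
  moreover have "op (\<lambda>x. of_real (Re c) * f x + of_real (Im c) * (\<i> * f x))
     = (\<lambda>x. op (\<lambda>x. of_real (Re c) * f x) x + op (\<lambda>x. of_real (Im c) * (\<i> * f x)) x)"
    using f by (auto simp: op_def fun_eq_iff complex_eq_iff add ell2_delta ell2_scale)
  ultimately have "op (\<lambda>x. c * f x) =
      (\<lambda>x. of_real (Re c) * op f x + of_real (Im c) * (\<i> * op f x))"
    using f re[of f "Re c"] re[of "\<lambda>x. \<i> * f x" "Im c"] i by (simp add: ell2_scale)
  then show "op (\<lambda>x. c * f x) = (\<lambda>x. c * op f x)"
    by (auto simp: complex_eq_iff)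
next
  show "\<exists>K. \<forall>f\<in>ell2 I. ell2_norm I (op f) \<le> K * ell2_norm I f"
    using op_norm by (intro exI[of _ 1]) auto
qed (rule op_ell2)

lemma ex_operator:
  "\<exists>T. selfadjoint_op I T \<and> (\<forall>f\<in>ell2 I. \<forall>g\<in>ell2 I. Re (ell2_inner I f (T g)) = r f g)"
  using op_selfadjoint op_represents by blast

end

section \<open>Polynomials of a self-adjoint operator\<close>

locale selfadjoint_operator =
  fixes I :: "'a set" and L :: "('a \<Rightarrow> complex) \<Rightarrow> ('a \<Rightarrow> complex)"
  assumes selfadjoint: "selfadjoint_op I L"
begin

lemma closed: "f \<in> ell2 I \<Longrightarrow> L f \<in> ell2 I"
  and add: "f \<in> ell2 I \<Longrightarrow> g \<in> ell2 I \<Longrightarrow> L (\<lambda>x. f x + g x) = (\<lambda>x. L f x + L g x)"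
  and scale: "f \<in> ell2 I \<Longrightarrow> L (\<lambda>x. c * f x) = (\<lambda>x. c * L f x)"
  and adjoint: "f \<in> ell2 I \<Longrightarrow> g \<in> ell2 I \<Longrightarrow> ell2_inner I f (L g) = ell2_inner I (L f) g"
  using selfadjoint by (auto simp: selfadjoint_op_def bounded_op_def)

lemma ex_norm_bound: "\<exists>K>0. \<forall>f\<in>ell2 I. ell2_norm I (L f) \<le> K * ell2_norm I f"
proof -
  obtain K where K: "\<forall>f\<in>ell2 I. ell2_norm I (L f) \<le> K * ell2_norm I f"
    using selfadjoint by (auto simp: selfadjoint_op_def bounded_op_def)
  have "ell2_norm I (L f) \<le> max K 1 * ell2_norm I f" if "f \<in> ell2 I" for f
    using K that by (meson ell2_norm_nonneg max.cobounded1 mult_right_mono order_trans)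
  then show ?thesis by (intro exI[of _ "max K 1"]) auto
qed

lemma zero: "L (\<lambda>_. 0) = (\<lambda>_. 0)"
  using scale[of "\<lambda>_. 0" 0] by simp

lemma sum:
  "(\<And>i. i \<in> J \<Longrightarrow> h i \<in> ell2 I) \<Longrightarrow> L (\<lambda>x. \<Sum>i\<in>J. h i x) = (\<lambda>x. \<Sum>i\<in>J. L (h i) x)"
  by (induction J rule: infinite_finite_induct) (auto simp: add ell2_sum zero)

lemma pow_closed: "f \<in> ell2 I \<Longrightarrow> (L ^^ n) f \<in> ell2 I"
  by (induction n) (auto intro: closed)

lemma pow_add:
  "f \<in> ell2 I \<Longrightarrow> g \<in> ell2 I \<Longrightarrow> (L ^^ n) (\<lambda>x. f x + g x) = (\<lambda>x. (L ^^ n) f x + (L ^^ n) g x)"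
  by (induction n) (auto simp: add pow_closed)

lemma pow_scale: "f \<in> ell2 I \<Longrightarrow> (L ^^ n) (\<lambda>x. c * f x) = (\<lambda>x. c * (L ^^ n) f x)"
  by (induction n) (auto simp: scale pow_closed)

definition pcalc :: "real poly \<Rightarrow> ('a \<Rightarrow> complex) \<Rightarrow> 'a \<Rightarrow> complex" where
  "pcalc p f = (\<lambda>x. \<Sum>i\<le>degree p. of_real (coeff p i) * (L ^^ i) f x)"

lemma pcalc_bound_degree:
  "degree p \<le> n \<Longrightarrow> pcalc p f = (\<lambda>x. \<Sum>i\<le>n. of_real (coeff p i) * (L ^^ i) f x)"
  unfolding pcalc_def by (intro ext sum.mono_neutral_left) (auto simp: coeff_eq_0)

lemma pcalc_closed: "f \<in> ell2 I \<Longrightarrow> pcalc p f \<in> ell2 I"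
  unfolding pcalc_def by (intro ell2_sum ell2_scale pow_closed)

lemma pcalc_zero: "pcalc 0 f = (\<lambda>_. 0)"
  by (simp add: pcalc_def)

lemma pcalc_one: "pcalc 1 f = f"
  by (simp add: pcalc_def)

lemma pcalc_monom: "pcalc (monom 1 n) f = (L ^^ n) f"
proof -
  have "pcalc (monom 1 n) f x = (\<Sum>i\<le>n. if i = n then (L ^^ i) f x else 0)" for x
    unfolding pcalc_def by (intro sum.cong) (auto simp: degree_monom_eq)
  then show ?thesis by (simp add: fun_eq_iff)
qed

lemma pcalc_add: "pcalc (p + q) f = (\<lambda>x. pcalc p f x + pcalc q f x)"
proof -
  have "degree (p + q) \<le> max (degree p) (degree q)" by (rule degree_add_le_max)
  then show ?thesis
    by (simp add: pcalc_bound_degree[of _ "max (degree p) (degree q)"] sum.distrib algebra_simps)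
qed

lemma pcalc_smult: "pcalc (smult c p) f = (\<lambda>x. of_real c * pcalc p f x)"
  by (cases "c = 0") (auto simp: pcalc_def sum_distrib_left mult.assoc)

lemma pcalc_pCons:
  assumes f: "f \<in> ell2 I"
  shows "pcalc (pCons a p) f = (\<lambda>x. of_real a * f x + L (pcalc p f) x)"
proof -
  have "L (pcalc p f) = (\<lambda>x. \<Sum>i\<le>degree p. of_real (coeff p i) * (L ^^ Suc i) f x)"
    unfolding pcalc_def using f by (subst sum) (auto simp: scale pow_closed ell2_scale)
  moreover have "pcalc (pCons a p) f
      = (\<lambda>x. \<Sum>i\<le>Suc (degree p). of_real (coeff (pCons a p) i) * (L ^^ i) f x)"
    by (rule pcalc_bound_degree) (rule degree_pCons_le)
  ultimately show ?thesis by (simp only: sum.atMost_Suc_shift) simp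
qed

lemma pcalc_vec_add:
  assumes "f \<in> ell2 I" "g \<in> ell2 I"
  shows "pcalc p (\<lambda>x. f x + g x) = (\<lambda>x. pcalc p f x + pcalc p g x)"
  using assms by (simp add: pcalc_def pow_add sum.distrib algebra_simps)

lemma pcalc_vec_scale: "f \<in> ell2 I \<Longrightarrow> pcalc p (\<lambda>x. c * f x) = (\<lambda>x. c * pcalc p f x)"
  by (simp add: pcalc_def pow_scale sum_distrib_left mult.left_commute)

lemma pcalc_mult:
  assumes f: "f \<in> ell2 I"
  shows "pcalc (p * q) f = pcalc p (pcalc q f)"
proof (induction p)
  case 0
  then show ?case by (simp add: pcalc_zero)
next
  case (pCons a p)
  have "pcalc (pCons a p * q) f = (\<lambda>x. of_real a * pcalc q f x + pcalc (pCons 0 (p * q)) f x)"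
    by (simp add: pcalc_add pcalc_smult)
  also have "\<dots> = (\<lambda>x. of_real a * pcalc q f x + L (pcalc p (pcalc q f)) x)"
    using f pCons.IH by (simp add: pcalc_pCons)
  also have "\<dots> = pcalc (pCons a p) (pcalc q f)"
    using f by (simp add: pcalc_pCons pcalc_closed)
  finally show ?case .
qed

lemma pcalc_adjoint:
  assumes f: "f \<in> ell2 I" and g: "g \<in> ell2 I"
  shows "ell2_inner I f (pcalc p g) = ell2_inner I (pcalc p f) g"
  using f
proof (induction p arbitrary: f)
  case 0
  then show ?case by (simp add: pcalc_zero ell2_inner_def)
next
  case (pCons a p)
  have L: "pcalc [:0, 1:] h = L h" if "h \<in> ell2 I" for h
    using that pcalc_monom[of 1 h] by (simp add: monom_altdef)
  have comm: "pcalc p (L f) = L (pcalc p f)"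
    using pCons.prems pcalc_mult[of f p "[:0, 1:]"] pcalc_mult[of f "[:0, 1:]" p]
    by (simp add: L pcalc_closed mult.commute)
  have "ell2_inner I f (pcalc (pCons a p) g)
      = of_real a * ell2_inner I f g + ell2_inner I (L f) (pcalc p g)"
    using pCons.prems g
    by (simp add: pcalc_pCons ell2_inner_add_right ell2_inner_scale_right ell2_scale pcalc_closed
        closed adjoint)
  also have "ell2_inner I (L f) (pcalc p g) = ell2_inner I (L (pcalc p f)) g"
    using pCons.IH[of "L f"] pCons.prems comm by (simp add: closed)
  also have "of_real a * ell2_inner I f g + \<dots> = ell2_inner I (pcalc (pCons a p) f) g"
    using pCons.prems g
    by (simp add: pcalc_pCons ell2_inner_add_left ell2_inner_scale_left ell2_scale pcalc_closed closed)
  finally show ?case .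
qed

text \<open>
  Real parts suffice, because \<open>p(L)\<close> is complex linear and symmetric.
\<close>

definition pform :: "real poly \<Rightarrow> ('a \<Rightarrow> complex) \<Rightarrow> ('a \<Rightarrow> complex) \<Rightarrow> real" where
  "pform p f g = Re (ell2_inner I f (pcalc p g))"

lemma pform_poly_add:
  "f \<in> ell2 I \<Longrightarrow> g \<in> ell2 I \<Longrightarrow> pform (p + q) f g = pform p f g + pform q f g"
  by (simp add: pform_def pcalc_add ell2_inner_add_right pcalc_closed)

lemma pform_poly_smult: "pform (smult c p) f g = c * pform p f g"
  by (simp add: pform_def pcalc_smult ell2_inner_scale_right)

lemma pform_sym:
  assumes "f \<in> ell2 I" "g \<in> ell2 I" shows "pform p f g = pform p g f"
  unfolding pform_def by (subst pcalc_adjoint[OF assms]) (rule Re_ell2_inner_commute)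

lemma pform_add:
  "f \<in> ell2 I \<Longrightarrow> g \<in> ell2 I \<Longrightarrow> h \<in> ell2 I \<Longrightarrow>
    pform p f (\<lambda>x. g x + h x) = pform p f g + pform p f h"
  by (simp add: pform_def pcalc_vec_add ell2_inner_add_right pcalc_closed)

lemma pform_add_left:
  "f \<in> ell2 I \<Longrightarrow> g \<in> ell2 I \<Longrightarrow> h \<in> ell2 I \<Longrightarrow>
    pform p (\<lambda>x. f x + g x) h = pform p f h + pform p g h"
  by (simp add: pform_def ell2_inner_add_left pcalc_closed)

lemma pform_scale:
  "f \<in> ell2 I \<Longrightarrow> g \<in> ell2 I \<Longrightarrow> pform p f (\<lambda>x. of_real c * g x) = c * pform p f g"
  by (simp add: pform_def pcalc_vec_scale ell2_inner_scale_right)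

lemma pform_scale_left:
  "f \<in> ell2 I \<Longrightarrow> g \<in> ell2 I \<Longrightarrow> pform p (\<lambda>x. of_real c * f x) g = c * pform p f g"
  by (simp add: pform_def ell2_inner_scale_left)

lemma pform_rot:
  "f \<in> ell2 I \<Longrightarrow> g \<in> ell2 I \<Longrightarrow> pform p (\<lambda>x. \<i> * f x) (\<lambda>x. \<i> * g x) = pform p f g"
  by (simp add: pform_def pcalc_vec_scale ell2_inner_scale_right ell2_inner_scale_left)

lemma pform_mult:
  assumes "f \<in> ell2 I" "g \<in> ell2 I"
  shows "pform (p * q) f g = pform q (pcalc p f) g" "pform (p * q) f g = pform p f (pcalc q g)"
  using assms unfolding pform_def
  by (auto simp: pcalc_mult pcalc_closed pcalc_adjoint[of f "pcalc q g"])

lemma pform_one: "pform 1 f f = (ell2_norm I f)\<^sup>2"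
  by (simp add: pform_def pcalc_one ell2_inner_self)

text \<open>
  For \<open>-K \<le> L \<le> K\<close> the operators \<open>K + L\<close> and \<open>K - L\<close> are positive, and so are all products of
  their powers: squares are absorbed into the vector, and what remains is at most a single factor of
  each kind, where \<open>2 K (K + L) (K - L) = (K + L)\<^sup>2 (K - L) + (K - L)\<^sup>2 (K + L)\<close>.
\<close>

lemma pform_bernstein_nonneg:
  assumes K: "0 < K" "\<forall>f\<in>ell2 I. ell2_norm I (L f) \<le> K * ell2_norm I f" and f: "f \<in> ell2 I"
  shows "0 \<le> pform ([:K, 1:] ^ k * [:K, -1:] ^ m) f f"
proof -
  let ?a = "[:K, 1:]" and ?b = "[:K, -1:]"
  have Lb: "\<bar>Re (ell2_inner I h (L h))\<bar> \<le> K * (ell2_norm I h)\<^sup>2" if "h \<in> ell2 I" for h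
  proof -
    have "\<bar>Re (ell2_inner I h (L h))\<bar> \<le> ell2_norm I h * ell2_norm I (L h)"
      by (intro Re_ell2_inner_bound closed that)
    also have "\<dots> \<le> ell2_norm I h * (K * ell2_norm I h)"
      using K that by (intro mult_left_mono) auto
    finally show ?thesis by (simp add: power2_eq_square mult_ac)
  qed
  have lin: "pform [:K, c:] h h = K * (ell2_norm I h)\<^sup>2 + c * Re (ell2_inner I h (L h))"
    if "h \<in> ell2 I" for c h
  proof -
    have "[:K, c:] = smult K 1 + smult c (monom 1 1)" by (simp add: monom_altdef)
    then show ?thesis using that
      by (simp only: pform_poly_add pform_poly_smult pform_one) (simp add: pform_def pcalc_monom)
  qed
  have a: "0 \<le> pform ?a h h" and b: "0 \<le> pform ?b h h" if "h \<in> ell2 I" for h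
    using Lb[OF that] by (auto simp: lin[OF that] abs_le_iff)
  have sq: "pform (p * p * q) h h = pform q (pcalc p h) (pcalc p h)" if "h \<in> ell2 I" for p q h
    using that by (simp add: pform_mult(1)[of _ _ p] pform_mult(2)[of _ _ q p] pcalc_closed mult.assoc mult.commute[of p q])
  have ab: "0 \<le> pform (?a * ?b) h h" if h: "h \<in> ell2 I" for h
  proof -
    have "smult (2 * K) (?a * ?b) = ?a * ?a * ?b + ?b * ?b * ?a" by (simp add: algebra_simps)
    then have "2 * K * pform (?a * ?b) h h = pform (?a * ?a * ?b + ?b * ?b * ?a) h h"
      by (metis pform_poly_smult)
    also have "\<dots> \<ge> 0" using h by (simp only: pform_poly_add sq) (simp add: a b pcalc_closed)
    finally show ?thesis using K by (simp add: zero_le_mult_iff)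
  qed
  define p where "p = ?a ^ (k div 2) * ?b ^ (m div 2)"
  have split: "c ^ n = c ^ (n div 2) * c ^ (n div 2) * c ^ (n mod 2)" for c :: "real poly" and n
    by (metis power_add mult_2 mult.commute[of 2] div_mult_mod_eq)
  have "?a ^ k * ?b ^ m = p * p * (?a ^ (k mod 2) * ?b ^ (m mod 2))"
    unfolding p_def by (subst split[of ?a k], subst split[of ?b m]) (simp only: mult_ac)
  moreover have "0 \<le> pform (?a ^ (k mod 2) * ?b ^ (m mod 2)) (pcalc p f) (pcalc p f)"
    using a[OF pcalc_closed[OF f, of p]] b[OF pcalc_closed[OF f, of p]] ab[OF pcalc_closed[OF f, of p]]
    by (cases "even k"; cases "even m") (simp_all add: mod2_eq_if pform_one)
  ultimately show ?thesis using f by (simp only: sq)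
qed

end

section \<open>Measures on an interval and their moments\<close>

text \<open>
  Two approximations turn identities between moments into identities between measures: polynomials
  converge boundedly to indicators of half-lines, and simple functions to bounded Borel functions.
  Signed measures appear as finite families of positive measures \<open>\<mu> i\<close> with weight functions \<open>w i\<close>.
\<close>

lemma continuous_poly_approx:
  fixes \<phi> :: "real \<Rightarrow> real"
  assumes "continuous_on {-K..K} \<phi>" "0 < e"
  obtains p where "\<And>t. \<bar>t\<bar> \<le> K \<Longrightarrow> \<bar>\<phi> t - poly p t\<bar> < e"
proof -
  obtain g where g: "real_polynomial_function g" "\<And>x. x \<in> {-K..K} \<Longrightarrow> \<bar>\<phi> x - g x\<bar> < e"
    using Stone_Weierstrass_real_polynomial_function[OF compact_Icc assms] by blast
  obtain a n where "g = (\<lambda>x. \<Sum>i\<le>n. a i * x ^ i)"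
    using g(1) by (auto simp: real_polynomial_function_iff_sum)
  then have "g x = poly (\<Sum>i\<le>n. monom (a i) i) x" for x
    by (simp add: poly_sum poly_monom)
  then show thesis using g(2) by (intro that[of "\<Sum>i\<le>n. monom (a i) i"]) (auto simp: abs_le_iff)
qed

lemma poly_measurable: "poly (p :: real poly) \<in> borel_measurable borel"
  by (intro borel_measurable_continuous_onI continuous_intros)

lemma halfline_poly_approx:
  fixes a K :: real
  obtains p :: "nat \<Rightarrow> real poly"
  where "\<And>t. \<bar>t\<bar> \<le> K \<Longrightarrow> (\<lambda>j. poly (p j) t) \<longlonglongrightarrow> indicator {..a} t"
    and "\<And>j t. \<bar>t\<bar> \<le> K \<Longrightarrow> \<bar>poly (p j) t\<bar> \<le> 2"
proof -
  \<comment> \<open>continuous ramps that fall from 1 to 0 over an interval of length \<open>1 / j\<close> to the right of \<open>a\<close>\<close>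
  define \<phi> where "\<phi> j t = max 0 (min 1 (1 - real j * (t - a)))" for j t
  have "\<exists>q. \<forall>t. \<bar>t\<bar> \<le> K \<longrightarrow> \<bar>\<phi> j t - poly q t\<bar> < 1 / (real j + 1)" for j
  proof -
    have "continuous_on {-K..K} (\<phi> j)" unfolding \<phi>_def by (intro continuous_intros)
    then show ?thesis by (rule continuous_poly_approx[of K "\<phi> j" "1 / (real j + 1)"]) auto
  qed
  then obtain p where p: "\<And>j t. \<bar>t\<bar> \<le> K \<Longrightarrow> \<bar>\<phi> j t - poly (p j) t\<bar> < 1 / (real j + 1)"
    by metis
  show thesis
  proof (rule that[of p])
    fix t :: real assume t: "\<bar>t\<bar> \<le> K"
    have "(\<lambda>j. \<phi> j t) \<longlonglongrightarrow> indicator {..a} t"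
    proof (cases "t \<le> a")
      case True
      then have "\<phi> j t = 1" for j by (simp add: \<phi>_def mult_nonneg_nonpos)
      then show ?thesis using True by simp
    next
      case False
      obtain N :: nat where N: "1 / (t - a) \<le> real N" using real_arch_simple by blast
      have "\<phi> j t = 0" if "j \<ge> N" for j
      proof -
        have "1 / (t - a) \<le> real j" using N that by simp
        then have "1 \<le> real j * (t - a)" using False by (simp add: field_simps)
        then show ?thesis by (simp add: \<phi>_def)
      qed
      then have "\<forall>\<^sub>F j in sequentially. \<phi> j t = 0" by (auto simp: eventually_sequentially)
      then show ?thesis using False by (simp add: tendsto_eventually)
    qed
    moreover have "(\<lambda>j. poly (p j) t - \<phi> j t) \<longlonglongrightarrow> 0"
    proof (rule Lim_null_comparison)
      show "\<forall>\<^sub>F j in sequentially. norm (poly (p j) t - \<phi> j t) \<le> inverse (real (Suc j))"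
        using p[OF t] by (intro always_eventually allI) (smt (verit) inverse_eq_divide of_nat_Suc real_norm_def)
      show "(\<lambda>j. inverse (real (Suc j))) \<longlonglongrightarrow> 0" by (rule LIMSEQ_inverse_real_of_nat)
    qed
    ultimately have "(\<lambda>j. \<phi> j t + (poly (p j) t - \<phi> j t)) \<longlonglongrightarrow> indicator {..a} t + 0"
      by (rule tendsto_add)
    then show "(\<lambda>j. poly (p j) t) \<longlonglongrightarrow> indicator {..a} t" by simp
  next
    fix j and t :: real assume t: "\<bar>t\<bar> \<le> K"
    have "\<bar>\<phi> j t\<bar> \<le> 1" by (simp add: \<phi>_def)
    moreover have "1 / (real j + 1) \<le> 1" by simp
    ultimately show "\<bar>poly (p j) t\<bar> \<le> 2" using p[OF t, of j] by linarith
  qed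
qed

text \<open>
  Dominated convergence for all members of the family at once. Bound and limit are required almost
  everywhere only, so that functions need to be controlled on the support of the measures alone.
\<close>

lemma weighted_integral_limit:
  fixes \<mu> :: "'i \<Rightarrow> real measure" and w :: "'i \<Rightarrow> real \<Rightarrow> real" and \<phi> :: "nat \<Rightarrow> real \<Rightarrow> real"
  assumes sets: "\<And>i. i \<in> J \<Longrightarrow> sets (\<mu> i) = sets borel"
    and w: "\<And>i. i \<in> J \<Longrightarrow> integrable (\<mu> i) (w i)"
    and meas: "\<And>n. \<phi> n \<in> borel_measurable borel" "\<psi> \<in> borel_measurable borel"
    and bound: "\<And>i n. i \<in> J \<Longrightarrow> AE t in \<mu> i. \<bar>\<phi> n t\<bar> \<le> C"
    and lim: "\<And>i. i \<in> J \<Longrightarrow> AE t in \<mu> i. (\<lambda>n. \<phi> n t) \<longlonglongrightarrow> \<psi> t"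
    and zero: "\<And>n. (\<Sum>i\<in>J. \<integral>t. w i t * \<phi> n t \<partial>\<mu> i) = 0"
  shows "(\<Sum>i\<in>J. \<integral>t. w i t * \<psi> t \<partial>\<mu> i) = 0"
proof -
  have "(\<lambda>n. \<integral>t. w i t * \<phi> n t \<partial>\<mu> i) \<longlonglongrightarrow> (\<integral>t. w i t * \<psi> t \<partial>\<mu> i)" if i: "i \<in> J" for i
  proof (rule integral_dominated_convergence[where w = "\<lambda>t. \<bar>w i t\<bar> * C"])
    have m: "w i \<in> borel_measurable (\<mu> i)" using w[OF i] by simp
    have b: "borel_measurable (\<mu> i) = borel_measurable borel"
      by (rule measurable_cong_sets[OF sets[OF i] refl])
    show "(\<lambda>t. w i t * \<psi> t) \<in> borel_measurable (\<mu> i)" "\<And>n. (\<lambda>t. w i t * \<phi> n t) \<in> borel_measurable (\<mu> i)"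
      using m meas by (auto simp: b)
    show "integrable (\<mu> i) (\<lambda>t. \<bar>w i t\<bar> * C)" using w[OF i] by simp
    show "AE t in \<mu> i. (\<lambda>n. w i t * \<phi> n t) \<longlonglongrightarrow> w i t * \<psi> t"
      using lim[OF i] by eventually_elim (intro tendsto_mult tendsto_const)
    show "AE t in \<mu> i. norm (w i t * \<phi> n t) \<le> \<bar>w i t\<bar> * C" for n
      using bound[OF i, of n] by eventually_elim (simp add: abs_mult mult_left_mono)
  qed
  then have "(\<lambda>n. \<Sum>i\<in>J. \<integral>t. w i t * \<phi> n t \<partial>\<mu> i) \<longlonglongrightarrow> (\<Sum>i\<in>J. \<integral>t. w i t * \<psi> t \<partial>\<mu> i)"
    by (intro tendsto_sum)
  from LIMSEQ_unique[OF this[unfolded zero] tendsto_const] show ?thesis .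
qed

lemma integrable_weight_mult:
  fixes w \<phi> :: "real \<Rightarrow> real"
  assumes "sets \<mu> = sets borel" "integrable \<mu> w" "\<phi> \<in> borel_measurable borel"
    and "AE t in \<mu>. \<bar>\<phi> t\<bar> \<le> C"
  shows "integrable \<mu> (\<lambda>t. w t * \<phi> t)"
proof (rule Bochner_Integration.integrable_bound[of _ "\<lambda>t. \<bar>w t\<bar> * C"])
  show "integrable \<mu> (\<lambda>t. \<bar>w t\<bar> * C)" using assms(2) by simp
  have "(borel_measurable \<mu> :: (real \<Rightarrow> real) set) = borel_measurable borel" by (rule measurable_cong_sets[OF assms(1) refl])
  then show "(\<lambda>t. w t * \<phi> t) \<in> borel_measurable \<mu>"
    using assms(3) by (intro borel_measurable_times borel_measurable_integrable[OF assms(2)]) simp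
  show "AE t in \<mu>. norm (w t * \<phi> t) \<le> norm (\<bar>w t\<bar> * C)"
    using assms(4) by eventually_elim (auto simp: abs_mult intro!: mult_left_mono)
qed

text \<open>
  Vanishing of all weighted moments passes to half-lines by polynomial approximation, and from these
  to all Borel sets because the sets with vanishing sum form a Dynkin system.
\<close>

lemma weighted_moments_determine_sets:
  fixes \<mu> :: "'i \<Rightarrow> real measure" and w :: "'i \<Rightarrow> real \<Rightarrow> real"
  assumes sets: "\<And>i. i \<in> J \<Longrightarrow> sets (\<mu> i) = sets borel"
    and w: "\<And>i. i \<in> J \<Longrightarrow> integrable (\<mu> i) (w i)"
    and K: "\<And>i. i \<in> J \<Longrightarrow> AE t in \<mu> i. \<bar>t\<bar> \<le> K"
    and moments: "\<And>p. (\<Sum>i\<in>J. \<integral>t. w i t * poly p t \<partial>\<mu> i) = 0"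
    and S: "S \<in> sets borel"
  shows "(\<Sum>i\<in>J. \<integral>t. w i t * indicator S t \<partial>\<mu> i) = 0"
proof -
  have one: "(\<Sum>i\<in>J. \<integral>t. w i t \<partial>\<mu> i) = 0" using moments[of 1] by simp
  have ind: "integrable (\<mu> i) (\<lambda>t. w i t * indicator A t)" if "i \<in> J" "A \<in> sets borel" for i A
    using that by (intro integrable_weight_mult[where C = 1] sets w) (auto split: split_indicator)
  have "Int_stable (range (\<lambda>a::real. {..a}))" by (auto simp: Int_stable_def)
  moreover have "range (\<lambda>a::real. {..a}) \<subseteq> Pow UNIV" by simp
  moreover have "S \<in> sigma_sets UNIV (range (\<lambda>a. {..a}))"
    using S by (simp add: borel_eq_atMost sets_measure_of_conv)
  ultimately show ?thesis
  proof (induction rule: sigma_sets_induct_disjoint)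
    case (basic A)
    then obtain a where A: "A = {..a}" by auto
    obtain p where p: "\<And>t. \<bar>t\<bar> \<le> K \<Longrightarrow> (\<lambda>j. poly (p j) t) \<longlonglongrightarrow> (indicator {..a} t :: real)"
        "\<And>j t. \<bar>t\<bar> \<le> K \<Longrightarrow> \<bar>poly (p j) t\<bar> \<le> 2"
      by (rule halfline_poly_approx[of K a]) blast
    show ?case unfolding A
    proof (rule weighted_integral_limit[where \<phi> = "\<lambda>j. poly (p j)" and C = 2])
      fix i n assume "i \<in> J"
      from K[OF this] show "AE t in \<mu> i. \<bar>poly (p n) t\<bar> \<le> 2"
        "AE t in \<mu> i. (\<lambda>n. poly (p n) t) \<longlonglongrightarrow> indicator {..a} t"
        by (eventually_elim, simp add: p)+
    qed (use moments w sets in \<open>auto intro: poly_measurable\<close>)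
  next
    case empty
    show ?case by simp
  next
    case (compl A)
    have A: "A \<in> sets borel" using compl by (simp add: borel_eq_atMost sets_measure_of_conv)
    have "(\<integral>t. w i t * indicator (UNIV - A) t \<partial>\<mu> i)
        = (\<integral>t. w i t \<partial>\<mu> i) - (\<integral>t. w i t * indicator A t \<partial>\<mu> i)" if "i \<in> J" for i
    proof -
      have "(\<integral>t. w i t \<partial>\<mu> i) - (\<integral>t. w i t * indicator A t \<partial>\<mu> i)
          = (\<integral>t. w i t - w i t * indicator A t \<partial>\<mu> i)"
        using that A by (intro Bochner_Integration.integral_diff[symmetric] w ind)
      also have "(\<lambda>t. w i t - w i t * indicator A t) = (\<lambda>t. w i t * indicator (UNIV - A) t)"
        by (auto split: split_indicator)
      finally show ?thesis by simp
    qed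
    then show ?case using one compl by (simp add: sum_subtractf)
  next
    case (union A)
    have A: "A n \<in> sets borel" for n
      using union(2) by (auto simp: borel_eq_atMost sets_measure_of_conv)
    have disj: "(\<Sum>k<n. indicator (A k) t) = (indicator (\<Union>k<n. A k) t :: real)" for n t
      using union(1) by (intro indicator_UN_disjoint[symmetric]) (auto simp: disjoint_family_on_def)
    show ?case
    proof (rule weighted_integral_limit[where \<phi> = "\<lambda>n t. \<Sum>k<n. indicator (A k) t" and C = 1])
      show "(\<Sum>i\<in>J. \<integral>t. w i t * (\<Sum>k<n. indicator (A k) t) \<partial>\<mu> i) = 0" for n
      proof -
        have "(\<Sum>i\<in>J. \<integral>t. w i t * (\<Sum>k<n. indicator (A k) t) \<partial>\<mu> i)
            = (\<Sum>i\<in>J. \<Sum>k<n. \<integral>t. w i t * indicator (A k) t \<partial>\<mu> i)"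
          unfolding sum_distrib_left
          by (intro sum.cong refl Bochner_Integration.integral_sum ind A)
        also have "\<dots> = 0" using union by (subst sum.swap) simp
        finally show ?thesis .
      qed
      fix i assume "i \<in> J"
      show "AE t in \<mu> i. (\<lambda>n. \<Sum>k<n. indicator (A k) t) \<longlonglongrightarrow> (indicator (\<Union>k. A k) t :: real)"
        unfolding disj by (intro AE_I2 LIMSEQ_indicator_UN)
      show "AE t in \<mu> i. \<bar>\<Sum>k<n. indicator (A k) t\<bar> \<le> (1::real)" for n
        unfolding disj by (auto split: split_indicator)
    qed (use A sets w in auto)
  qed
qed

lemma weighted_sets_determine_integrals:
  fixes \<mu> :: "'i \<Rightarrow> real measure" and w :: "'i \<Rightarrow> real \<Rightarrow> real" and \<phi> :: "real \<Rightarrow> real"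
  assumes sets: "\<And>i. i \<in> J \<Longrightarrow> sets (\<mu> i) = sets borel"
    and w: "\<And>i. i \<in> J \<Longrightarrow> integrable (\<mu> i) (w i)"
    and eq: "\<And>S. S \<in> sets borel \<Longrightarrow> (\<Sum>i\<in>J. \<integral>t. w i t * indicator S t \<partial>\<mu> i) = 0"
    and \<phi>: "\<phi> \<in> borel_measurable borel" and bound: "\<And>i. i \<in> J \<Longrightarrow> AE t in \<mu> i. \<bar>\<phi> t\<bar> \<le> C"
  shows "(\<Sum>i\<in>J. \<integral>t. w i t * \<phi> t \<partial>\<mu> i) = 0"
proof -
  obtain F where F: "\<And>i. simple_function borel (F i)" "\<And>x. (\<lambda>i. F i x) \<longlonglongrightarrow> \<phi> x"
      "\<And>i x. dist (F i x) 0 \<le> 2 * dist (\<phi> x) 0"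
    using borel_measurable_implies_sequence_metric[OF \<phi>, of 0] by auto
  show ?thesis
  proof (rule weighted_integral_limit[where \<phi> = F and C = "2 * C"])
    show "F n \<in> borel_measurable borel" for n using F(1) by (rule borel_measurable_simple_function)
    show "AE t in \<mu> i. \<bar>F n t\<bar> \<le> 2 * C" if "i \<in> J" for i n
      using bound[OF that] by eventually_elim (use F(3)[of n] in \<open>simp add: dist_real_def, meson mult_left_mono order_trans zero_le_numeral\<close>)
    show "(\<Sum>i\<in>J. \<integral>t. w i t * F n t \<partial>\<mu> i) = 0" for n
    proof -
      have fin: "finite (range (F n))" using F(1)[of n] by (simp add: simple_function_def)
      have m: "F n -` {y} \<in> sets borel" for y
        using measurable_sets[OF borel_measurable_simple_function[OF F(1)[of n]], of "{y}"] by simp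
      have rep: "F n t = (\<Sum>y\<in>range (F n). y * indicator (F n -` {y}) t)" for t
      proof -
        have "(\<Sum>y\<in>range (F n). y * indicator (F n -` {y}) t) = (\<Sum>y\<in>{F n t}. y * indicator (F n -` {y}) t)"
          using fin by (intro sum.mono_neutral_right) (auto split: split_indicator)
        then show ?thesis by simp
      qed
      have "(\<integral>t. w i t * F n t \<partial>\<mu> i)
          = (\<Sum>y\<in>range (F n). y * (\<integral>t. w i t * indicator (F n -` {y}) t \<partial>\<mu> i))" if "i \<in> J" for i
      proof -
        have int: "integrable (\<mu> i) (\<lambda>t. w i t * indicator (F n -` {y}) t)" for y
          using that m by (intro integrable_weight_mult[where C = 1] sets w) (auto split: split_indicator)
        have "(\<integral>t. w i t * F n t \<partial>\<mu> i)
            = (\<integral>t. (\<Sum>y\<in>range (F n). y * (w i t * indicator (F n -` {y}) t)) \<partial>\<mu> i)"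
          by (subst rep) (simp add: sum_distrib_left mult.left_commute)
        also have "\<dots> = (\<Sum>y\<in>range (F n). y * (\<integral>t. w i t * indicator (F n -` {y}) t \<partial>\<mu> i))"
          using int by (subst Bochner_Integration.integral_sum) auto
        finally show ?thesis .
      qed
      then have "(\<Sum>i\<in>J. \<integral>t. w i t * F n t \<partial>\<mu> i)
          = (\<Sum>i\<in>J. \<Sum>y\<in>range (F n). y * (\<integral>t. w i t * indicator (F n -` {y}) t \<partial>\<mu> i))"
        by simp
      also have "\<dots> = (\<Sum>y\<in>range (F n). y * (\<Sum>i\<in>J. \<integral>t. w i t * indicator (F n -` {y}) t \<partial>\<mu> i))"
        by (subst sum.swap) (simp add: sum_distrib_left)
      finally show ?thesis using eq[OF m] by simp
    qed
  qed (use F \<phi> sets w in auto)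
qed

section \<open>Representing a positive functional on polynomials by a measure\<close>

text \<open>
  Both numbers are products of \<open>j\<close> factors, \<open>k / n\<close> and \<open>(k - i) / (n - i)\<close>, that lie in \<open>[-1, 1]\<close> and
  differ pairwise by at most \<open>j / (n - j)\<close>.
\<close>

lemma choose_ratio_approx:
  assumes "2 * j \<le> n" "k \<le> n" "0 < n"
  shows "\<bar>(real k / real n) ^ j - real (k choose j) / real (n choose j)\<bar> \<le> real j * (real j / (real n - real j))"
proof -
  have ch: "real (m choose j) = (\<Prod>i=0..<j. real m - real i) / fact j" for m
    by (simp add: binomial_gbinomial gbinomial_prod_rev)
  have ratio: "real (k choose j) / real (n choose j) = (\<Prod>i=0..<j. (real k - real i) / (real n - real i))"
    by (simp add: ch prod_dividef)
  have pow: "(real k / real n) ^ j = (\<Prod>i=0..<j. real k / real n)" by simp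
  have "\<bar>(\<Prod>i=0..<j. real k / real n) - (\<Prod>i=0..<j. (real k - real i) / (real n - real i))\<bar>
      \<le> (\<Sum>i=0..<j. \<bar>real k / real n - (real k - real i) / (real n - real i)\<bar>)"
    unfolding real_norm_def[symmetric]
  proof (rule norm_prod_diff)
    show "norm (real k / real n) \<le> 1" using assms by simp
    show "norm ((real k - real i) / (real n - real i)) \<le> 1" if "i \<in> {0..<j}" for i
      using assms that by (auto simp: abs_le_iff divide_simps)
  qed
  also have "\<dots> \<le> (\<Sum>i=0..<j. real j / (real n - real j))"
  proof (rule sum_mono)
    fix i assume i: "i \<in> {0..<j}"
    have n: "0 < real n - real i" "0 < real n" "0 < real n - real j" using i assms by auto
    have d: "real k / real n - (real k - real i) / (real n - real i)
        = (real i / (real n - real i)) * ((real n - real k) / real n)"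
      using n by (simp add: field_simps)
    have "\<bar>real k / real n - (real k - real i) / (real n - real i)\<bar>
        = (real i / (real n - real i)) * ((real n - real k) / real n)"
      unfolding d using n assms by (simp add: abs_mult)
    also have "\<dots> \<le> (real i / (real n - real i)) * 1"
      using n assms by (intro mult_left_mono) auto
    also have "\<dots> \<le> real j / (real n - real j)"
      using i n by (auto intro!: frac_le)
    finally show "\<bar>real k / real n - (real k - real i) / (real n - real i)\<bar> \<le> real j / (real n - real j)" .
  qed
  finally show ?thesis unfolding ratio pow by simp
qed

text \<open>
  For \<open>x + y = 1\<close> these are the factorial moments of the binomial distribution.
\<close>

lemma binomial_choose_sum:
  fixes x y :: "'a :: comm_ring_1"
  assumes "j \<le> n"
  shows "(\<Sum>k\<le>n. of_nat (k choose j) * (of_nat (n choose k) * (x ^ k * y ^ (n - k))))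
     = of_nat (n choose j) * (x ^ j * (x + y) ^ (n - j))"
proof -
  have "(\<Sum>k\<le>n. of_nat (k choose j) * (of_nat (n choose k) * (x ^ k * y ^ (n - k))))
      = (\<Sum>k\<in>{j..n}. of_nat (k choose j) * (of_nat (n choose k) * (x ^ k * y ^ (n - k))))"
    by (intro sum.mono_neutral_right) (auto simp: binomial_eq_0 not_le)
  also have "\<dots> = (\<Sum>i\<le>n - j. of_nat ((j + i) choose j) * (of_nat (n choose (j + i)) * (x ^ (j + i) * y ^ (n - (j + i)))))"
    using assms by (intro sum.reindex_bij_witness[of _ "\<lambda>i. j + i" "\<lambda>k. k - j"]) auto
  also have "\<dots> = (\<Sum>i\<le>n - j. of_nat (n choose j) * x ^ j * (of_nat ((n - j) choose i) * x ^ i * y ^ (n - j - i)))"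
  proof (rule sum.cong[OF refl])
    fix i assume i: "i \<in> {..n - j}"
    have "of_nat ((j + i) choose j) * of_nat (n choose (j + i))
        = (of_nat (n choose j) * of_nat ((n - j) choose i) :: 'a)"
      unfolding of_nat_mult[symmetric] using choose_mult[of j "j + i" n] i assms
      by (simp add: mult.commute)
    then show "of_nat ((j + i) choose j) * (of_nat (n choose (j + i)) * (x ^ (j + i) * y ^ (n - (j + i))))
        = of_nat (n choose j) * x ^ j * (of_nat ((n - j) choose i) * x ^ i * y ^ (n - j - i))"
      by (simp add: power_add mult_ac) (metis mult.assoc mult.commute)
  qed
  also have "\<dots> = of_nat (n choose j) * (x ^ j * (x + y) ^ (n - j))"
    by (simp add: binomial_ring sum_distrib_left mult.assoc)
  finally show ?thesis .
qed

text \<open>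
  A linear functional on polynomials that is positive on \<open>[0, 1]\<close> in the weak sense that it is
  nonnegative on products of powers of \<open>t\<close> and \<open>1 - t\<close>.
\<close>

locale positive_functional =
  fixes F :: "real poly \<Rightarrow> real"
  assumes add: "F (p + q) = F p + F q"
    and smult: "F (smult c p) = c * F p"
    and one: "F 1 = 1"
    and nonneg: "0 \<le> F ([:0, 1:] ^ k * [:1, -1:] ^ m)"
begin

lemma sum: "F (\<Sum>i\<in>J. h i) = (\<Sum>i\<in>J. F (h i))"
  using smult[of 0 0] by (induction J rule: infinite_finite_induct) (auto simp: add)

lemma of_nat_mult: "F (of_nat n * p) = real n * F p"
  by (simp add: of_nat_poly smult)

definition weight :: "nat \<Rightarrow> nat \<Rightarrow> real" where
  "weight n k = real (n choose k) * F ([:0, 1:] ^ k * [:1, -1:] ^ (n - k))"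

lemma weight_nonneg: "0 \<le> weight n k"
  using nonneg by (simp add: weight_def)

text \<open>
  The weights reproduce \<open>F\<close> on monomials exactly if powers of \<open>k / n\<close> are replaced by ratios of
  binomial coefficients. By \<open>choose_ratio_approx\<close> this costs nothing in the limit.
\<close>

lemma weight_moment:
  assumes "j \<le> n"
  shows "(\<Sum>k\<le>n. real (k choose j) / real (n choose j) * weight n k) = F (monom 1 j)"
proof -
  have xy: "[:0, 1:] + [:1, -1:] = (1 :: real poly)" by simp
  have "(\<Sum>k\<le>n. real (k choose j) * weight n k)
      = F (\<Sum>k\<le>n. of_nat (k choose j) * (of_nat (n choose k) * ([:0, 1:] ^ k * [:1, -1:] ^ (n - k))))"
    by (simp only: sum of_nat_mult weight_def)
  also have "\<dots> = F (of_nat (n choose j) * ([:0, 1:] ^ j * ([:0, 1:] + [:1, -1:]) ^ (n - j)))"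
    using assms by (simp only: binomial_choose_sum)
  also have "\<dots> = real (n choose j) * F (monom 1 j)"
    by (simp only: xy of_nat_mult) (simp add: monom_altdef)
  finally have "(\<Sum>k\<le>n. real (k choose j) * weight n k) / real (n choose j) = F (monom 1 j)"
    using assms by simp
  then show ?thesis by (simp add: sum_divide_distrib)
qed

lemma weight_sum: "(\<Sum>k\<le>n. weight n k) = 1"
  using weight_moment[of 0 n] one by (simp add: one_pCons)

text \<open>The distribution behind the Bernstein polynomial of degree \<open>n\<close>.\<close>

definition bernstein_measure :: "nat \<Rightarrow> real measure" where
  "bernstein_measure n = distr (point_measure {..n} (weight n)) borel (\<lambda>k. real k / real n)"

lemma real_distribution_bernstein: "real_distribution (bernstein_measure n)"
proof -
  have "prob_space (point_measure {..n} (weight n))"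
    by (rule prob_spaceI)
      (simp add: emeasure_point_measure_finite space_point_measure weight_nonneg weight_sum sum_ennreal)
  then have "prob_space (bernstein_measure n)"
    unfolding bernstein_measure_def by (rule prob_space.prob_space_distr) simp
  then show ?thesis
    by (simp add: real_distribution_def real_distribution_axioms_def bernstein_measure_def)
qed

lemma integral_bernstein:
  fixes \<phi> :: "real \<Rightarrow> real"
  assumes "\<phi> \<in> borel_measurable borel"
  shows "(\<integral>t. \<phi> t \<partial>bernstein_measure n) = (\<Sum>k\<le>n. weight n k * \<phi> (real k / real n))"
  unfolding bernstein_measure_def using assms
  by (simp add: integral_distr lebesgue_integral_point_measure_finite weight_nonneg)

lemma measure_bernstein: "measure (bernstein_measure n) {-1<..1} = 1"
proof -
  interpret real_distribution "bernstein_measure n" by (rule real_distribution_bernstein)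
  have "measure (bernstein_measure n) {-1<..1} = (\<integral>t. indicator {-1<..1} t \<partial>bernstein_measure n)"
    by simp
  also have "\<dots> = (\<Sum>k\<le>n. weight n k * 1)"
    by (subst integral_bernstein) (auto split: split_indicator simp: divide_simps intro!: sum.cong)
  finally show ?thesis by (simp add: weight_sum)
qed

lemma bernstein_moment_tendsto:
  "(\<lambda>n. \<Sum>k\<le>n. weight n k * (real k / real n) ^ j) \<longlonglongrightarrow> F (monom 1 j)"
proof -
  have "(\<lambda>n. (\<Sum>k\<le>n. weight n k * (real k / real n) ^ j) - F (monom 1 j)) \<longlonglongrightarrow> 0"
  proof (rule Lim_null_comparison)
    show "(\<lambda>n. real j * (real j / (real n - real j))) \<longlonglongrightarrow> 0" by real_asymp
    show "\<forall>\<^sub>F n in sequentially. norm ((\<Sum>k\<le>n. weight n k * (real k / real n) ^ j) - F (monom 1 j))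
        \<le> real j * (real j / (real n - real j))"
      using eventually_ge_at_top[of "2 * j + 1"]
    proof eventually_elim
      fix n assume n: "2 * j + 1 \<le> n"
      have diff: "(\<Sum>k\<le>n. weight n k * (real k / real n) ^ j) - F (monom 1 j)
         = (\<Sum>k\<le>n. weight n k * ((real k / real n) ^ j - real (k choose j) / real (n choose j)))"
        using n by (subst weight_moment[of j n, symmetric])
          (auto simp: sum_subtractf right_diff_distrib mult.commute)
      have "norm ((\<Sum>k\<le>n. weight n k * (real k / real n) ^ j) - F (monom 1 j))
         \<le> (\<Sum>k\<le>n. \<bar>weight n k * ((real k / real n) ^ j - real (k choose j) / real (n choose j))\<bar>)"
        unfolding diff real_norm_def by (rule sum_abs)
      also have "\<dots> \<le> (\<Sum>k\<le>n. weight n k * (real j * (real j / (real n - real j))))"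
        unfolding abs_mult abs_of_nonneg[OF weight_nonneg] using n
        by (intro sum_mono mult_left_mono[OF choose_ratio_approx weight_nonneg]) auto
      also have "\<dots> = real j * (real j / (real n - real j))"
        by (simp only: sum_distrib_right[symmetric] weight_sum mult_1)
      finally show "norm ((\<Sum>k\<le>n. weight n k * (real k / real n) ^ j) - F (monom 1 j))
        \<le> real j * (real j / (real n - real j))" .
    qed
  qed
  then show ?thesis using LIM_zero_iff by blast
qed

text \<open>
  The Bernstein measures live on \<open>[0, 1]\<close>, hence are tight, and Helly's theorem provides a weak limit
  point. Weak convergence is tested on functions \<open>h\<close> that are bounded and continuous on the whole
  line and agree on \<open>[0, 1]\<close> with zero, respectively with a power of \<open>t\<close>.
\<close>

lemma ex_measure:
  "\<exists>\<mu>. real_distribution \<mu> \<and> (AE t in \<mu>. 0 \<le> t \<and> t \<le> 1) \<and> (\<forall>p. F p = (\<integral>t. poly p t \<partial>\<mu>))"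
proof -
  have "tight bernstein_measure"
    unfolding tight_def
  proof (intro conjI allI impI)
    fix e :: real assume "0 < e"
    then show "\<exists>a b. a < b \<and> (\<forall>n. 1 - e < measure (bernstein_measure n) {a<..b})"
      by (intro exI[of _ "-1"] exI[of _ 1]) (simp add: measure_bernstein)
  qed (rule real_distribution_bernstein)
  then obtain s \<mu> where s: "strict_mono (s :: nat \<Rightarrow> nat)" and \<mu>: "real_distribution \<mu>"
    and conv: "weak_conv_m (bernstein_measure \<circ> s) \<mu>"
    using tight_imp_convergent_subsubsequence[of bernstein_measure id] by (auto simp: strict_mono_def)
  interpret real_distribution \<mu> by fact
  have lim: "(\<lambda>n. \<Sum>k\<le>s n. weight (s n) k * \<phi> (real k / real (s n))) \<longlonglongrightarrow> (\<integral>t. \<phi> t \<partial>\<mu>)"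
    if c: "\<And>x. isCont \<phi> x" and "\<And>x. \<bar>\<phi> x\<bar> \<le> 1" for \<phi> :: "real \<Rightarrow> real"
  proof -
    have "(\<lambda>n. \<integral>t. \<phi> t \<partial>(bernstein_measure \<circ> s) n) \<longlonglongrightarrow> (\<integral>t. \<phi> t \<partial>\<mu>)"
      using that by (intro weak_conv_imp_integral_bdd_continuous_conv[OF _ \<mu> conv, where B = 1])
        (auto simp: real_distribution_bernstein)
    moreover have "\<phi> \<in> borel_measurable borel"
      using c by (intro borel_measurable_continuous_onI continuous_at_imp_continuous_on) auto
    ultimately show ?thesis by (simp add: integral_bernstein)
  qed
  have supp: "AE t in \<mu>. 0 \<le> t \<and> t \<le> 1"
  proof -
    define h where "h t = min 1 (max 0 (max (t - 1) (- t)))" for t :: real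
    have c: "isCont h x" for x unfolding h_def by (intro continuous_intros)
    have b: "\<bar>h x\<bar> \<le> 1" for x by (simp add: h_def)
    have "h (real k / real n) = 0" if "k \<le> n" for k n
      using that by (cases "n = 0") (auto simp: h_def divide_simps)
    then have "(\<lambda>n. \<Sum>k\<le>s n. weight (s n) k * h (real k / real (s n))) = (\<lambda>n. 0)"
      by (intro ext sum.neutral) auto
    then have "(\<integral>t. h t \<partial>\<mu>) = 0"
      using LIMSEQ_unique[OF lim[OF c b]] tendsto_const by simp
    moreover have hm: "h \<in> borel_measurable borel"
      using c by (intro borel_measurable_continuous_onI continuous_at_imp_continuous_on) auto
    moreover have "integrable \<mu> h"
      using b hm by (intro integrable_const_bound[where B = 1]) auto
    moreover have "0 \<le> h t" for t by (simp add: h_def)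
    ultimately have "AE t in \<mu>. h t = 0"
      by (subst (asm) integral_nonneg_eq_0_iff_AE) auto
    then show ?thesis by eventually_elim (auto simp: h_def min_def max_def split: if_splits)
  qed
  have moment: "F (monom 1 j) = (\<integral>t. t ^ j \<partial>\<mu>)" for j
  proof -
    define h where "h t = (max 0 (min 1 t)) ^ j" for t :: real
    have c: "isCont h x" for x unfolding h_def by (intro continuous_intros)
    have b: "\<bar>h x\<bar> \<le> 1" for x by (auto simp: h_def power_abs intro!: power_le_one)
    have e: "weight n k * h (real k / real n) = weight n k * (real k / real n) ^ j" if "k \<le> n" for k n
      using that by (cases "n = 0") (auto simp: h_def)
    have "(\<lambda>n. \<Sum>k\<le>s n. weight (s n) k * h (real k / real (s n)))
        = (\<lambda>n. \<Sum>k\<le>n. weight n k * (real k / real n) ^ j) \<circ> s"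
      by (auto simp: fun_eq_iff e intro!: sum.cong)
    moreover have "((\<lambda>n. \<Sum>k\<le>n. weight n k * (real k / real n) ^ j) \<circ> s) \<longlonglongrightarrow> F (monom 1 j)"
      by (rule LIMSEQ_subseq_LIMSEQ[OF bernstein_moment_tendsto s])
    ultimately have "(\<lambda>n. \<Sum>k\<le>s n. weight (s n) k * h (real k / real (s n))) \<longlonglongrightarrow> F (monom 1 j)"
      by (simp only:)
    from LIMSEQ_unique[OF this lim[OF c b]] have "F (monom 1 j) = (\<integral>t. h t \<partial>\<mu>)" .
    also have "\<dots> = (\<integral>t. t ^ j \<partial>\<mu>)"
    proof (rule integral_cong_AE)
      show "AE t in \<mu>. h t = t ^ j" using supp by eventually_elim (simp add: h_def)
      have "h \<in> borel_measurable borel"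
        using c by (intro borel_measurable_continuous_onI continuous_at_imp_continuous_on) auto
      then show "h \<in> borel_measurable \<mu>" by simp
    qed simp
    finally show ?thesis .
  qed
  have "F p = (\<integral>t. poly p t \<partial>\<mu>)" for p
  proof -
    have int: "integrable \<mu> (\<lambda>t. t ^ i)" for i
    proof (rule integrable_const_bound[where B = 1])
      show "AE t in \<mu>. norm (t ^ i) \<le> 1" using supp by eventually_elim (simp add: power_abs power_le_one)
    qed simp
    have "F p = F (\<Sum>i\<le>degree p. smult (coeff p i) (monom 1 i))"
      by (simp add: smult_monom poly_as_sum_of_monoms)
    also have "\<dots> = (\<Sum>i\<le>degree p. coeff p i * (\<integral>t. t ^ i \<partial>\<mu>))"
      by (simp only: sum smult moment)
    also have "\<dots> = (\<integral>t. poly p t \<partial>\<mu>)"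
      unfolding poly_altdef using int by (subst Bochner_Integration.integral_sum) auto
    finally show ?thesis .
  qed
  with \<mu> supp show ?thesis by blast
qed

end

text \<open>
  Transfer of \<open>ex_measure\<close> to the interval \<open>[-K, K]\<close> and an arbitrary positive total mass \<open>F 1\<close>.
\<close>

lemma bernstein_functional_measure:
  fixes F :: "real poly \<Rightarrow> real" and K :: real
  assumes add: "\<And>p q. F (p + q) = F p + F q" and smult: "\<And>c p. F (smult c p) = c * F p"
    and K: "0 < K" and nonneg: "\<And>k m. 0 \<le> F ([:K, 1:] ^ k * [:K, -1:] ^ m)" and pos: "0 < F 1"
  shows "\<exists>\<mu>. finite_measure \<mu> \<and> sets \<mu> = sets borel \<and> (AE t in \<mu>. \<bar>t\<bar> \<le> K) \<and>
    (\<forall>p. F p = (\<integral>t. poly p t \<partial>\<mu>))"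
proof -
  \<comment> \<open>the affine change of variable \<open>t = 2 K s - K\<close> maps \<open>[0, 1]\<close> onto \<open>[-K, K]\<close>\<close>
  define G where "G p = F (pcompose p [:1/2, 1 / (2 * K):]) / F 1" for p
  interpret positive_functional G
  proof
    fix p q c k m
    show "G (p + q) = G p + G q" by (simp add: G_def pcompose_add add add_divide_distrib)
    show "G (smult c p) = c * G p" by (simp add: G_def pcompose_smult smult)
    show "G 1 = 1" using pos by (simp add: G_def pcompose_1)
    have c: "pcompose [:0, 1:] [:1/2, 1 / (2 * K):] = smult (1 / (2 * K)) [:K, 1:]"
      "pcompose [:1, -1:] [:1/2, 1 / (2 * K):] = smult (1 / (2 * K)) [:K, -1:]"
      using K by (simp_all add: pcompose_pCons field_simps)
    have pow: "pcompose (p ^ n) r = pcompose p r ^ n" for p r :: "real poly" and n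
      by (induction n) (simp_all add: pcompose_mult pcompose_1)
    have "pcompose ([:0, 1:] ^ k * [:1, -1:] ^ m) [:1/2, 1 / (2 * K):]
        = smult ((1 / (2 * K)) ^ k * (1 / (2 * K)) ^ m) ([:K, 1:] ^ k * [:K, -1:] ^ m)"
      by (simp only: pcompose_mult pow c smult_power mult_smult_left mult_smult_right smult_smult)
        (simp only: mult.commute)
    then show "0 \<le> G ([:0, 1:] ^ k * [:1, -1:] ^ m)"
      unfolding G_def using K pos nonneg[of k m] by (simp add: smult)
  qed
  obtain \<nu> where \<nu>: "real_distribution \<nu>" and supp: "AE s in \<nu>. 0 \<le> s \<and> s \<le> 1"
    and rep: "\<And>p. G p = (\<integral>s. poly p s \<partial>\<nu>)"
    using ex_measure by blast
  interpret real_distribution \<nu> by fact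
  define \<kappa> where "\<kappa> = distr \<nu> borel (\<lambda>s. 2 * K * s - K)"
  interpret \<kappa>: prob_space \<kappa> unfolding \<kappa>_def by (rule prob_space_distr) simp
  have ks: "sets \<kappa> = sets borel" by (simp add: \<kappa>_def)
  have kK: "AE t in \<kappa>. \<bar>t\<bar> \<le> K"
  proof -
    have "AE s in \<nu>. \<bar>2 * K * s - K\<bar> \<le> K"
      using supp
    proof eventually_elim
      case (elim s)
      then have "2 * K * s \<le> 2 * K * 1" "0 \<le> 2 * K * s" using K by (auto intro: mult_left_mono)
      then show ?case by (simp add: abs_le_iff)
    qed
    then show ?thesis unfolding \<kappa>_def by (subst AE_distr_iff) auto
  qed
  have kint: "(\<integral>t. poly p t \<partial>\<kappa>) = F p / F 1" for p
  proof -
    have "(\<integral>t. poly p t \<partial>\<kappa>) = (\<integral>s. poly (pcompose p [:- K, 2 * K:]) s \<partial>\<nu>)"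
      unfolding \<kappa>_def using poly_measurable
      by (subst integral_distr)
        (auto simp: poly_pcompose algebra_simps intro!: Bochner_Integration.integral_cong)
    also have "\<dots> = G (pcompose p [:- K, 2 * K:])" by (simp add: rep)
    also have "pcompose (pcompose p [:- K, 2 * K:]) [:1/2, 1 / (2 * K):] = p"
    proof -
      have "pcompose [:- K, 2 * K:] [:1/2, 1 / (2 * K):] = [:0, 1:]"
        using K by (simp add: pcompose_pCons field_simps)
      then show ?thesis by (simp add: pcompose_assoc[symmetric])
    qed
    then have "G (pcompose p [:- K, 2 * K:]) = F p / F 1" by (simp add: G_def)
    finally show ?thesis .
  qed
  define \<mu> where "\<mu> = density \<kappa> (\<lambda>_. ennreal (F 1))"
  have "finite_measure \<mu>"
    by (rule finite_measureI) (simp add: \<mu>_def emeasure_density nn_integral_cmult ennreal_mult_eq_top_iff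
        \<kappa>.emeasure_space_1)
  moreover have "sets \<mu> = sets borel" by (simp add: \<mu>_def ks)
  moreover have "AE t in \<mu>. \<bar>t\<bar> \<le> K" unfolding \<mu>_def using kK by (simp add: AE_density)
  moreover have "F p = (\<integral>t. poly p t \<partial>\<mu>)" for p
  proof -
    have "(borel_measurable \<kappa> :: (real \<Rightarrow> real) set) = borel_measurable borel"
      by (rule measurable_cong_sets[OF ks refl])
    then have "(\<integral>t. poly p t \<partial>\<mu>) = (\<integral>t. F 1 * poly p t \<partial>\<kappa>)"
      unfolding \<mu>_def using pos poly_measurable by (subst integral_density) auto
    then show ?thesis using pos by (simp add: kint)
  qed
  ultimately show ?thesis by blast
qed

section \<open>The spectral theorem\<close>

lemma ell2_norm_eq_0D:
  assumes "f \<in> ell2 I" "ell2_norm I f = 0" shows "f = (\<lambda>_. 0)"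
proof
  show "f x = 0" for x
    using cmod_le_ell2_norm[OF assms(1), of x] assms ell2_outside[OF assms(1), of x] by (cases "x \<in> I") auto
qed

text \<open>
  The description of the spectral measure of \<open>L\<close> at \<open>f\<close> by its moments.
\<close>

definition represents_powers ::
    "'a set \<Rightarrow> (('a \<Rightarrow> complex) \<Rightarrow> 'a \<Rightarrow> complex) \<Rightarrow> ('a \<Rightarrow> complex) \<Rightarrow> real \<Rightarrow> real measure \<Rightarrow> bool" where
  "represents_powers I L f K \<mu> \<longleftrightarrow> finite_measure \<mu> \<and> sets \<mu> = sets borel \<and> (AE t in \<mu>. \<bar>t\<bar> \<le> K) \<and>
    (\<forall>n. (\<integral>t. t ^ n \<partial>\<mu>) = Re (ell2_inner I f ((L ^^ n) f)))"

context selfadjoint_operator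
begin

lemma represents_powersD:
  assumes "represents_powers I L f K \<mu>"
  shows "finite_measure \<mu>" "sets \<mu> = sets borel" "AE t in \<mu>. \<bar>t\<bar> \<le> K"
  using assms by (auto simp: represents_powers_def)

lemma represents_powers_poly:
  assumes "represents_powers I L f K \<mu>" "f \<in> ell2 I"
  shows "(\<integral>t. poly p t \<partial>\<mu>) = pform p f f"
proof -
  interpret finite_measure \<mu> using assms by (simp add: represents_powers_def)
  have int: "integrable \<mu> (\<lambda>t. t ^ i)" for i
  proof (rule integrable_const_bound[where B = "K ^ i"])
    show "AE t in \<mu>. norm (t ^ i) \<le> K ^ i"
      using represents_powersD(3)[OF assms(1)] by eventually_elim (simp add: power_abs power_mono)
    have "(borel_measurable \<mu> :: (real \<Rightarrow> real) set) = borel_measurable borel"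
      by (rule measurable_cong_sets[OF represents_powersD(2)[OF assms(1)] refl])
    then show "(\<lambda>t. t ^ i) \<in> borel_measurable \<mu>" by simp
  qed
  have "(\<integral>t. poly p t \<partial>\<mu>) = (\<Sum>i\<le>degree p. coeff p i * (\<integral>t. t ^ i \<partial>\<mu>))"
    unfolding poly_altdef using int by (subst Bochner_Integration.integral_sum) auto
  also have "\<dots> = (\<Sum>i\<le>degree p. coeff p i * pform (monom 1 i) f f)"
    using assms(1) by (simp add: represents_powers_def pform_def pcalc_monom)
  also have "\<dots> = pform (\<Sum>i\<le>degree p. smult (coeff p i) (monom 1 i)) f f"
  proof -
    have "pform (\<Sum>i\<in>J. h i) f f = (\<Sum>i\<in>J. pform (h i) f f)" for J :: "nat set" and h
      using assms(2) pform_poly_smult[of 0 0 f f]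
      by (induction J rule: infinite_finite_induct) (auto simp: pform_poly_add)
    then show ?thesis by (simp add: pform_poly_smult)
  qed
  also have "(\<Sum>i\<le>degree p. smult (coeff p i) (monom 1 i)) = p"
    by (simp add: smult_monom poly_as_sum_of_monoms)
  finally show ?thesis .
qed

lemma ex_represents_powers:
  assumes K: "0 < K" "\<forall>f\<in>ell2 I. ell2_norm I (L f) \<le> K * ell2_norm I f" and f: "f \<in> ell2 I"
  shows "\<exists>\<mu>. represents_powers I L f K \<mu>"
proof (cases "ell2_norm I f = 0")
  \<comment> \<open>the functional cannot be normalized, and the measure is zero\<close>
  case True
  then have f0: "f = (\<lambda>_. 0)" using ell2_norm_eq_0D[OF f] by simp
  have "(L ^^ n) (\<lambda>_. 0) = (\<lambda>_. 0)" for n by (induction n) (auto simp: zero)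
  moreover have "finite_measure (null_measure (borel :: real measure))"
    by (rule finite_measureI) simp
  moreover have "AE t in null_measure borel. \<bar>t\<bar> \<le> K" by (rule AE_I'[of UNIV]) (auto simp: null_sets_def)
  ultimately have "represents_powers I L f K (null_measure borel)"
    by (simp add: represents_powers_def f0 ell2_inner_def)
  then show ?thesis by blast
next
  case False
  have "0 < pform 1 f f" using False by (simp add: pform_one)
  then obtain \<mu> where "finite_measure \<mu>" "sets \<mu> = sets borel" "AE t in \<mu>. \<bar>t\<bar> \<le> K"
      and rep: "\<And>p. pform p f f = (\<integral>t. poly p t \<partial>\<mu>)"
    using bernstein_functional_measure[of "\<lambda>p. pform p f f" K] f K
      pform_bernstein_nonneg[OF K f]
    by (auto simp: pform_poly_add pform_poly_smult)
  moreover have "(\<integral>t. t ^ n \<partial>\<mu>) = Re (ell2_inner I f ((L ^^ n) f))" for n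
    using rep[of "monom 1 n"] by (simp add: poly_monom pform_def pcalc_monom)
  ultimately show ?thesis by (auto simp: represents_powers_def)
qed

text \<open>
  Linear relations between moments, with bounded weight functions as coefficients, are relations
  between the measures.
\<close>

lemma represents_powers_combination:
  assumes rep: "\<And>i. i \<in> J \<Longrightarrow> represents_powers I L (f i) K (\<mu> i)"
    and w: "\<And>i. i \<in> J \<Longrightarrow> w i \<in> borel_measurable borel \<and> (\<forall>t. \<bar>t\<bar> \<le> K \<longrightarrow> \<bar>w i t\<bar> \<le> C i)"
    and eq: "\<And>p. (\<Sum>i\<in>J. \<integral>t. w i t * poly p t \<partial>\<mu> i) = 0"
    and S: "S \<in> sets borel"
  shows "(\<Sum>i\<in>J. \<integral>t. w i t * indicator S t \<partial>\<mu> i) = 0"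
proof (rule weighted_moments_determine_sets[where K = K])
  fix i assume i: "i \<in> J"
  interpret finite_measure "\<mu> i" using rep[OF i] by (simp add: represents_powers_def)
  show "sets (\<mu> i) = sets borel" "AE t in \<mu> i. \<bar>t\<bar> \<le> K"
    using rep[OF i] by (auto simp: represents_powers_def)
  show "integrable (\<mu> i) (w i)"
  proof (rule integrable_const_bound[where B = "C i"])
    show "AE t in \<mu> i. norm (w i t) \<le> C i"
      using \<open>AE t in \<mu> i. \<bar>t\<bar> \<le> K\<close> by eventually_elim (use w[OF i] in auto)
    show "w i \<in> borel_measurable (\<mu> i)"
      using w[OF i] measurable_cong_sets[OF \<open>sets (\<mu> i) = sets borel\<close> refl, of borel] by auto
  qed
qed (use eq S in auto)

end

lemma ell2_eqI:
  assumes "u \<in> ell2 I" "v \<in> ell2 I"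
    and "\<And>f. f \<in> ell2 I \<Longrightarrow> Re (ell2_inner I f u) = Re (ell2_inner I f v)"
  shows "u = v"
proof
  show "u x = v x" for x
  proof (cases "x \<in> I")
    case True
    have "ell2_inner I (delta x) u = ell2_inner I (delta x) v"
      using assms(3)[OF ell2_delta[OF True]] assms(3)[OF ell2_scale[OF ell2_delta[OF True]], of "\<i>"]
      by (subst (1 2) ell2_inner_eq_Complex) simp
    then show ?thesis using True by (simp add: ell2_inner_delta_left)
  next
    case False
    then show ?thesis using assms ell2_outside by metis
  qed
qed

context selfadjoint_operator
begin

lemma pform_diff:
  assumes "f \<in> ell2 I" "g \<in> ell2 I" "h \<in> ell2 I"
  shows "pform p f (\<lambda>x. g x - h x) = pform p f g - pform p f h"
    "pform p (\<lambda>x. g x - h x) f = pform p g f - pform p h f"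
proof -
  have "(\<lambda>x. g x - h x) = (\<lambda>x. g x + of_real (-1) * h x)" by simp
  then show "pform p f (\<lambda>x. g x - h x) = pform p f g - pform p f h"
    "pform p (\<lambda>x. g x - h x) f = pform p g f - pform p h f"
    using assms
    by (simp_all only: pform_add pform_add_left ell2_scale pform_scale pform_scale_left)
qed

lemma pform_polarization:
  assumes "f \<in> ell2 I" "g \<in> ell2 I"
  shows "pform p (\<lambda>x. f x + g x) (\<lambda>x. f x + g x) - pform p (\<lambda>x. f x - g x) (\<lambda>x. f x - g x) = 4 * pform p f g"
  using assms pform_sym[of g f p] by (simp add: pform_add pform_add_left pform_diff ell2_add ell2_diff)

end

locale selfadjoint_bounded_by = selfadjoint_operator +
  fixes K :: real
  assumes K_pos: "0 < K" and K_bound: "\<forall>f\<in>ell2 I. ell2_norm I (L f) \<le> K * ell2_norm I f"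
begin

definition mu :: "('a \<Rightarrow> complex) \<Rightarrow> real measure" where
  "mu f = (SOME \<mu>. represents_powers I L f K \<mu>)"

lemma mu: "f \<in> ell2 I \<Longrightarrow> represents_powers I L f K (mu f)"
  unfolding mu_def by (rule someI_ex) (rule ex_represents_powers[OF K_pos K_bound])

lemma mu_finite: "f \<in> ell2 I \<Longrightarrow> finite_measure (mu f)"
  and mu_sets: "f \<in> ell2 I \<Longrightarrow> sets (mu f) = sets borel"
  and mu_supp: "f \<in> ell2 I \<Longrightarrow> AE t in mu f. \<bar>t\<bar> \<le> K"
  and mu_poly: "f \<in> ell2 I \<Longrightarrow> (\<integral>t. poly p t \<partial>mu f) = pform p f f"
  using represents_powersD[OF mu] represents_powers_poly[OF mu] by auto

lemma mu_space: "f \<in> ell2 I \<Longrightarrow> space (mu f) = UNIV"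
  using sets_eq_imp_space_eq[OF mu_sets] by simp

text \<open>
  \<open>q S f\<close> is the value that \<open>\<langle>f, E(S) f\<rangle>\<close> is going to have, and \<open>r S\<close> is its polarization.
\<close>

definition q :: "real set \<Rightarrow> ('a \<Rightarrow> complex) \<Rightarrow> real" where
  "q S f = measure (mu f) S"

definition r :: "real set \<Rightarrow> ('a \<Rightarrow> complex) \<Rightarrow> ('a \<Rightarrow> complex) \<Rightarrow> real" where
  "r S f g = (q S (\<lambda>x. f x + g x) - q S (\<lambda>x. f x - g x)) / 4"

lemma integral_indicator_mu: "f \<in> ell2 I \<Longrightarrow> (\<integral>t. indicator S t \<partial>mu f) = q S f"
  by (simp add: q_def mu_space)

lemma mu_list_combination:
  assumes xs: "\<And>w f. (w, f) \<in> set xs \<Longrightarrow>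
      f \<in> ell2 I \<and> w \<in> borel_measurable borel \<and> (\<exists>C. \<forall>t. \<bar>t\<bar> \<le> K \<longrightarrow> \<bar>w t\<bar> \<le> C)"
    and eq: "\<And>p. (\<Sum>(w, f)\<leftarrow>xs. \<integral>t. w t * poly p t \<partial>mu f) = 0" and S: "S \<in> sets borel"
  shows "(\<Sum>(w, f)\<leftarrow>xs. \<integral>t. w t * indicator S t \<partial>mu f) = 0"
proof -
  define w where "w i = fst (xs ! i)" for i
  define f where "f i = snd (xs ! i)" for i
  have wf: "f i \<in> ell2 I \<and> w i \<in> borel_measurable borel \<and> (\<exists>C. \<forall>t. \<bar>t\<bar> \<le> K \<longrightarrow> \<bar>w i t\<bar> \<le> C)"
    if "i < length xs" for i
    using that nth_mem[of i xs] by (intro xs) (auto simp: w_def f_def)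
  then obtain C where C: "\<And>i. i < length xs \<Longrightarrow> \<forall>t. \<bar>t\<bar> \<le> K \<longrightarrow> \<bar>w i t\<bar> \<le> C i" by metis
  have conv: "(\<Sum>(w, f)\<leftarrow>xs. \<integral>t. w t * \<phi> t \<partial>mu f) = (\<Sum>i\<in>{..<length xs}. \<integral>t. w i t * \<phi> t \<partial>mu (f i))" for \<phi>
    by (simp add: sum_list_sum_nth w_def f_def case_prod_unfold atLeast0LessThan)
  show ?thesis unfolding conv
  proof (rule represents_powers_combination[where f = f and C = C])
    show "(\<Sum>i\<in>{..<length xs}. \<integral>t. w i t * poly p t \<partial>mu (f i)) = 0" for p
      using eq[of p] by (simp add: conv)
  qed (use wf C S mu in auto)
qed

text \<open>
  The list gives the terms of a linear relation between the quadratic forms of \<open>p(L)\<close>; it holds for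
  \<open>q S\<close> as well. All algebraic properties of \<open>q S\<close> follow by writing down the right list.
\<close>

lemma q_list_combination:
  assumes "\<And>c f. (c, f) \<in> set xs \<Longrightarrow> f \<in> ell2 I"
    and "\<And>p. (\<Sum>(c, f)\<leftarrow>xs. c * pform p f f) = 0" and "S \<in> sets borel"
  shows "(\<Sum>(c, f)\<leftarrow>xs. c * q S f) = 0"
proof -
  let ?ys = "map (\<lambda>(c, f). (\<lambda>_ :: real. c, f)) xs"
  have "(\<Sum>(w, f)\<leftarrow>?ys. \<integral>t. w t * indicator S t \<partial>mu f) = 0"
  proof (rule mu_list_combination)
    fix p
    have "(\<Sum>(w, f)\<leftarrow>?ys. \<integral>t. w t * poly p t \<partial>mu f) = (\<Sum>(c, f)\<leftarrow>xs. c * pform p f f)"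
      using assms(1) by (auto simp: o_def case_prod_unfold mu_poly intro!: arg_cong[of _ _ sum_list])
    then show "(\<Sum>(w, f)\<leftarrow>?ys. \<integral>t. w t * poly p t \<partial>mu f) = 0" using assms(2) by simp
  qed (use assms in auto)
  also have "(\<Sum>(w, f)\<leftarrow>?ys. \<integral>t. w t * indicator S t \<partial>mu f) = (\<Sum>(c, f)\<leftarrow>xs. c * q S f)"
    using assms(1)
    by (auto simp: o_def case_prod_unfold q_def mu_space[OF assms(1)] intro!: arg_cong[of _ _ sum_list])
  finally show ?thesis by simp
qed

lemma q_UNIV: "f \<in> ell2 I \<Longrightarrow> q UNIV f = (ell2_norm I f)\<^sup>2"
  using mu_poly[of f 1] integral_indicator_mu[of f UNIV] by (simp add: pform_one)

lemma q_le: "f \<in> ell2 I \<Longrightarrow> q S f \<le> (ell2_norm I f)\<^sup>2"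
  using finite_measure.bounded_measure[OF mu_finite, of f S] q_UNIV[of f] by (simp add: q_def mu_space)

lemma r_self:
  assumes "f \<in> ell2 I" "S \<in> sets borel" shows "r S f f = q S f"
proof -
  have "(\<Sum>(c, f)\<leftarrow>[(1, \<lambda>x. f x + f x), (-1, \<lambda>x. f x - f x), (-4, f)]. c * q S f) = 0"
  proof (rule q_list_combination)
    show "(\<Sum>(c, f)\<leftarrow>[(1, \<lambda>x. f x + f x), (-1, \<lambda>x. f x - f x), (-4, f)]. c * pform p f f) = 0" for p
      using pform_polarization[OF assms(1,1), of p] by simp
  qed (use assms in \<open>auto simp: ell2_add ell2_diff ell2_scale\<close>)
  then show ?thesis by (simp add: r_def)
qed

lemma bounded_form_r:
  assumes S: "S \<in> sets borel"
  shows "bounded_form I (r S)"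
proof
  fix f g h c
  assume f: "f \<in> ell2 I"
  note simps = ell2_add ell2_diff ell2_scale pform_add pform_add_left pform_diff pform_scale pform_scale_left
  show "0 \<le> r S f f" "r S f f \<le> (ell2_norm I f)\<^sup>2"
    using f S by (simp_all add: r_self q_le) (simp add: q_def)
  assume g: "g \<in> ell2 I"
  have "(\<Sum>(c, f)\<leftarrow>[(1, \<lambda>x. f x + g x), (-1, \<lambda>x. f x - g x), (-1, \<lambda>x. g x + f x), (1, \<lambda>x. g x - f x)].
      c * q S f) = 0"
    by (rule q_list_combination) (use f g S in \<open>auto simp: simps\<close>)
  then show "r S f g = r S g f" by (simp add: r_def)
  have "(\<Sum>(c, f)\<leftarrow>[(1, \<lambda>x. \<i> * f x + \<i> * g x), (-1, \<lambda>x. \<i> * f x - \<i> * g x), (-1, \<lambda>x. f x + g x), (1, \<lambda>x. f x - g x)].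
      c * q S f) = 0"
    by (rule q_list_combination) (use f g S in \<open>auto simp: simps pform_rot\<close>)
  then show "r S (\<lambda>x. \<i> * f x) (\<lambda>x. \<i> * g x) = r S f g" by (simp add: r_def)
  have "(\<Sum>(c, f)\<leftarrow>[(1, \<lambda>x. f x + of_real c * g x), (-1, \<lambda>x. f x - of_real c * g x), (-c, \<lambda>x. f x + g x), (c, \<lambda>x. f x - g x)].
      c * q S f) = 0"
    by (rule q_list_combination) (use f g S in \<open>auto simp: simps algebra_simps\<close>)
  then show "r S f (\<lambda>x. of_real c * g x) = c * r S f g" by (simp add: r_def field_simps)
  assume h: "h \<in> ell2 I"
  have "(\<Sum>(c, f)\<leftarrow>[(1, \<lambda>x. f x + (g x + h x)), (-1, \<lambda>x. f x - (g x + h x)),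
      (-1, \<lambda>x. f x + g x), (1, \<lambda>x. f x - g x), (-1, \<lambda>x. f x + h x), (1, \<lambda>x. f x - h x)].
      c * q S f) = 0"
    by (rule q_list_combination) (use f g h S in \<open>auto simp: simps\<close>)
  then show "r S f (\<lambda>x. g x + h x) = r S f g + r S f h" by (simp add: r_def field_simps)
qed

definition E :: "real set \<Rightarrow> ('a \<Rightarrow> complex) \<Rightarrow> 'a \<Rightarrow> complex" where
  "E S = (SOME T. selfadjoint_op I T \<and> (\<forall>f\<in>ell2 I. \<forall>g\<in>ell2 I. Re (ell2_inner I f (T g)) = r S f g))"

lemma E: "S \<in> sets borel \<Longrightarrow> selfadjoint_op I (E S) \<and> (\<forall>f\<in>ell2 I. \<forall>g\<in>ell2 I. Re (ell2_inner I f (E S g)) = r S f g)"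
  unfolding E_def by (rule someI_ex[OF bounded_form.ex_operator[OF bounded_form_r]])

lemma E_closed: "S \<in> sets borel \<Longrightarrow> f \<in> ell2 I \<Longrightarrow> E S f \<in> ell2 I"
  using E[of S] by (auto simp: selfadjoint_op_def bounded_op_def)

lemma E_inner: "S \<in> sets borel \<Longrightarrow> f \<in> ell2 I \<Longrightarrow> g \<in> ell2 I \<Longrightarrow> Re (ell2_inner I f (E S g)) = r S f g"
  using E by blast

lemma poly_bounded_on: "\<exists>C. \<forall>t. \<bar>t\<bar> \<le> K \<longrightarrow> \<bar>poly p t\<bar> \<le> C"
proof -
  have "compact (poly p ` {-K..K})" by (intro compact_continuous_image continuous_intros compact_Icc)
  then have "bounded (poly p ` {-K..K})" by (rule compact_imp_bounded)
  then obtain C where "\<forall>y\<in>poly p ` {-K..K}. norm y \<le> C" by (auto simp: bounded_iff)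
  then show ?thesis by (intro exI[of _ C]) (auto simp: abs_le_iff)
qed

text \<open>
  In terms of the signed measures \<open>\<mu>\<^sub>f\<^sub>,\<^sub>g = (\<mu>\<^bsub>f + g\<^esub> - \<mu>\<^bsub>f - g\<^esub>) / 4\<close> this says that \<open>\<mu>\<^sub>u\<^sub>,\<^sub>g\<close> for \<open>u = p(L) f\<close>
  has density \<open>p\<close> with respect to \<open>\<mu>\<^sub>f\<^sub>,\<^sub>g\<close>: both have the moments \<open>Re \<langle>f, (p t\<^sup>n)(L) g\<rangle>\<close>.
\<close>

lemma r_pcalc:
  assumes f: "f \<in> ell2 I" and g: "g \<in> ell2 I" and S: "S \<in> sets borel"
  shows "4 * r S (pcalc p f) g = (\<integral>t. poly p t * indicator S t \<partial>mu (\<lambda>x. f x + g x))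
      - (\<integral>t. poly p t * indicator S t \<partial>mu (\<lambda>x. f x - g x))"
proof -
  let ?u = "pcalc p f"
  let ?xs = "[(\<lambda>_. 1, \<lambda>x. ?u x + g x), (\<lambda>_. -1, \<lambda>x. ?u x - g x),
     (\<lambda>t. - poly p t, \<lambda>x. f x + g x), (\<lambda>t. poly p t, \<lambda>x. f x - g x)]"
  have u: "?u \<in> ell2 I" using f by (rule pcalc_closed)
  have "(\<Sum>(w, f)\<leftarrow>?xs. \<integral>t. w t * indicator S t \<partial>mu f) = 0"
  proof (rule mu_list_combination)
    fix p'
    have "(\<Sum>(w, f)\<leftarrow>?xs. \<integral>t. w t * poly p' t \<partial>mu f)
       = 4 * pform p' ?u g - ((\<integral>t. poly (p * p') t \<partial>mu (\<lambda>x. f x + g x)) - (\<integral>t. poly (p * p') t \<partial>mu (\<lambda>x. f x - g x)))"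
      using u f g pform_polarization[OF u g, of p'] by (simp add: mu_poly ell2_add ell2_diff)
    also have "\<dots> = 0"
      using f g pform_polarization[OF f g, of "p * p'"]
      by (simp only: mu_poly ell2_add ell2_diff pform_mult(1))
    finally show "(\<Sum>(w, f)\<leftarrow>?xs. \<integral>t. w t * poly p' t \<partial>mu f) = 0" .
  qed (use u f g S poly_measurable[of p] in \<open>auto simp: ell2_add ell2_diff intro: poly_bounded_on\<close>)
  then show ?thesis
    using u f g by (simp add: r_def q_def mu_space ell2_add ell2_diff)
qed

text \<open>
  The signed measure \<open>\<mu>\<^sub>f\<^sub>,\<^sub>u\<close> for \<open>u = E(S) g\<close> is the restriction of \<open>\<mu>\<^sub>f\<^sub>,\<^sub>g\<close> to \<open>S\<close>. The moments
  agree, as \<open>\<langle>f, p(L) E(S) g\<rangle> = \<langle>p(L) f, E(S) g\<rangle>\<close> is given by \<open>r_pcalc\<close>. This is where multiplicativity of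
  \<open>E\<close> comes from.
\<close>

lemma r_E:
  assumes f: "f \<in> ell2 I" and g: "g \<in> ell2 I" and S: "S \<in> sets borel" and T: "T \<in> sets borel"
  shows "r T f (E S g) = r (S \<inter> T) f g"
proof -
  let ?u = "E S g"
  let ?xs = "[(\<lambda>_ :: real. 1 :: real, \<lambda>x. f x + ?u x), (\<lambda>_. -1, \<lambda>x. f x - ?u x),
     (\<lambda>t. - indicator S t, \<lambda>x. f x + g x), (\<lambda>t. indicator S t, \<lambda>x. f x - g x)]"
  have u: "?u \<in> ell2 I" using S g by (rule E_closed)
  have "(\<Sum>(w, f)\<leftarrow>?xs. \<integral>t. w t * indicator T t \<partial>mu f) = 0"
  proof (rule mu_list_combination)
    fix p
    have "pform p f ?u = Re (ell2_inner I (pcalc p f) ?u)"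
      using f u by (simp add: pform_def pcalc_adjoint)
    also have "\<dots> = r S (pcalc p f) g" using f g S by (simp add: E_inner pcalc_closed)
    finally show "(\<Sum>(w, f)\<leftarrow>?xs. \<integral>t. w t * poly p t \<partial>mu f) = 0"
      using u f g pform_polarization[OF f u, of p] r_pcalc[OF f g S, of p]
      by (simp add: mu_poly ell2_add ell2_diff mult.commute)
  qed (use u f g S T in \<open>auto simp: ell2_add ell2_diff intro!: exI[of _ 1] split: split_indicator\<close>)
  then show ?thesis
    using u f g by (simp add: r_def q_def mu_space ell2_add ell2_diff indicator_inter_arith[symmetric])
qed

lemma E_inter:
  assumes "S \<in> sets borel" "T \<in> sets borel" "f \<in> ell2 I"
  shows "E (S \<inter> T) f = E S (E T f)"
  using assms by (intro ell2_eqI[of _ I] E_closed sets.Int) (simp_all add: E_inner E_closed r_E Int_commute)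

lemma E_eq_self:
  assumes S: "S \<in> sets borel" and f: "f \<in> ell2 I" and q: "\<And>g. g \<in> ell2 I \<Longrightarrow> q S g = q UNIV g"
  shows "E S f = f"
proof (rule ell2_eqI[of _ I])
  fix g assume g: "g \<in> ell2 I"
  have "Re (ell2_inner I g (E S f)) = r UNIV g f"
    using S f g q by (simp add: E_inner r_def ell2_add ell2_diff)
  also have "4 * \<dots> = 4 * Re (ell2_inner I g f)"
    using f g pform_polarization[OF g f, of 1]
    by (simp add: r_def q_UNIV ell2_add ell2_diff pform_one) (simp add: pform_def pcalc_one)
  finally show "Re (ell2_inner I g (E S f)) = Re (ell2_inner I g f)" by simp
qed (use assms E_closed in auto)

lemma q_sums:
  assumes "range A \<subseteq> sets borel" "disjoint_family A" "f \<in> ell2 I"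
  shows "(\<lambda>n. q (A n) f) sums q (\<Union>n. A n) f"
  unfolding q_def using assms mu_sets[OF assms(3)]
  by (intro finite_measure.finite_measure_UNION mu_finite) auto

lemma projection_valued_measure_E: "projection_valued_measure I E"
  unfolding projection_valued_measure_def
proof (intro conjI ballI allI impI)
  fix A :: "nat \<Rightarrow> real set" and f g
  assume A: "range A \<subseteq> sets borel" "disjoint_family A" and f: "f \<in> ell2 I" and g: "g \<in> ell2 I"
  have An: "A n \<in> sets borel" "(\<Union>n. A n) \<in> sets borel" for n using A by auto
  have "(\<lambda>n. r (A n) h g) sums r (\<Union>n. A n) h g" if "h \<in> ell2 I" for h
    unfolding r_def using that g by (intro sums_divide sums_diff q_sums A ell2_add ell2_diff)
  then have *: "(\<lambda>n. Re (ell2_inner I h (E (A n) g))) sums Re (ell2_inner I h (E (\<Union>n. A n) g))"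
    if "h \<in> ell2 I" for h
    using that g An by (simp add: E_inner)
  have "(\<lambda>n. Complex (Re (ell2_inner I f (E (A n) g))) (Re (ell2_inner I (\<lambda>x. \<i> * f x) (E (A n) g))))
    sums Complex (Re (ell2_inner I f (E (\<Union>n. A n) g))) (Re (ell2_inner I (\<lambda>x. \<i> * f x) (E (\<Union>n. A n) g)))"
    unfolding sums_complex_iff using *[OF f] *[OF ell2_scale[OF f]] by auto
  then show "(\<lambda>n. ell2_inner I f (E (A n) g)) sums ell2_inner I f (E (\<Union>n. A n) g)"
    by (simp only: ell2_inner_eq_Complex[symmetric])
next
  fix S f assume "S \<in> sets (borel :: real measure)" "f \<in> ell2 I"
  then show "E S (E S f) = E S f" using E_inter[of S S f] by simp
qed (use E E_inter E_eq_self[of UNIV] in auto)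

lemma quadratic_measure_E:
  assumes f: "f \<in> ell2 I"
  shows "quadratic_measure I E f = mu f"
proof -
  interpret finite_measure "mu f" using f by (rule mu_finite)
  have "quadratic_measure I E f = measure_of UNIV (sets borel) (emeasure (mu f))"
    unfolding quadratic_measure_def
  proof (rule measure_of_eq)
    fix S assume "S \<in> sigma_sets UNIV (sets (borel :: real measure))"
    then have "S \<in> sets borel" by (metis sets.sigma_sets_eq space_borel)
    then show "ennreal (Re (ell2_inner I f (E S f))) = emeasure (mu f) S"
      using f by (simp add: E_inner r_self q_def emeasure_eq_measure)
  qed simp
  then show ?thesis using measure_of_of_measure[of "mu f"] f by (simp add: mu_space mu_sets)
qed

theorem is_spectral_resolution_E: "is_spectral_resolution I L E"
  unfolding is_spectral_resolution_def
proof (intro conjI ballI exI[of _ K] projection_valued_measure_E)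
  fix f assume f: "f \<in> ell2 I"
  have "q {-K..K} g = q UNIV g" if g: "g \<in> ell2 I" for g
  proof -
    have "AE t in mu g. (t \<in> {-K..K}) = (t \<in> UNIV)"
      using mu_supp[OF g] by eventually_elim auto
    then show ?thesis
      unfolding q_def measure_def using mu_sets[OF g]
      by (intro arg_cong[of _ _ enn2real] emeasure_eq_AE) auto
  qed
  then show "E {-K..K} f = f" using f by (intro E_eq_self) auto
  have "Re (ell2_inner I f (L f)) = (\<integral>t. t \<partial>mu f)"
    using mu[OF f] by (auto simp: represents_powers_def dest: spec[of _ 1])
  moreover have "Im (ell2_inner I f (L f)) = 0"
    using adjoint[OF f f] arg_cong[OF ell2_inner_cnj[of I f "L f"], of Im] by simp
  ultimately show "ell2_inner I f (L f) = of_real (\<integral>t. t \<partial>quadratic_measure I E f)"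
    using f by (simp add: quadratic_measure_E complex_eq_iff)
qed

end

section \<open>Uniqueness of the spectral measures\<close>

lemma (in selfadjoint_operator) represents_powers_unique:
  assumes f: "f \<in> ell2 I" and \<mu>: "represents_powers I L f K \<mu>" and \<nu>: "represents_powers I L f K' \<nu>"
  shows "\<mu> = \<nu>"
proof (rule measure_eqI)
  show "sets \<mu> = sets \<nu>" using \<mu> \<nu> by (simp add: represents_powers_def)
  fix S assume "S \<in> sets \<mu>"
  then have S: "S \<in> sets borel" using \<mu> by (simp add: represents_powers_def)
  interpret \<mu>: finite_measure \<mu> using \<mu> by (simp add: represents_powers_def)
  interpret \<nu>: finite_measure \<nu> using \<nu> by (simp add: represents_powers_def)
  have sp: "space \<mu> = UNIV" "space \<nu> = UNIV"
    using sets_eq_imp_space_eq[OF represents_powersD(2)[OF \<mu>]]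
      sets_eq_imp_space_eq[OF represents_powersD(2)[OF \<nu>]] by simp_all
  have "(\<Sum>i\<in>{0, 1 :: nat}. \<integral>t. (if i = 0 then 1 else -1 :: real) * indicator S t \<partial>(if i = 0 then \<mu> else \<nu>)) = 0"
  proof (rule weighted_moments_determine_sets[where K = "max K K'"])
    show "(\<Sum>i\<in>{0, 1 :: nat}. \<integral>t. (if i = 0 then 1 else -1 :: real) * poly p t \<partial>(if i = 0 then \<mu> else \<nu>)) = 0" for p
      using represents_powers_poly[OF \<mu> f, of p] represents_powers_poly[OF \<nu> f, of p] by simp
    have "AE t in \<mu>. \<bar>t\<bar> \<le> max K K'" "AE t in \<nu>. \<bar>t\<bar> \<le> max K K'"
      by (rule eventually_mono[OF represents_powersD(3)[OF \<mu>]], simp)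
        (rule eventually_mono[OF represents_powersD(3)[OF \<nu>]], simp)
    then show "AE t in (if i = 0 then \<mu> else \<nu>). \<bar>t\<bar> \<le> max K K'" for i :: nat by simp
  qed (use S represents_powersD(2)[OF \<mu>] represents_powersD(2)[OF \<nu>] in auto)
  then have "measure \<mu> S = measure \<nu> S" by (simp add: sp)
  then show "emeasure \<mu> S = emeasure \<nu> S"
    by (simp add: \<mu>.emeasure_eq_measure \<nu>.emeasure_eq_measure)
qed

text \<open>
  An arbitrary spectral resolution \<open>E\<close> of \<open>L\<close>, such as the one that the choice operator selects.
\<close>

locale spectral_resolution_of = selfadjoint_operator +
  fixes E :: "real set \<Rightarrow> ('a \<Rightarrow> complex) \<Rightarrow> 'a \<Rightarrow> complex"
  assumes resolution: "is_spectral_resolution I L E"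
begin

abbreviation \<nu> :: "('a \<Rightarrow> complex) \<Rightarrow> real measure" where
  "\<nu> \<equiv> quadratic_measure I E"

lemma pvm: "projection_valued_measure I E"
  using resolution by (simp add: is_spectral_resolution_def)

lemma E_selfadjoint: "S \<in> sets borel \<Longrightarrow> selfadjoint_op I (E S)"
  using pvm by (simp add: projection_valued_measure_def)

lemma E_inter: "S \<in> sets borel \<Longrightarrow> T \<in> sets borel \<Longrightarrow> f \<in> ell2 I \<Longrightarrow> E (S \<inter> T) f = E S (E T f)"
  using pvm by (simp add: projection_valued_measure_def)

lemma E_sums:
  "range A \<subseteq> sets borel \<Longrightarrow> disjoint_family A \<Longrightarrow> f \<in> ell2 I \<Longrightarrow> g \<in> ell2 I \<Longrightarrow>
    (\<lambda>n. ell2_inner I f (E (A n) g)) sums ell2_inner I f (E (\<Union>n. A n) g)" for A :: "nat \<Rightarrow> real set"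
  using pvm by (simp add: projection_valued_measure_def)

lemma E_closed: "S \<in> sets borel \<Longrightarrow> f \<in> ell2 I \<Longrightarrow> E S f \<in> ell2 I"
  using selfadjoint_operator.closed[OF selfadjoint_operator.intro[OF E_selfadjoint]] .

lemma E_adjoint:
  "S \<in> sets borel \<Longrightarrow> f \<in> ell2 I \<Longrightarrow> g \<in> ell2 I \<Longrightarrow> ell2_inner I f (E S g) = ell2_inner I (E S f) g"
  using selfadjoint_operator.adjoint[OF selfadjoint_operator.intro[OF E_selfadjoint]] .

lemma E_quadratic_nonneg:
  assumes "S \<in> sets borel" "f \<in> ell2 I" shows "0 \<le> Re (ell2_inner I f (E S f))"
  using E_inter[of S S f] E_adjoint[of S f "E S f"] assms
  by (simp add: E_closed ell2_inner_self)

lemma emeasure_\<nu>: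
  assumes f: "f \<in> ell2 I" and S: "S \<in> sets borel"
  shows "emeasure (\<nu> f) S = ennreal (Re (ell2_inner I f (E S f)))"
  unfolding quadratic_measure_def
proof (rule emeasure_measure_of_sigma)
  show "sigma_algebra UNIV (sets (borel :: real measure))"
    using sets.sigma_algebra_axioms[of "borel :: real measure"] by simp
  have "(\<lambda>n :: nat. ell2_inner I f (E {} f)) sums ell2_inner I f (E (\<Union>n :: nat. {}) f)"
    using f by (intro E_sums) (auto simp: disjoint_family_on_def)
  then have "ell2_inner I f (E {} f) = 0" using sums_summable summable_const_iff by fast
  then show "positive (sets (borel :: real measure)) (\<lambda>S. ennreal (Re (ell2_inner I f (E S f))))"
    by (simp add: positive_def)
  show "countably_additive (sets (borel :: real measure)) (\<lambda>S. ennreal (Re (ell2_inner I f (E S f))))"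
  proof (rule countably_additiveI)
    fix A :: "nat \<Rightarrow> real set"
    assume A: "range A \<subseteq> sets borel" "disjoint_family A"
    have s: "(\<lambda>n. Re (ell2_inner I f (E (A n) f))) sums Re (ell2_inner I f (E (\<Union>n. A n) f))"
      by (rule sums_Re[OF E_sums[OF A f f]])
    show "(\<Sum>n. ennreal (Re (ell2_inner I f (E (A n) f)))) = ennreal (Re (ell2_inner I f (E (\<Union>n. A n) f)))"
      using s A f by (subst suminf_ennreal2) (auto simp: E_quadratic_nonneg sums_iff)
  qed
qed (rule S)

lemma sets_\<nu>: "sets (\<nu> f) = sets borel" and space_\<nu>: "space (\<nu> f) = UNIV"
proof -
  have "sigma_algebra UNIV (sets (borel :: real measure))"
    using sets.sigma_algebra_axioms[of "borel :: real measure"] by simp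
  then show "sets (\<nu> f) = sets borel"
    unfolding quadratic_measure_def using sets.sigma_sets_eq[of "borel :: real measure"]
    by (simp add: sigma_algebra.sets_measure_of_eq)
  from sets_eq_imp_space_eq[OF this] show "space (\<nu> f) = UNIV" by simp
qed

lemma measure_\<nu>: "f \<in> ell2 I \<Longrightarrow> S \<in> sets borel \<Longrightarrow> measure (\<nu> f) S = Re (ell2_inner I f (E S f))"
  by (simp add: measure_def emeasure_\<nu> E_quadratic_nonneg)

lemma finite_\<nu>: "f \<in> ell2 I \<Longrightarrow> finite_measure (\<nu> f)"
  by (rule finite_measureI) (simp add: space_\<nu> emeasure_\<nu>)

lemma measure_\<nu>_polarization:
  assumes f: "f \<in> ell2 I" and g: "g \<in> ell2 I" and S: "S \<in> sets borel"
  shows "measure (\<nu> (\<lambda>x. f x + g x)) S - measure (\<nu> (\<lambda>x. f x - g x)) S = 4 * Re (ell2_inner I f (E S g))"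
proof -
  interpret S: selfadjoint_operator I "E S" by unfold_locales (rule E_selfadjoint[OF S])
  show ?thesis
    using S.pform_polarization[OF f g, of "monom 1 1"] f g S
    by (simp add: measure_\<nu> ell2_add ell2_diff S.pform_def S.pcalc_monom)
qed

lemma ex_support: "\<exists>R. \<forall>f\<in>ell2 I. AE t in \<nu> f. \<bar>t\<bar> \<le> R"
proof -
  obtain R where R: "\<And>f. f \<in> ell2 I \<Longrightarrow> E {-R..R} f = f"
    using resolution by (auto simp: is_spectral_resolution_def)
  have "AE t in \<nu> f. \<bar>t\<bar> \<le> R" if f: "f \<in> ell2 I" for f
  proof -
    interpret finite_measure "\<nu> f" using f by (rule finite_\<nu>)
    have "E UNIV f = f" using pvm f by (simp add: projection_valued_measure_def)
    then have "measure (\<nu> f) (space (\<nu> f) - {-R..R}) = 0"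
      using f R[OF f] by (subst finite_measure_compl) (auto simp: measure_\<nu> space_\<nu> sets_\<nu>)
    then have "emeasure (\<nu> f) (space (\<nu> f) - {-R..R}) = 0" by (simp add: emeasure_eq_measure)
    then show ?thesis
      by (rule AE_I[where N = "space (\<nu> f) - {-R..R}", rotated]) (auto simp: sets_\<nu> space_\<nu>)
  qed
  then show ?thesis by blast
qed

text \<open>
  A linear relation between measures, with weight functions as coefficients, can be integrated
  against powers of \<open>t\<close>.
\<close>

lemma \<nu>_list_integral:
  assumes supp: "\<And>f. f \<in> ell2 I \<Longrightarrow> AE t in \<nu> f. \<bar>t\<bar> \<le> R"
    and xs: "\<And>w f. (w, f) \<in> set xs \<Longrightarrow>
      f \<in> ell2 I \<and> w \<in> borel_measurable borel \<and> (\<exists>C. \<forall>t. \<bar>t\<bar> \<le> R \<longrightarrow> \<bar>w t\<bar> \<le> C)"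
    and eq: "\<And>S. S \<in> sets borel \<Longrightarrow> (\<Sum>(w, f)\<leftarrow>xs. \<integral>t. w t * indicator S t \<partial>\<nu> f) = 0"
  shows "(\<Sum>(w, f)\<leftarrow>xs. \<integral>t. w t * t ^ n \<partial>\<nu> f) = 0"
proof -
  define w where "w i = fst (xs ! i)" for i
  define f where "f i = snd (xs ! i)" for i
  have wf: "f i \<in> ell2 I \<and> w i \<in> borel_measurable borel \<and> (\<exists>C. \<forall>t. \<bar>t\<bar> \<le> R \<longrightarrow> \<bar>w i t\<bar> \<le> C)"
    if "i < length xs" for i
    using that nth_mem[of i xs] by (intro xs) (auto simp: w_def f_def)
  have conv: "(\<Sum>(w, f)\<leftarrow>xs. \<integral>t. w t * \<phi> t \<partial>\<nu> f) = (\<Sum>i\<in>{..<length xs}. \<integral>t. w i t * \<phi> t \<partial>\<nu> (f i))" for \<phi>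
    by (simp add: sum_list_sum_nth w_def f_def case_prod_unfold atLeast0LessThan)
  show ?thesis unfolding conv
  proof (rule weighted_sets_determine_integrals[where C = "R ^ n"])
    fix i assume "i \<in> {..<length xs}"
    then have i: "i < length xs" by simp
    then obtain C where C: "\<forall>t. \<bar>t\<bar> \<le> R \<longrightarrow> \<bar>w i t\<bar> \<le> C" using wf by blast
    interpret finite_measure "\<nu> (f i)" using wf[OF i] by (simp add: finite_\<nu>)
    show "AE t in \<nu> (f i). \<bar>t ^ n\<bar> \<le> R ^ n"
      using supp[of "f i"] wf[OF i] by (auto simp: power_abs power_mono elim!: eventually_mono)
    show "integrable (\<nu> (f i)) (w i)"
    proof (rule integrable_const_bound[where B = C])
      show "AE t in \<nu> (f i). norm (w i t) \<le> C"
        using supp[of "f i"] wf[OF i] C by (auto elim!: eventually_mono)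
      show "w i \<in> borel_measurable (\<nu> (f i))"
        using wf[OF i] measurable_cong_sets[OF sets_\<nu> refl, of "f i" borel] by auto
    qed
    show "sets (\<nu> (f i)) = sets borel" by (rule sets_\<nu>)
  next
    fix S :: "real set" assume "S \<in> sets borel"
    then show "(\<Sum>i\<in>{..<length xs}. \<integral>t. w i t * indicator S t \<partial>\<nu> (f i)) = 0"
      using eq[of S] by (simp only: conv)
  qed simp
qed

lemma inner_L_\<nu>: "f \<in> ell2 I \<Longrightarrow> Re (ell2_inner I f (L f)) = (\<integral>t. t \<partial>\<nu> f)"
  using resolution by (simp add: is_spectral_resolution_def)

text \<open>
  The real part of \<open>\<langle>f, E(S) L\<^sup>n g\<rangle> = \<integral>\<^sub>S t\<^sup>n d\<langle>f, E(t) g\<rangle>\<close>, polarized. For the step put \<open>h = L\<^sup>n g\<close> and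
  \<open>e = E(S) f\<close>, so that \<open>\<langle>f, E(S) L h\<rangle> = \<langle>e, L h\<rangle> = \<integral> t d\<langle>e, E(t) h\<rangle>\<close>. By induction the measure
  \<open>\<langle>e, E(T) h\<rangle> = \<langle>f, E(S \<inter> T) h\<rangle>\<close> has density \<open>t\<^sup>n\<close> on \<open>S\<close>, so integrating \<open>t\<close> adds one power.
\<close>

lemma inner_E_pow:
  assumes supp: "\<And>f. f \<in> ell2 I \<Longrightarrow> AE t in \<nu> f. \<bar>t\<bar> \<le> R"
    and f: "f \<in> ell2 I" and g: "g \<in> ell2 I" and S: "S \<in> sets borel"
  shows "4 * Re (ell2_inner I f (E S ((L ^^ n) g)))
    = (\<integral>t. t ^ n * indicator S t \<partial>\<nu> (\<lambda>x. f x + g x)) - (\<integral>t. t ^ n * indicator S t \<partial>\<nu> (\<lambda>x. f x - g x))"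
  using f S
proof (induction n arbitrary: f S)
  case 0
  then show ?case using measure_\<nu>_polarization[OF 0(1) g 0(2)] by (simp add: space_\<nu>)
next
  case (Suc n)
  define h where "h = (L ^^ n) g"
  define e where "e = E S f"
  have h: "h \<in> ell2 I" unfolding h_def using g by (rule pow_closed)
  have e: "e \<in> ell2 I" unfolding e_def using Suc.prems by (intro E_closed)
  let ?xs = "[(\<lambda>_ :: real. 1 :: real, \<lambda>x. e x + h x), (\<lambda>_. -1, \<lambda>x. e x - h x),
     (\<lambda>t. - (t ^ n * indicator S t), \<lambda>x. f x + g x), (\<lambda>t. t ^ n * indicator S t, \<lambda>x. f x - g x)]"
  have "(\<Sum>(w, f)\<leftarrow>?xs. \<integral>t. w t * t ^ 1 \<partial>\<nu> f) = 0"
  proof (rule \<nu>_list_integral[OF supp])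
    fix T :: "real set" assume T: "T \<in> sets borel"
    have "4 * Re (ell2_inner I e (E T h)) = 4 * Re (ell2_inner I f (E (S \<inter> T) h))"
      using Suc.prems T h by (simp add: E_inter E_adjoint[of S] E_closed e_def)
    also have "\<dots> = (\<integral>t. t ^ n * indicator (S \<inter> T) t \<partial>\<nu> (\<lambda>x. f x + g x))
        - (\<integral>t. t ^ n * indicator (S \<inter> T) t \<partial>\<nu> (\<lambda>x. f x - g x))"
      unfolding h_def using Suc.prems T by (intro Suc.IH) auto
    finally show "(\<Sum>(w, f)\<leftarrow>?xs. \<integral>t. w t * indicator T t \<partial>\<nu> f) = 0"
      using measure_\<nu>_polarization[OF e h T]
      by (simp add: space_\<nu> indicator_inter_arith mult.assoc)
  next
    have b: "\<bar>t ^ n * indicator S t\<bar> \<le> R ^ n" if "\<bar>t\<bar> \<le> R" for t :: real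
      using that power_mono[of "\<bar>t\<bar>" R n] by (auto simp: power_abs split: split_indicator)
    fix w and f' :: "'a \<Rightarrow> complex" assume "(w, f') \<in> set ?xs"
    then show "f' \<in> ell2 I \<and> w \<in> borel_measurable borel \<and> (\<exists>C. \<forall>t. \<bar>t\<bar> \<le> R \<longrightarrow> \<bar>w t\<bar> \<le> C)"
      using e h g Suc.prems b by (auto simp: ell2_add ell2_diff le_max_iff_disj intro!: exI[of _ "max 1 (R ^ n)"])
  qed
  moreover have "(\<integral>t. t \<partial>\<nu> (\<lambda>x. e x + h x)) - (\<integral>t. t \<partial>\<nu> (\<lambda>x. e x - h x))
      = 4 * Re (ell2_inner I e (L h))"
    using e h pform_polarization[OF e h, of "monom 1 1"]
    by (simp add: inner_L_\<nu>[symmetric] ell2_add ell2_diff pform_def pcalc_monom)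
  moreover have "ell2_inner I f (E S ((L ^^ Suc n) g)) = ell2_inner I e (L h)"
    using Suc.prems h by (simp add: E_adjoint e_def h_def closed)
  ultimately show ?case by (simp add: mult_ac)
qed

theorem represents_powers_\<nu>:
  assumes f: "f \<in> ell2 I"
  shows "\<exists>R. represents_powers I L f R (\<nu> f)"
proof -
  obtain R where R: "\<And>f. f \<in> ell2 I \<Longrightarrow> AE t in \<nu> f. \<bar>t\<bar> \<le> R" using ex_support by blast
  have "(\<integral>t. t ^ n \<partial>\<nu> f) = Re (ell2_inner I f ((L ^^ n) f))" for n
  proof -
    \<comment> \<open>polarization with \<open>f = g\<close> compares the measures at \<open>2 f\<close> and \<open>0\<close> with four times the one at \<open>f\<close>\<close>
    have "(\<Sum>(w, f)\<leftarrow>[(\<lambda>_ :: real. 1 :: real, \<lambda>x. f x + f x), (\<lambda>_. -1, \<lambda>x. f x - f x), (\<lambda>_. -4, f)].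
        \<integral>t. w t * t ^ n \<partial>\<nu> f) = 0"
    proof (rule \<nu>_list_integral[OF R])
      fix S :: "real set" assume "S \<in> sets borel"
      then show "(\<Sum>(w, f)\<leftarrow>[(\<lambda>_ :: real. 1 :: real, \<lambda>x. f x + f x), (\<lambda>_. -1, \<lambda>x. f x - f x), (\<lambda>_. -4, f)].
        \<integral>t. w t * indicator S t \<partial>\<nu> f) = 0"
        using measure_\<nu>_polarization[OF f f, of S] f by (simp add: space_\<nu> measure_\<nu>[OF f])
    qed (use f in \<open>auto simp: ell2_scale\<close>)
    moreover have "E UNIV ((L ^^ n) f) = (L ^^ n) f"
      using pvm pow_closed[OF f] by (simp add: projection_valued_measure_def)
    ultimately show ?thesis using inner_E_pow[OF R f f, of UNIV n] by simp
  qed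
  then have "represents_powers I L f R (\<nu> f)"
    using f R finite_\<nu> by (simp add: represents_powers_def sets_\<nu>)
  then show ?thesis ..
qed

end

text \<open>
  Whatever resolution is selected, its measure has the moments of the constructed one, whose support
  is controlled by the norm of \<open>L\<close>.
\<close>

theorem spectral_measure_represents_powers:
  assumes "selfadjoint_op I L" and x: "x \<in> I"
    and K: "0 < K" "\<forall>f\<in>ell2 I. ell2_norm I (L f) \<le> K * ell2_norm I f"
  shows "represents_powers I L (delta x) K (spectral_measure I L x)"
proof -
  interpret selfadjoint_bounded_by I L K using assms by unfold_locales
  have "is_spectral_resolution I L (spectral_resolution I L)"
    unfolding spectral_resolution_def by (rule someI[of "is_spectral_resolution I L", OF is_spectral_resolution_E])
  then interpret spectral_resolution_of I L "spectral_resolution I L" by unfold_locales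
  have sm: "spectral_measure I L x = \<nu> (delta x)"
    using assms(1) by (simp add: spectral_measure_def)
  have d: "delta x \<in> ell2 I" using x by (rule ell2_delta)
  obtain R where "represents_powers I L (delta x) R (\<nu> (delta x))"
    using represents_powers_\<nu>[OF d] by blast
  then have "mu (delta x) = \<nu> (delta x)" by (rule represents_powers_unique[OF d mu[OF d]])
  then show ?thesis using mu[OF d] sm by simp
qed

section \<open>Convolution operators\<close>

text \<open>
  Push-forward along an injective map only relabels the index.
\<close>

lemma infsum_push_forward:
  assumes inj: "inj_on \<phi> (carrier H)" and maps: "\<phi> ` carrier H \<subseteq> S"
  shows "(\<Sum>\<^sub>\<infinity>z\<in>S. push_forward H \<phi> m z * \<psi> z) = (\<Sum>\<^sub>\<infinity>x\<in>carrier H. m x * \<psi> (\<phi> x))"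
    and "(\<lambda>x. cmod (m x)) summable_on carrier H \<Longrightarrow> (\<lambda>z. cmod (push_forward H \<phi> m z)) summable_on S"
proof -
  have on: "push_forward H \<phi> m (\<phi> x) = m x" if "x \<in> carrier H" for x
  proof -
    have "{y \<in> carrier H. \<phi> y = \<phi> x} = {x}" using inj that by (auto simp: inj_on_def)
    then show ?thesis by (simp add: push_forward_def)
  qed
  have off: "push_forward H \<phi> m z = 0" if "z \<notin> \<phi> ` carrier H" for z
  proof -
    have "{y \<in> carrier H. \<phi> y = z} = {}" using that by auto
    then show ?thesis by (simp only: push_forward_def infsum_empty)
  qed
  have "(\<Sum>\<^sub>\<infinity>z\<in>S. push_forward H \<phi> m z * \<psi> z) = (\<Sum>\<^sub>\<infinity>z\<in>\<phi> ` carrier H. push_forward H \<phi> m z * \<psi> z)"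
    using maps off by (intro infsum_cong_neutral) auto
  also have "\<dots> = (\<Sum>\<^sub>\<infinity>x\<in>carrier H. push_forward H \<phi> m (\<phi> x) * \<psi> (\<phi> x))"
    using inj by (subst infsum_reindex) (simp_all add: o_def)
  also have "\<dots> = (\<Sum>\<^sub>\<infinity>x\<in>carrier H. m x * \<psi> (\<phi> x))"
    by (intro infsum_cong) (simp add: on)
  finally show "(\<Sum>\<^sub>\<infinity>z\<in>S. push_forward H \<phi> m z * \<psi> z) = (\<Sum>\<^sub>\<infinity>x\<in>carrier H. m x * \<psi> (\<phi> x))" .
  assume "(\<lambda>x. cmod (m x)) summable_on carrier H"
  then have "(\<lambda>x. cmod (push_forward H \<phi> m (\<phi> x))) summable_on carrier H"
    by (subst summable_on_cong[where g = "\<lambda>x. cmod (m x)"]) (auto simp: on)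
  then have "(\<lambda>z. cmod (push_forward H \<phi> m z)) summable_on \<phi> ` carrier H"
    using inj by (subst summable_on_reindex) (simp_all add: o_def)
  then show "(\<lambda>z. cmod (push_forward H \<phi> m z)) summable_on S"
    by (rule summable_on_cong_neutral[THEN iffD1, rotated -1]) (use maps off in auto)
qed

lemma infsum_finite_sum:
  fixes h :: "'a \<Rightarrow> 'b \<Rightarrow> complex"
  assumes "finite F" "\<And>y. y \<in> F \<Longrightarrow> h y summable_on S"
  shows "(\<Sum>\<^sub>\<infinity>x\<in>S. \<Sum>y\<in>F. h y x) = (\<Sum>y\<in>F. \<Sum>\<^sub>\<infinity>x\<in>S. h y x)"
proof -
  have "(\<lambda>x. \<Sum>y\<in>F. h y x) summable_on S \<and> (\<Sum>\<^sub>\<infinity>x\<in>S. \<Sum>y\<in>F. h y x) = (\<Sum>y\<in>F. \<Sum>\<^sub>\<infinity>x\<in>S. h y x)"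
    using assms by (induction F rule: finite_induct) (auto simp: infsum_add intro!: summable_on_add)
  then show ?thesis ..
qed

context group
begin

lemma bij_translate: "x \<in> carrier G \<Longrightarrow> bij_betw (\<lambda>y. inv x \<otimes> y) (carrier G) (carrier G)"
  by (rule bij_betwI[where g = "\<lambda>y. x \<otimes> y"]) (auto simp: m_assoc[symmetric])

lemma left_regular_ell2:
  assumes x: "x \<in> carrier G" and f: "f \<in> ell2 (carrier G)"
  shows "left_regular G x f \<in> ell2 (carrier G)"
    and "ell2_norm (carrier G) (left_regular G x f) = ell2_norm (carrier G) f"
proof -
  have "(\<lambda>y. (cmod (f (inv x \<otimes> y)))\<^sup>2) summable_on carrier G"
    using summable_on_reindex_bij_betw[OF bij_translate[OF x], of "\<lambda>y. (cmod (f y))\<^sup>2"] ell2D[OF f] by simp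
  then have "(\<lambda>y. (cmod (left_regular G x f y))\<^sup>2) summable_on carrier G"
    by (subst summable_on_cong[where g = "\<lambda>y. (cmod (f (inv x \<otimes> y)))\<^sup>2"]) (auto simp: left_regular_def)
  then show "left_regular G x f \<in> ell2 (carrier G)" by (auto simp: ell2_def left_regular_def)
  have "(\<Sum>\<^sub>\<infinity>y\<in>carrier G. (cmod (left_regular G x f y))\<^sup>2) = (\<Sum>\<^sub>\<infinity>y\<in>carrier G. (cmod (f (inv x \<otimes> y)))\<^sup>2)"
    by (intro infsum_cong) (auto simp: left_regular_def)
  also have "\<dots> = (\<Sum>\<^sub>\<infinity>y\<in>carrier G. (cmod (f y))\<^sup>2)"
    by (rule infsum_reindex_bij_betw[OF bij_translate[OF x], of "\<lambda>y. (cmod (f y))\<^sup>2"])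
  finally show "ell2_norm (carrier G) (left_regular G x f) = ell2_norm (carrier G) f"
    by (simp add: ell2_norm_def)
qed

lemma inner_left_regular:
  assumes x: "x \<in> carrier G"
  shows "ell2_inner (carrier G) g (left_regular G x f) = ell2_inner (carrier G) (left_regular G (inv x) g) f"
proof -
  have "ell2_inner (carrier G) g (left_regular G x f)
      = (\<Sum>\<^sub>\<infinity>y\<in>carrier G. cnj (left_regular G (inv x) g (inv x \<otimes> y)) * f (inv x \<otimes> y))"
    unfolding ell2_inner_def using x
    by (intro infsum_cong) (auto simp: left_regular_def m_assoc[symmetric])
  also have "\<dots> = ell2_inner (carrier G) (left_regular G (inv x) g) f"
    unfolding ell2_inner_def
    by (rule infsum_reindex_bij_betw[OF bij_translate[OF x], of "\<lambda>y. cnj (left_regular G (inv x) g y) * f y"])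
  finally show ?thesis .
qed

lemma convolution_summable:
  assumes m: "finite_complex_measure G m" and f: "f \<in> ell2 (carrier G)"
  shows "(\<lambda>x. m x * left_regular G x f y) summable_on carrier G"
proof (rule abs_summable_summable, rule summable_on_comparison_test)
  show "(\<lambda>x. cmod (m x) * ell2_norm (carrier G) f) summable_on carrier G"
    using m by (intro summable_on_cmult_left) (simp add: finite_complex_measure_def)
  fix x assume x: "x \<in> carrier G"
  have "cmod (left_regular G x f y) \<le> ell2_norm (carrier G) f"
  proof (cases "y \<in> carrier G")
    case True
    then show ?thesis using cmod_le_ell2_norm[OF left_regular_ell2(1)[OF x f]] left_regular_ell2(2)[OF x f] by simp
  qed (simp add: left_regular_def)
  then show "cmod (m x * left_regular G x f y) \<le> cmod (m x) * ell2_norm (carrier G) f"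
    by (simp add: norm_mult mult_left_mono)
qed auto

lemma convolution_pairing_summable:
  assumes m: "finite_complex_measure G m" and f: "f \<in> ell2 (carrier G)" and g: "g \<in> ell2 (carrier G)"
  shows "(\<lambda>x. cmod (m x * ell2_inner (carrier G) g (left_regular G x f))) summable_on carrier G"
    and "x \<in> carrier G \<Longrightarrow> cmod (m x * ell2_inner (carrier G) g (left_regular G x f))
      \<le> cmod (m x) * (ell2_norm (carrier G) g * ell2_norm (carrier G) f)"
proof -
  have le: "cmod (m x * ell2_inner (carrier G) g (left_regular G x f))
      \<le> cmod (m x) * (ell2_norm (carrier G) g * ell2_norm (carrier G) f)" if x: "x \<in> carrier G" for x
    using ell2_inner_bound[OF g left_regular_ell2(1)[OF x f]] left_regular_ell2(2)[OF x f]
    by (simp add: norm_mult mult_left_mono)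
  then show "x \<in> carrier G \<Longrightarrow> cmod (m x * ell2_inner (carrier G) g (left_regular G x f))
      \<le> cmod (m x) * (ell2_norm (carrier G) g * ell2_norm (carrier G) f)" .
  show "(\<lambda>x. cmod (m x * ell2_inner (carrier G) g (left_regular G x f))) summable_on carrier G"
  proof (rule summable_on_comparison_test)
    show "(\<lambda>x. cmod (m x) * (ell2_norm (carrier G) g * ell2_norm (carrier G) f)) summable_on carrier G"
      using m by (intro summable_on_cmult_left) (simp add: finite_complex_measure_def)
  qed (use le in auto)
qed

text \<open>
  Young's inequality. The convolution \<open>u\<close> is paired with its restriction \<open>c\<close> to a finite set, and the
  sum over the group is estimated term by term, translations being isometric.
\<close>

lemma convolution_ell2:
  assumes m: "finite_complex_measure G m" and f: "f \<in> ell2 (carrier G)"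
  shows "convolution_op G m f \<in> ell2 (carrier G)"
    and "ell2_norm (carrier G) (convolution_op G m f)
      \<le> (\<Sum>\<^sub>\<infinity>x\<in>carrier G. cmod (m x)) * ell2_norm (carrier G) f"
proof -
  let ?I = "carrier G" and ?u = "convolution_op G m f"
  define C where "C = (\<Sum>\<^sub>\<infinity>x\<in>?I. cmod (m x)) * ell2_norm ?I f"
  have u0: "?u y = 0" if "y \<notin> ?I" for y
    using that by (simp add: convolution_op_def left_regular_def)
  have C0: "0 \<le> C" by (simp add: C_def infsum_nonneg)
  have b: "(\<Sum>y\<in>F. (cmod (?u y))\<^sup>2) \<le> C * sqrt (\<Sum>y\<in>F. (cmod (?u y))\<^sup>2)" if F: "finite F" "F \<subseteq> ?I" for F
  proof -
    define c where "c = (\<lambda>y. if y \<in> F then ?u y else 0)"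
    have c: "c \<in> ell2 ?I" unfolding c_def by (rule ell2_cut[OF F])
    have "of_real (\<Sum>y\<in>F. (cmod (?u y))\<^sup>2) = (\<Sum>y\<in>F. cnj (?u y) * ?u y)"
      unfolding of_real_sum by (intro sum.cong refl) (metis complex_norm_square mult.commute of_real_power)
    also have "\<dots> = (\<Sum>y\<in>F. \<Sum>\<^sub>\<infinity>x\<in>?I. m x * (cnj (?u y) * left_regular G x f y))"
      by (subst (2) convolution_op_def) (simp add: infsum_cmult_right'[symmetric] mult_ac)
    also have "\<dots> = (\<Sum>\<^sub>\<infinity>x\<in>?I. \<Sum>y\<in>F. m x * (cnj (?u y) * left_regular G x f y))"
    proof (rule infsum_finite_sum[symmetric, OF F(1)])
      fix y assume "y \<in> F"
      show "(\<lambda>x. m x * (cnj (?u y) * left_regular G x f y)) summable_on ?I"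
        using summable_on_cmult_right[OF convolution_summable[OF m f, of y], of "cnj (?u y)"]
        by (simp add: mult_ac)
    qed
    also have "\<dots> = (\<Sum>\<^sub>\<infinity>x\<in>?I. m x * ell2_inner ?I c (left_regular G x f))"
    proof (intro infsum_cong)
      fix x
      have "ell2_inner ?I c (left_regular G x f) = (\<Sum>\<^sub>\<infinity>y\<in>F. cnj (?u y) * left_regular G x f y)"
        unfolding ell2_inner_def using F by (intro infsum_cong_neutral) (auto simp: c_def)
      then show "(\<Sum>y\<in>F. m x * (cnj (?u y) * left_regular G x f y)) = m x * ell2_inner ?I c (left_regular G x f)"
        using F by (simp add: sum_distrib_left)
    qed
    finally have eq: "of_real (\<Sum>y\<in>F. (cmod (?u y))\<^sup>2) = (\<Sum>\<^sub>\<infinity>x\<in>?I. m x * ell2_inner ?I c (left_regular G x f))" .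
    have "(\<Sum>y\<in>F. (cmod (?u y))\<^sup>2) = cmod (of_real (\<Sum>y\<in>F. (cmod (?u y))\<^sup>2))"
      by (subst norm_of_real) (simp add: sum_nonneg)
    also have "\<dots> = cmod (\<Sum>\<^sub>\<infinity>x\<in>?I. m x * ell2_inner ?I c (left_regular G x f))" by (simp only: eq)
    also have "\<dots> \<le> (\<Sum>\<^sub>\<infinity>x\<in>?I. cmod (m x * ell2_inner ?I c (left_regular G x f)))"
      by (rule norm_infsum_bound) (rule convolution_pairing_summable(1)[OF m f c])
    also have "\<dots> \<le> (\<Sum>\<^sub>\<infinity>x\<in>?I. cmod (m x) * (ell2_norm ?I c * ell2_norm ?I f))"
      using m by (intro infsum_mono convolution_pairing_summable[OF m f c] summable_on_cmult_left)
        (simp_all add: finite_complex_measure_def)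
    also have "\<dots> = C * ell2_norm ?I c" by (simp add: C_def infsum_cmult_left' mult_ac)
    also have "ell2_norm ?I c = sqrt (\<Sum>y\<in>F. (cmod (?u y))\<^sup>2)"
      unfolding c_def by (subst ell2_norm_cut[OF F, symmetric]) simp
    finally show ?thesis .
  qed
  show "?u \<in> ell2 ?I" by (rule ell2I_finite_bound(1)[OF u0 C0 b])
  have "ell2_norm ?I ?u \<le> C" by (rule ell2I_finite_bound(2)[OF u0 C0 b])
  then show "ell2_norm ?I ?u \<le> (\<Sum>\<^sub>\<infinity>x\<in>?I. cmod (m x)) * ell2_norm ?I f" by (simp add: C_def)
qed

text \<open>
  An exchange of sums. Absolute convergence is the summability of the pairings for \<open>\<bar>m\<bar>\<close>, \<open>\<bar>g\<bar>\<close> and \<open>\<bar>f\<bar>\<close>.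
\<close>

lemma convolution_inner:
  assumes m: "finite_complex_measure G m" and f: "f \<in> ell2 (carrier G)" and g: "g \<in> ell2 (carrier G)"
  shows "ell2_inner (carrier G) g (convolution_op G m f)
    = (\<Sum>\<^sub>\<infinity>x\<in>carrier G. m x * ell2_inner (carrier G) g (left_regular G x f))"
proof -
  let ?I = "carrier G"
  let ?h = "\<lambda>x y. m x * (cnj (g y) * left_regular G x f y)"
  have "(\<lambda>p. norm (?h (fst p) (snd p))) summable_on Sigma ?I (\<lambda>_. ?I)"
  proof (rule Infinite_Sum.abs_summable_on_Sigma_iff[where f = "\<lambda>p. ?h (fst p) (snd p)", THEN iffD2], intro conjI ballI)
    fix x assume x: "x \<in> ?I"
    show "(\<lambda>y. cmod (?h (fst (x, y)) (snd (x, y)))) summable_on ?I"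
      using ell2_product_summable[OF g left_regular_ell2(1)[OF x f]]
      by (simp add: norm_mult summable_on_cmult_right)
  next
    define a where "a = (\<lambda>y. of_real (cmod (g y)) :: complex)"
    define b where "b = (\<lambda>y. of_real (cmod (f y)) :: complex)"
    have a: "a \<in> ell2 ?I" and b: "b \<in> ell2 ?I"
      using f g by (auto simp: ell2_def a_def b_def)
    have e: "norm (\<Sum>\<^sub>\<infinity>y\<in>?I. norm (?h (fst (x, y)) (snd (x, y))))
        = cmod (of_real (cmod (m x)) * ell2_inner ?I a (left_regular G x b))" for x
    proof -
      define s where "s = (\<Sum>\<^sub>\<infinity>y\<in>?I. cmod (g y) * cmod (left_regular G x f y))"
      have "ell2_inner ?I a (left_regular G x b) = of_real s"
        unfolding ell2_inner_def s_def infsum_of_real[symmetric]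
        by (intro infsum_cong) (auto simp: a_def b_def left_regular_def)
      moreover have "(\<Sum>\<^sub>\<infinity>y\<in>?I. norm (?h (fst (x, y)) (snd (x, y)))) = cmod (m x) * s"
        by (simp add: s_def norm_mult infsum_cmult_right')
      moreover have "0 \<le> s" by (simp add: s_def infsum_nonneg)
      ultimately show ?thesis by (simp add: norm_mult)
    qed
    have "finite_complex_measure G (\<lambda>x. of_real (cmod (m x)))"
      using m by (simp add: finite_complex_measure_def)
    from convolution_pairing_summable(1)[OF this b a]
    show "(\<lambda>x. norm (\<Sum>\<^sub>\<infinity>y\<in>?I. norm (?h (fst (x, y)) (snd (x, y))))) summable_on ?I"
      by (simp only: e)
  qed
  then have sw: "(\<lambda>(x, y). ?h x y) summable_on ?I \<times> ?I"
    unfolding case_prod_unfold by (rule abs_summable_summable)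
  have "ell2_inner ?I g (convolution_op G m f) = (\<Sum>\<^sub>\<infinity>y\<in>?I. \<Sum>\<^sub>\<infinity>x\<in>?I. ?h x y)"
    unfolding ell2_inner_def convolution_op_def
    by (simp add: infsum_cmult_right'[symmetric] mult_ac)
  also have "\<dots> = (\<Sum>\<^sub>\<infinity>x\<in>?I. \<Sum>\<^sub>\<infinity>y\<in>?I. ?h x y)"
    by (rule infsum_swap_banach[OF sw, symmetric])
  also have "\<dots> = (\<Sum>\<^sub>\<infinity>x\<in>?I. m x * ell2_inner ?I g (left_regular G x f))"
    unfolding ell2_inner_def by (simp add: infsum_cmult_right')
  finally show ?thesis .
qed

lemma convolution_selfadjoint:
  assumes m: "finite_complex_measure G m" and sym: "\<And>x. x \<in> carrier G \<Longrightarrow> m (inv x) = cnj (m x)"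
  shows "selfadjoint_op (carrier G) (convolution_op G m)"
  unfolding selfadjoint_op_def bounded_op_def
proof (intro conjI ballI allI)
  let ?I = "carrier G"
  fix f g assume f: "f \<in> ell2 ?I" and g: "g \<in> ell2 ?I"
  show "convolution_op G m f \<in> ell2 ?I" by (rule convolution_ell2(1)[OF m f])
  show "convolution_op G m (\<lambda>x. f x + g x) = (\<lambda>x. convolution_op G m f x + convolution_op G m g x)"
  proof
    fix y
    have "convolution_op G m (\<lambda>x. f x + g x) y
        = (\<Sum>\<^sub>\<infinity>x\<in>?I. m x * left_regular G x f y + m x * left_regular G x g y)"
      unfolding convolution_op_def by (intro infsum_cong) (simp add: left_regular_def distrib_left)
    also have "\<dots> = convolution_op G m f y + convolution_op G m g y"
      unfolding convolution_op_def by (intro infsum_add convolution_summable m f g)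
    finally show "convolution_op G m (\<lambda>x. f x + g x) y = convolution_op G m f y + convolution_op G m g y" .
  qed
  have "ell2_inner ?I (convolution_op G m f) g = cnj (\<Sum>\<^sub>\<infinity>x\<in>?I. m x * ell2_inner ?I g (left_regular G x f))"
    by (subst ell2_inner_cnj[symmetric]) (simp only: convolution_inner[OF m f g])
  also have "\<dots> = (\<Sum>\<^sub>\<infinity>x\<in>?I. m (inv x) * ell2_inner ?I f (left_regular G (inv x) g))"
    unfolding infsum_cnj[symmetric] complex_cnj_mult ell2_inner_cnj
    by (intro infsum_cong) (simp add: sym inner_left_regular)
  also have "\<dots> = (\<Sum>\<^sub>\<infinity>x\<in>?I. m x * ell2_inner ?I f (left_regular G x g))"
    by (rule infsum_reindex_bij_betw[of "\<lambda>x. inv x", where f = "\<lambda>x. m x * ell2_inner ?I f (left_regular G x g)"])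
      (auto intro!: bij_betwI[where g = "\<lambda>x. inv x"])
  also have "\<dots> = ell2_inner ?I f (convolution_op G m g)" by (rule convolution_inner[OF m g f, symmetric])
  finally show "ell2_inner ?I f (convolution_op G m g) = ell2_inner ?I (convolution_op G m f) g" ..
next
  fix c f assume f: "f \<in> ell2 (carrier G)"
  show "convolution_op G m (\<lambda>x. c * f x) = (\<lambda>x. c * convolution_op G m f x)"
    unfolding convolution_op_def infsum_cmult_right'[symmetric]
    by (intro ext infsum_cong) (simp add: left_regular_def)
next
  show "\<exists>K. \<forall>f\<in>ell2 (carrier G). ell2_norm (carrier G) (convolution_op G m f) \<le> K * ell2_norm (carrier G) f"
    using convolution_ell2(2)[OF m] by blast
qed

lemma convolution_delta:
  assumes "x \<in> carrier G" "y \<in> carrier G"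
  shows "convolution_op G m (delta x) y = m (y \<otimes> inv x)"
proof -
  have eq: "inv z \<otimes> y = x \<longleftrightarrow> z = y \<otimes> inv x" if "z \<in> carrier G" for z
    using assms that by (metis inv_closed inv_inv inv_solve_left inv_solve_right m_closed)
  have "convolution_op G m (delta x) y = (\<Sum>\<^sub>\<infinity>z\<in>{y \<otimes> inv x}. m z * left_regular G z (delta x) y)"
    unfolding convolution_op_def using assms
    by (intro infsum_cong_neutral) (auto simp: left_regular_def delta_def eq)
  then show ?thesis using assms eq[of "y \<otimes> inv x"] by (simp add: left_regular_def delta_def)
qed

text \<open>
  Compare the matrix entries of the operator between \<open>delta \<one>\<close> and \<open>delta x\<close>.
\<close>

lemma selfadjoint_convolutionD:
  assumes sa: "selfadjoint_op (carrier G) (convolution_op G m)" and x: "x \<in> carrier G"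
  shows "m (inv x) = cnj (m x)"
proof -
  interpret selfadjoint_operator "carrier G" "convolution_op G m" by unfold_locales (rule sa)
  have d: "delta x \<in> ell2 (carrier G)" "delta \<one> \<in> ell2 (carrier G)" using x by (auto intro: ell2_delta)
  have "m (inv x) = ell2_inner (carrier G) (delta \<one>) (convolution_op G m (delta x))"
    using x by (simp add: ell2_inner_delta_left convolution_delta)
  also have "\<dots> = ell2_inner (carrier G) (convolution_op G m (delta \<one>)) (delta x)"
    by (rule adjoint[OF d(2,1)])
  also have "\<dots> = cnj (m x)"
    using x by (subst ell2_inner_cnj[symmetric]) (simp add: ell2_inner_delta_left convolution_delta)
  finally show ?thesis .
qed

lemma convolution_add_measure:
  assumes "finite_complex_measure G m" "finite_complex_measure G n" "f \<in> ell2 (carrier G)"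
  shows "convolution_op G (\<lambda>x. m x + n x) f = (\<lambda>y. convolution_op G m f y + convolution_op G n f y)"
  unfolding convolution_op_def distrib_right
  by (intro ext infsum_add convolution_summable assms)

end

section \<open>Vectors over the wreath product\<close>

lemma push_forward_symmetric:
  assumes "group_hom H G \<phi>" and inj: "inj_on \<phi> (carrier H)"
    and sym: "\<And>x. x \<in> carrier H \<Longrightarrow> m (inv\<^bsub>H\<^esub> x) = cnj (m x)" and z: "z \<in> carrier G"
  shows "push_forward H \<phi> m (inv\<^bsub>G\<^esub> z) = cnj (push_forward H \<phi> m z)"
proof -
  interpret group_hom H G \<phi> by fact
  have "inj_on (\<lambda>x. inv\<^bsub>H\<^esub> x) (carrier H)"
    by (rule G.inv_inj)
  then have inv_inj: "inj_on (\<lambda>x. inv\<^bsub>H\<^esub> x) {x \<in> carrier H. \<phi> x = z}"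
    by (rule inj_on_subset) auto
  have "{x \<in> carrier H. \<phi> x = inv\<^bsub>G\<^esub> z} = (\<lambda>x. inv\<^bsub>H\<^esub> x) ` {x \<in> carrier H. \<phi> x = z}"
  proof (intro equalityI subsetI)
    fix x assume x: "x \<in> {x \<in> carrier H. \<phi> x = inv\<^bsub>G\<^esub> z}"
    then have "\<phi> (inv\<^bsub>H\<^esub> x) = z" using z by simp
    then show "x \<in> (\<lambda>x. inv\<^bsub>H\<^esub> x) ` {x \<in> carrier H. \<phi> x = z}"
      using x by (intro image_eqI[of _ _ "inv\<^bsub>H\<^esub> x"]) auto
  qed (use z in auto)
  then have "push_forward H \<phi> m (inv\<^bsub>G\<^esub> z) = (\<Sum>\<^sub>\<infinity>x\<in>{x \<in> carrier H. \<phi> x = z}. m (inv\<^bsub>H\<^esub> x))"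
    unfolding push_forward_def
    by (simp add: infsum_reindex[OF inv_inj] o_def)
  also have "\<dots> = (\<Sum>\<^sub>\<infinity>x\<in>{x \<in> carrier H. \<phi> x = z}. cnj (m x))"
    by (intro infsum_cong) (simp add: sym)
  finally show ?thesis by (simp add: push_forward_def)
qed

text \<open>
  The symmetry of the two measures expresses that their convolution operators are self-adjoint
  (\<open>convolution_selfadjoint\<close>, \<open>selfadjoint_convolutionD\<close>).
\<close>

locale wreath_pair = G: group \<Gamma> + L: group \<Lambda>
  for \<Gamma> :: "('g, 'c) monoid_scheme" and \<Lambda> :: "('l, 'd) monoid_scheme" +
  fixes m\<^sub>\<Gamma> :: "'g \<Rightarrow> complex" and m\<^sub>\<Lambda> :: "'l \<Rightarrow> complex"
  assumes m\<Gamma>: "finite_complex_measure \<Gamma> m\<^sub>\<Gamma>" and m\<Lambda>: "finite_complex_measure \<Lambda> m\<^sub>\<Lambda>"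
    and sym\<Gamma>: "\<And>x. x \<in> carrier \<Gamma> \<Longrightarrow> m\<^sub>\<Gamma> (inv\<^bsub>\<Gamma>\<^esub> x) = cnj (m\<^sub>\<Gamma> x)"
    and sym\<Lambda>: "\<And>x. x \<in> carrier \<Lambda> \<Longrightarrow> m\<^sub>\<Lambda> (inv\<^bsub>\<Lambda>\<^esub> x) = cnj (m\<^sub>\<Lambda> x)"
begin

abbreviation W where "W \<equiv> wreath \<Lambda> \<Gamma>"
abbreviation base where "base \<equiv> embed_base \<Lambda> \<Gamma>"
abbreviation lamp where "lamp \<equiv> embed_lamp \<Lambda> \<Gamma>"
abbreviation e where "e \<equiv> (\<lambda>h\<in>carrier \<Gamma>. \<one>\<^bsub>\<Lambda>\<^esub>)"

sublocale W: group W
  by (rule group_wreath) (rule L.group_axioms G.group_axioms)+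

lemma carrier_W: "carrier W = lamp_configs \<Lambda> \<Gamma> \<times> carrier \<Gamma>"
  by (simp add: wreath_def)

lemma one_W: "\<one>\<^bsub>W\<^esub> = (e, \<one>\<^bsub>\<Gamma>\<^esub>)"
  by (simp add: wreath_def)

lemma mult_W: "(f, g) \<otimes>\<^bsub>W\<^esub> (f', g') =
    (\<lambda>h\<in>carrier \<Gamma>. f h \<otimes>\<^bsub>\<Lambda>\<^esub> f' (inv\<^bsub>\<Gamma>\<^esub> g \<otimes>\<^bsub>\<Gamma>\<^esub> h), g \<otimes>\<^bsub>\<Gamma>\<^esub> g')"
  by (simp add: wreath_def)

lemma configD:
  assumes "f \<in> lamp_configs \<Lambda> \<Gamma>"
  shows "x \<in> carrier \<Gamma> \<Longrightarrow> f x \<in> carrier \<Lambda>" "x \<notin> carrier \<Gamma> \<Longrightarrow> f x = undefined"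
    "finite {x \<in> carrier \<Gamma>. f x \<noteq> \<one>\<^bsub>\<Lambda>\<^esub>}"
  using assms by (auto simp: lamp_configs_def PiE_def extensional_def)

lemma e_config: "e \<in> lamp_configs \<Lambda> \<Gamma>"
  by (rule lamp_configsI[where F = "{}"]) auto

lemma base_closed: "x \<in> carrier \<Gamma> \<Longrightarrow> base x \<in> carrier W"
  by (simp add: embed_base_def carrier_W e_config)

lemma lamp_closed: "l \<in> carrier \<Lambda> \<Longrightarrow> lamp l \<in> carrier W"
  unfolding embed_lamp_def carrier_W
  by (auto intro!: lamp_configsI[where F = "{\<one>\<^bsub>\<Gamma>\<^esub>}"] split: if_splits)

lemma base_hom: "group_hom \<Gamma> W base"
  by unfold_locales
    (auto intro!: homI simp: base_closed fun_eq_iff, auto simp: embed_base_def mult_W fun_eq_iff)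

lemma lamp_hom: "group_hom \<Lambda> W lamp"
  by unfold_locales
    (auto intro!: homI simp: lamp_closed fun_eq_iff, auto simp: embed_lamp_def mult_W fun_eq_iff)

lemma base_inj: "inj_on base (carrier \<Gamma>)"
  by (auto simp: inj_on_def embed_base_def)

lemma lamp_inj: "inj_on lamp (carrier \<Lambda>)"
  by (auto simp: inj_on_def embed_lamp_def dest!: fun_cong[of _ _ "\<one>\<^bsub>\<Gamma>\<^esub>"])

lemma base_mult:
  assumes "x \<in> carrier \<Gamma>" "f \<in> lamp_configs \<Lambda> \<Gamma>" "h \<in> carrier \<Gamma>"
  shows "inv\<^bsub>W\<^esub> (base x) \<otimes>\<^bsub>W\<^esub> (f, h) = (\<lambda>y\<in>carrier \<Gamma>. f (x \<otimes>\<^bsub>\<Gamma>\<^esub> y), inv\<^bsub>\<Gamma>\<^esub> x \<otimes>\<^bsub>\<Gamma>\<^esub> h)"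
proof -
  interpret group_hom \<Gamma> W base by (rule base_hom)
  have "inv\<^bsub>W\<^esub> (base x) = base (inv\<^bsub>\<Gamma>\<^esub> x)" using assms by simp
  then show ?thesis using assms by (auto simp: embed_base_def mult_W fun_eq_iff configD)
qed

lemma lamp_mult:
  assumes "l \<in> carrier \<Lambda>" "f \<in> lamp_configs \<Lambda> \<Gamma>" "h \<in> carrier \<Gamma>"
  shows "inv\<^bsub>W\<^esub> (lamp l) \<otimes>\<^bsub>W\<^esub> (f, h) = (f(\<one>\<^bsub>\<Gamma>\<^esub> := inv\<^bsub>\<Lambda>\<^esub> l \<otimes>\<^bsub>\<Lambda>\<^esub> f \<one>\<^bsub>\<Gamma>\<^esub>), h)"
proof -
  interpret group_hom \<Lambda> W lamp by (rule lamp_hom)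
  have "inv\<^bsub>W\<^esub> (lamp l) = lamp (inv\<^bsub>\<Lambda>\<^esub> l)" using assms by simp
  then show ?thesis using assms by (auto simp: embed_lamp_def mult_W fun_eq_iff configD)
qed

definition m\<^sub>1 where "m\<^sub>1 = push_forward \<Gamma> base m\<^sub>\<Gamma>"
definition m\<^sub>2 where "m\<^sub>2 = push_forward \<Lambda> lamp m\<^sub>\<Lambda>"

lemma m\<^sub>1: "finite_complex_measure W m\<^sub>1" and m\<^sub>2: "finite_complex_measure W m\<^sub>2"
  using infsum_push_forward(2)[OF base_inj, of "carrier W" m\<^sub>\<Gamma>] base_closed m\<Gamma>
    infsum_push_forward(2)[OF lamp_inj, of "carrier W" m\<^sub>\<Lambda>] lamp_closed m\<Lambda>
  by (auto simp: finite_complex_measure_def m\<^sub>1_def m\<^sub>2_def)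

lemma m\<^sub>1_sym: "z \<in> carrier W \<Longrightarrow> m\<^sub>1 (inv\<^bsub>W\<^esub> z) = cnj (m\<^sub>1 z)"
  unfolding m\<^sub>1_def by (rule push_forward_symmetric[OF base_hom base_inj]) (auto simp: sym\<Gamma>)

lemma m\<^sub>2_sym: "z \<in> carrier W \<Longrightarrow> m\<^sub>2 (inv\<^bsub>W\<^esub> z) = cnj (m\<^sub>2 z)"
  unfolding m\<^sub>2_def by (rule push_forward_symmetric[OF lamp_hom lamp_inj]) (auto simp: sym\<Lambda>)

definition M where "M = convolution_op W (\<lambda>z. m\<^sub>1 z + m\<^sub>2 z)"

lemma M_selfadjoint: "selfadjoint_op (carrier W) M"
  unfolding M_def
proof (rule W.convolution_selfadjoint)
  show "finite_complex_measure W (\<lambda>z. m\<^sub>1 z + m\<^sub>2 z)"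
    unfolding finite_complex_measure_def
  proof (rule summable_on_comparison_test)
    show "(\<lambda>z. cmod (m\<^sub>1 z) + cmod (m\<^sub>2 z)) summable_on carrier W"
      using m\<^sub>1 m\<^sub>2 by (intro summable_on_add) (auto simp: finite_complex_measure_def)
  qed (auto intro: norm_triangle_ineq)
qed (simp add: m\<^sub>1_sym m\<^sub>2_sym)

sublocale M: selfadjoint_operator "carrier W" M
  by unfold_locales (rule M_selfadjoint)

text \<open>
  The state of a single lamp after \<open>n\<close> applications of the convolution operator.
\<close>

definition b :: "nat \<Rightarrow> 'l \<Rightarrow> complex" where
  "b n = (convolution_op \<Lambda> m\<^sub>\<Lambda> ^^ n) (delta \<one>\<^bsub>\<Lambda>\<^esub>)"

lemma b_0: "b 0 l = (if l = \<one>\<^bsub>\<Lambda>\<^esub> then 1 else 0)"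
  by (simp add: b_def delta_def)

lemma b_Suc: "l \<in> carrier \<Lambda> \<Longrightarrow> b (Suc n) l = (\<Sum>\<^sub>\<infinity>x\<in>carrier \<Lambda>. m\<^sub>\<Lambda> x * b n (inv\<^bsub>\<Lambda>\<^esub> x \<otimes>\<^bsub>\<Lambda>\<^esub> l))"
  by (simp add: b_def convolution_op_def left_regular_def)

text \<open>
  The lamp at site \<open>x\<close> is \<open>f (g x\<^sup>-\<^sup>1)\<close> if the walker is at \<open>g\<close>. At a site that is not active the lamp is
  off and \<open>count k x = 0\<close>, so the corresponding factor of the product over all sites is \<open>b 0 \<one> = 1\<close>;
  restricting \<open>tensor\<close> to active sites makes that product finite.
\<close>

definition active :: "'g multiset \<Rightarrow> 'g \<Rightarrow> ('g \<Rightarrow> 'l) \<Rightarrow> 'g set" where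
  "active k g f = {x \<in> carrier \<Gamma>. x \<in># k \<or> f (g \<otimes>\<^bsub>\<Gamma>\<^esub> inv\<^bsub>\<Gamma>\<^esub> x) \<noteq> \<one>\<^bsub>\<Lambda>\<^esub>}"

definition tensor :: "'g multiset \<Rightarrow> 'g \<Rightarrow> ('g \<Rightarrow> 'l) \<times> 'g \<Rightarrow> complex" where
  "tensor k g = (\<lambda>(f, h). if f \<in> lamp_configs \<Lambda> \<Gamma> \<and> h = g
     then \<Prod>x\<in>active k g f. b (count k x) (f (g \<otimes>\<^bsub>\<Gamma>\<^esub> inv\<^bsub>\<Gamma>\<^esub> x)) else 0)"

lemma finite_active:
  assumes "f \<in> lamp_configs \<Lambda> \<Gamma>" "g \<in> carrier \<Gamma>"
  shows "finite (active k g f)"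
proof -
  have "{x \<in> carrier \<Gamma>. f (g \<otimes>\<^bsub>\<Gamma>\<^esub> inv\<^bsub>\<Gamma>\<^esub> x) \<noteq> \<one>\<^bsub>\<Lambda>\<^esub>}
      \<subseteq> (\<lambda>y. inv\<^bsub>\<Gamma>\<^esub> y \<otimes>\<^bsub>\<Gamma>\<^esub> g) ` {x \<in> carrier \<Gamma>. f x \<noteq> \<one>\<^bsub>\<Lambda>\<^esub>}"
  proof
    fix x assume x: "x \<in> {x \<in> carrier \<Gamma>. f (g \<otimes>\<^bsub>\<Gamma>\<^esub> inv\<^bsub>\<Gamma>\<^esub> x) \<noteq> \<one>\<^bsub>\<Lambda>\<^esub>}"
    then have "x = inv\<^bsub>\<Gamma>\<^esub> (g \<otimes>\<^bsub>\<Gamma>\<^esub> inv\<^bsub>\<Gamma>\<^esub> x) \<otimes>\<^bsub>\<Gamma>\<^esub> g"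
      using assms(2) by (simp add: G.inv_mult_group G.m_assoc)
    then show "x \<in> (\<lambda>y. inv\<^bsub>\<Gamma>\<^esub> y \<otimes>\<^bsub>\<Gamma>\<^esub> g) ` {x \<in> carrier \<Gamma>. f x \<noteq> \<one>\<^bsub>\<Lambda>\<^esub>}"
      using x assms(2) by (intro image_eqI) auto
  qed
  then have "finite {x \<in> carrier \<Gamma>. f (g \<otimes>\<^bsub>\<Gamma>\<^esub> inv\<^bsub>\<Gamma>\<^esub> x) \<noteq> \<one>\<^bsub>\<Lambda>\<^esub>}"
    using configD(3)[OF assms(1)] finite_subset by blast
  moreover have "active k g f \<subseteq> set_mset k \<union> {x \<in> carrier \<Gamma>. f (g \<otimes>\<^bsub>\<Gamma>\<^esub> inv\<^bsub>\<Gamma>\<^esub> x) \<noteq> \<one>\<^bsub>\<Lambda>\<^esub>}"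
    by (auto simp: active_def)
  ultimately show ?thesis using finite_subset by blast
qed

lemma tensor_eq:
  assumes "f \<in> lamp_configs \<Lambda> \<Gamma>" "finite J" "J \<subseteq> carrier \<Gamma>" "active k g f \<subseteq> J"
  shows "tensor k g (f, g) = (\<Prod>x\<in>J. b (count k x) (f (g \<otimes>\<^bsub>\<Gamma>\<^esub> inv\<^bsub>\<Gamma>\<^esub> x)))"
proof -
  have "(\<Prod>x\<in>active k g f. b (count k x) (f (g \<otimes>\<^bsub>\<Gamma>\<^esub> inv\<^bsub>\<Gamma>\<^esub> x)))
      = (\<Prod>x\<in>J. b (count k x) (f (g \<otimes>\<^bsub>\<Gamma>\<^esub> inv\<^bsub>\<Gamma>\<^esub> x)))"
    using assms by (intro prod.mono_neutral_left) (auto simp: active_def b_0 not_in_iff)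
  then show ?thesis using assms by (simp add: tensor_def)
qed

lemma tensor_outside: "p \<notin> carrier W \<Longrightarrow> g \<in> carrier \<Gamma> \<Longrightarrow> tensor k g p = 0"
  by (cases p) (auto simp: tensor_def carrier_W)

lemma tensor_empty:
  assumes g: "g \<in> carrier \<Gamma>"
  shows "tensor {#} g = delta (e, g)"
proof
  fix p :: "('g \<Rightarrow> 'l) \<times> 'g"
  obtain f h where p: "p = (f, h)" by (cases p)
  show "tensor {#} g p = delta (e, g) p"
  proof (cases "f \<in> lamp_configs \<Lambda> \<Gamma> \<and> h = g")
    case True
    show ?thesis
    proof (cases "active {#} g f = {}")
      case True
      have "f y = e y" for y
      proof (cases "y \<in> carrier \<Gamma>")
        case y: True
        have "g \<otimes>\<^bsub>\<Gamma>\<^esub> inv\<^bsub>\<Gamma>\<^esub> (inv\<^bsub>\<Gamma>\<^esub> y \<otimes>\<^bsub>\<Gamma>\<^esub> g) = y"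
          using g y by (simp add: G.inv_mult_group G.m_assoc[symmetric])
        moreover have "inv\<^bsub>\<Gamma>\<^esub> y \<otimes>\<^bsub>\<Gamma>\<^esub> g \<in> carrier \<Gamma>" using g y by simp
        ultimately show ?thesis using True y by (auto simp: active_def)
      next
        case False
        then show ?thesis using \<open>f \<in> lamp_configs \<Lambda> \<Gamma> \<and> h = g\<close> by (simp add: configD)
      qed
      then have "f = e" by (rule ext)
      then show ?thesis using True \<open>f \<in> lamp_configs \<Lambda> \<Gamma> \<and> h = g\<close> by (simp add: p tensor_def delta_def)
    next
      case False
      then obtain x where x: "x \<in> active {#} g f" by blast
      then have "b (count {#} x) (f (g \<otimes>\<^bsub>\<Gamma>\<^esub> inv\<^bsub>\<Gamma>\<^esub> x)) = 0" by (simp add: active_def b_0)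
      then have "(\<Prod>x\<in>active {#} g f. b (count {#} x) (f (g \<otimes>\<^bsub>\<Gamma>\<^esub> inv\<^bsub>\<Gamma>\<^esub> x))) = 0"
        using x finite_active[of f g] g True by (intro prod_zero) blast+
      moreover have "f \<noteq> e" using x g by (auto simp: active_def)
      ultimately show ?thesis using True by (simp add: p tensor_def delta_def)
    qed
  next
    case False
    then show ?thesis using e_config by (auto simp: p tensor_def delta_def)
  qed
qed

text \<open>
  Moving the walker carries the configuration along, so the lamp at each site is unchanged.
\<close>

lemma tensor_translate:
  assumes x: "x \<in> carrier \<Gamma>" and g: "g \<in> carrier \<Gamma>"
  shows "left_regular W (base x) (tensor k g) = tensor k (x \<otimes>\<^bsub>\<Gamma>\<^esub> g)"
proof
  fix p :: "('g \<Rightarrow> 'l) \<times> 'g"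
  obtain f h where p: "p = (f, h)" by (cases p)
  show "left_regular W (base x) (tensor k g) p = tensor k (x \<otimes>\<^bsub>\<Gamma>\<^esub> g) p"
  proof (cases "p \<in> carrier W")
    case False
    then show ?thesis using x g by (simp add: left_regular_def tensor_outside)
  next
    case True
    then have f: "f \<in> lamp_configs \<Lambda> \<Gamma>" and h: "h \<in> carrier \<Gamma>" by (auto simp: p carrier_W)
    have "inv\<^bsub>W\<^esub> (base x) \<otimes>\<^bsub>W\<^esub> p \<in> carrier W" using True x by (simp add: base_closed)
    then have f': "(\<lambda>y\<in>carrier \<Gamma>. f (x \<otimes>\<^bsub>\<Gamma>\<^esub> y)) \<in> lamp_configs \<Lambda> \<Gamma>"
      using x f h by (simp add: p base_mult carrier_W)
    have hg: "inv\<^bsub>\<Gamma>\<^esub> x \<otimes>\<^bsub>\<Gamma>\<^esub> h = g \<longleftrightarrow> h = x \<otimes>\<^bsub>\<Gamma>\<^esub> g"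
      using x g h by (metis G.inv_closed G.inv_inv G.inv_solve_left)
    have val: "(\<lambda>y\<in>carrier \<Gamma>. f (x \<otimes>\<^bsub>\<Gamma>\<^esub> y)) (g \<otimes>\<^bsub>\<Gamma>\<^esub> inv\<^bsub>\<Gamma>\<^esub> y) = f (x \<otimes>\<^bsub>\<Gamma>\<^esub> g \<otimes>\<^bsub>\<Gamma>\<^esub> inv\<^bsub>\<Gamma>\<^esub> y)"
      if "y \<in> carrier \<Gamma>" for y
      using x g that by (simp add: G.m_assoc)
    then have act: "active k g (\<lambda>y\<in>carrier \<Gamma>. f (x \<otimes>\<^bsub>\<Gamma>\<^esub> y)) = active k (x \<otimes>\<^bsub>\<Gamma>\<^esub> g) f"
      unfolding active_def by (intro Collect_cong conj_cong refl) (simp only: val)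
    have sub: "active k (x \<otimes>\<^bsub>\<Gamma>\<^esub> g) f \<subseteq> carrier \<Gamma>" by (auto simp: active_def)
    have "(\<Prod>y\<in>active k g (\<lambda>y\<in>carrier \<Gamma>. f (x \<otimes>\<^bsub>\<Gamma>\<^esub> y)).
          b (count k y) ((\<lambda>y\<in>carrier \<Gamma>. f (x \<otimes>\<^bsub>\<Gamma>\<^esub> y)) (g \<otimes>\<^bsub>\<Gamma>\<^esub> inv\<^bsub>\<Gamma>\<^esub> y)))
        = (\<Prod>y\<in>active k (x \<otimes>\<^bsub>\<Gamma>\<^esub> g) f. b (count k y) (f (x \<otimes>\<^bsub>\<Gamma>\<^esub> g \<otimes>\<^bsub>\<Gamma>\<^esub> inv\<^bsub>\<Gamma>\<^esub> y)))"
      unfolding act using sub val by (intro prod.cong refl arg_cong[of _ _ "b _"]) blast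
    then show ?thesis using True f f' x h hg by (simp add: left_regular_def p base_mult tensor_def)
  qed
qed

text \<open>
  The lamp generators change \<open>f\<close> at the identity of the base group, which is the lamp at the site \<open>g\<close>
  of the walker. The other factors come out of the sum, and the remaining convolution raises the
  exponent at \<open>g\<close> by one.
\<close>

lemma tensor_lamp:
  assumes g: "g \<in> carrier \<Gamma>"
  shows "convolution_op W m\<^sub>2 (tensor k g) = tensor (add_mset g k) g"
proof
  fix p :: "('g \<Rightarrow> 'l) \<times> 'g"
  obtain f h where p: "p = (f, h)" by (cases p)
  have conv: "convolution_op W m\<^sub>2 (tensor k g) p
      = (\<Sum>\<^sub>\<infinity>l\<in>carrier \<Lambda>. m\<^sub>\<Lambda> l * left_regular W (lamp l) (tensor k g) p)"
    unfolding convolution_op_def m\<^sub>2_def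
    using lamp_closed by (intro infsum_push_forward(1)[OF lamp_inj, of _ _ "\<lambda>z. left_regular W z (tensor k g) p"]) auto
  show "convolution_op W m\<^sub>2 (tensor k g) p = tensor (add_mset g k) g p"
  proof (cases "p \<in> carrier W")
    case False
    then show ?thesis using g by (simp add: conv left_regular_def tensor_outside)
  next
    case True
    then have f: "f \<in> lamp_configs \<Lambda> \<Gamma>" and h: "h \<in> carrier \<Gamma>" by (auto simp: p carrier_W)
    define fl where "fl l = f(\<one>\<^bsub>\<Gamma>\<^esub> := inv\<^bsub>\<Lambda>\<^esub> l \<otimes>\<^bsub>\<Lambda>\<^esub> f \<one>\<^bsub>\<Gamma>\<^esub>)" for l
    have reg: "left_regular W (lamp l) (tensor k g) p = tensor k g (fl l, h)" if "l \<in> carrier \<Lambda>" for l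
      using that True f h by (simp add: left_regular_def p lamp_mult fl_def)
    have fl: "fl l \<in> lamp_configs \<Lambda> \<Gamma>" if "l \<in> carrier \<Lambda>" for l
    proof -
      have "inv\<^bsub>W\<^esub> (lamp l) \<otimes>\<^bsub>W\<^esub> p \<in> carrier W" using True that by (simp add: lamp_closed)
      then show ?thesis using that f h by (simp add: p lamp_mult carrier_W fl_def)
    qed
    show ?thesis
    proof (cases "h = g")
      case False
      then have "convolution_op W m\<^sub>2 (tensor k g) p = (\<Sum>\<^sub>\<infinity>l\<in>carrier \<Lambda>. 0)"
        unfolding conv by (intro infsum_cong, simp only: reg) (simp add: tensor_def)
      then show ?thesis using False by (simp add: p tensor_def)
    next
      case hg: True
      define J where "J = insert g (active k g f)"
      have J: "finite J" "J \<subseteq> carrier \<Gamma>" "g \<in> J"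
        using g finite_active[OF f g] by (auto simp: J_def active_def)
      have site: "g \<otimes>\<^bsub>\<Gamma>\<^esub> inv\<^bsub>\<Gamma>\<^esub> x = \<one>\<^bsub>\<Gamma>\<^esub> \<longleftrightarrow> x = g" if "x \<in> carrier \<Gamma>" for x
        using that g by (metis G.inv_closed G.inv_equality G.inv_inv G.r_inv)
      define R where "R = (\<Prod>x\<in>J - {g}. b (count k x) (f (g \<otimes>\<^bsub>\<Gamma>\<^esub> inv\<^bsub>\<Gamma>\<^esub> x)))"
      have t: "tensor k g (fl l, g) = b (count k g) (inv\<^bsub>\<Lambda>\<^esub> l \<otimes>\<^bsub>\<Lambda>\<^esub> f \<one>\<^bsub>\<Gamma>\<^esub>) * R"
        if l: "l \<in> carrier \<Lambda>" for l
      proof -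
        have "active k g (fl l) \<subseteq> J"
          using site by (auto simp: active_def J_def fl_def split: if_splits)
        then have "tensor k g (fl l, g) = (\<Prod>x\<in>J. b (count k x) (fl l (g \<otimes>\<^bsub>\<Gamma>\<^esub> inv\<^bsub>\<Gamma>\<^esub> x)))"
          using fl[OF l] J by (intro tensor_eq)
        also have "\<dots> = b (count k g) (fl l (g \<otimes>\<^bsub>\<Gamma>\<^esub> inv\<^bsub>\<Gamma>\<^esub> g)) * (\<Prod>x\<in>J - {g}. b (count k x) (fl l (g \<otimes>\<^bsub>\<Gamma>\<^esub> inv\<^bsub>\<Gamma>\<^esub> x)))"
          using J by (rule_tac prod.remove)
        also have "(\<Prod>x\<in>J - {g}. b (count k x) (fl l (g \<otimes>\<^bsub>\<Gamma>\<^esub> inv\<^bsub>\<Gamma>\<^esub> x))) = R"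
          unfolding R_def using J site by (intro prod.cong refl) (auto simp: fl_def)
        also have "fl l (g \<otimes>\<^bsub>\<Gamma>\<^esub> inv\<^bsub>\<Gamma>\<^esub> g) = inv\<^bsub>\<Lambda>\<^esub> l \<otimes>\<^bsub>\<Lambda>\<^esub> f \<one>\<^bsub>\<Gamma>\<^esub>"
          using g by (simp add: fl_def)
        finally show ?thesis .
      qed
      have "convolution_op W m\<^sub>2 (tensor k g) p
          = (\<Sum>\<^sub>\<infinity>l\<in>carrier \<Lambda>. (m\<^sub>\<Lambda> l * b (count k g) (inv\<^bsub>\<Lambda>\<^esub> l \<otimes>\<^bsub>\<Lambda>\<^esub> f \<one>\<^bsub>\<Gamma>\<^esub>)) * R)"
        unfolding conv by (intro infsum_cong) (simp add: reg t hg mult.assoc)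
      also have "\<dots> = b (Suc (count k g)) (f \<one>\<^bsub>\<Gamma>\<^esub>) * R"
        using f by (simp add: infsum_cmult_left' b_Suc configD)
      also have "R = (\<Prod>x\<in>J - {g}. b (count (add_mset g k) x) (f (g \<otimes>\<^bsub>\<Gamma>\<^esub> inv\<^bsub>\<Gamma>\<^esub> x)))"
        unfolding R_def by (intro prod.cong) auto
      also have "b (Suc (count k g)) (f \<one>\<^bsub>\<Gamma>\<^esub>) * \<dots>
          = (\<Prod>x\<in>J. b (count (add_mset g k) x) (f (g \<otimes>\<^bsub>\<Gamma>\<^esub> inv\<^bsub>\<Gamma>\<^esub> x)))"
        using J g by (subst (2) prod.remove[of _ g]) simp_all
      also have "\<dots> = tensor (add_mset g k) g (f, g)"
        using f J by (intro tensor_eq[symmetric]) (auto simp: active_def J_def)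
      finally show ?thesis by (simp add: p hg)
    qed
  qed
qed

text \<open>
  Every tensor vector arises from a point mass by the two operations \<open>tensor_lamp\<close> and
  \<open>tensor_translate\<close>, both of which preserve square summability.
\<close>

lemma tensor_ell2:
  assumes "set_mset k \<subseteq> carrier \<Gamma>" "g \<in> carrier \<Gamma>"
  shows "tensor k g \<in> ell2 (carrier W)"
  using assms
proof (induction k arbitrary: g)
  case empty
  then show ?case by (simp add: tensor_empty ell2_delta carrier_W e_config)
next
  case (add x k)
  then have x: "x \<in> carrier \<Gamma>" by simp
  have "tensor (add_mset x k) x \<in> ell2 (carrier W)"
    unfolding tensor_lamp[OF x, symmetric] using add x by (intro W.convolution_ell2 m\<^sub>2) auto
  then have "left_regular W (base (g \<otimes>\<^bsub>\<Gamma>\<^esub> inv\<^bsub>\<Gamma>\<^esub> x)) (tensor (add_mset x k) x) \<in> ell2 (carrier W)"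
    using add x by (intro W.left_regular_ell2 base_closed) auto
  then show ?case using add x by (simp add: tensor_translate G.m_assoc)
qed

lemma tensor_one:
  assumes "set_mset k \<subseteq> carrier \<Gamma>" "g \<in> carrier \<Gamma>"
  shows "tensor k g \<one>\<^bsub>W\<^esub> = (if g = \<one>\<^bsub>\<Gamma>\<^esub> then \<Prod>x\<in>set_mset k. b (count k x) \<one>\<^bsub>\<Lambda>\<^esub> else 0)"
proof (cases "g = \<one>\<^bsub>\<Gamma>\<^esub>")
  case True
  have "active k g e \<subseteq> set_mset k" using assms by (auto simp: active_def)
  then have "tensor k g (e, g) = (\<Prod>x\<in>set_mset k. b (count k x) (e (g \<otimes>\<^bsub>\<Gamma>\<^esub> inv\<^bsub>\<Gamma>\<^esub> x)))"
    using assms e_config by (intro tensor_eq) auto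
  also have "\<dots> = (\<Prod>x\<in>set_mset k. b (count k x) \<one>\<^bsub>\<Lambda>\<^esub>)"
    using assms by (intro prod.cong refl) auto
  finally show ?thesis using True by (simp add: one_W)
qed (auto simp: one_W tensor_def)

definition u :: "nat \<Rightarrow> ('g \<Rightarrow> 'l) \<times> 'g \<Rightarrow> complex" where
  "u n = (M ^^ n) (delta \<one>\<^bsub>W\<^esub>)"

lemma u_ell2: "u n \<in> ell2 (carrier W)"
  unfolding u_def by (intro M.pow_closed ell2_delta W.one_closed)

definition T :: "nat \<Rightarrow> 'g multiset \<Rightarrow> 'g \<Rightarrow> complex" where
  "T n k g = ell2_inner (carrier W) (tensor k g) (u n)"

lemma T_0:
  assumes "set_mset k \<subseteq> carrier \<Gamma>" "g \<in> carrier \<Gamma>"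
  shows "T 0 k g = cnj (if g = \<one>\<^bsub>\<Gamma>\<^esub> then \<Prod>x\<in>set_mset k. b (count k x) \<one>\<^bsub>\<Lambda>\<^esub> else 0)"
  unfolding T_def u_def
  by (subst ell2_inner_cnj[symmetric]) (simp only: funpow_0 ell2_inner_delta_left[OF W.one_closed] tensor_one[OF assms])

text \<open>
  Both parts of \<open>M\<close> are moved to the left side of the inner product, where the base part translates
  the tensor vector and the lamp part adds \<open>g\<close> to the multiset.
\<close>

lemma T_Suc:
  assumes k: "set_mset k \<subseteq> carrier \<Gamma>" and g: "g \<in> carrier \<Gamma>"
  shows "T (Suc n) k g = (\<Sum>\<^sub>\<infinity>x\<in>carrier \<Gamma>. m\<^sub>\<Gamma> x * T n k (inv\<^bsub>\<Gamma>\<^esub> x \<otimes>\<^bsub>\<Gamma>\<^esub> g)) + T n (add_mset g k) g"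
proof -
  let ?I = "carrier W"
  have t: "tensor k g \<in> ell2 ?I" by (rule tensor_ell2[OF k g])
  interpret M2: selfadjoint_operator ?I "convolution_op W m\<^sub>2"
    by unfold_locales (rule W.convolution_selfadjoint[OF m\<^sub>2 m\<^sub>2_sym])
  interpret base: group_hom \<Gamma> W base by (rule base_hom)
  have "u (Suc n) = (\<lambda>z. convolution_op W m\<^sub>1 (u n) z + convolution_op W m\<^sub>2 (u n) z)"
    using W.convolution_add_measure[OF m\<^sub>1 m\<^sub>2 u_ell2, of n] by (simp add: u_def M_def)
  then have "T (Suc n) k g = ell2_inner ?I (tensor k g) (convolution_op W m\<^sub>1 (u n))
      + ell2_inner ?I (tensor k g) (convolution_op W m\<^sub>2 (u n))"
    unfolding T_def using t u_ell2
    by (simp only: ell2_inner_add_right W.convolution_ell2(1)[OF m\<^sub>1] W.convolution_ell2(1)[OF m\<^sub>2])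
  also have "ell2_inner ?I (tensor k g) (convolution_op W m\<^sub>2 (u n)) = T n (add_mset g k) g"
    unfolding T_def by (simp only: M2.adjoint[OF t u_ell2] tensor_lamp[OF g])
  also have "ell2_inner ?I (tensor k g) (convolution_op W m\<^sub>1 (u n))
      = (\<Sum>\<^sub>\<infinity>z\<in>?I. m\<^sub>1 z * ell2_inner ?I (tensor k g) (left_regular W z (u n)))"
    by (rule W.convolution_inner[OF m\<^sub>1 u_ell2 t])
  also have "\<dots> = (\<Sum>\<^sub>\<infinity>x\<in>carrier \<Gamma>. m\<^sub>\<Gamma> x * ell2_inner ?I (tensor k g) (left_regular W (base x) (u n)))"
    unfolding m\<^sub>1_def using base_closed by (intro infsum_push_forward(1)[OF base_inj]) auto
  also have "\<dots> = (\<Sum>\<^sub>\<infinity>x\<in>carrier \<Gamma>. m\<^sub>\<Gamma> x * T n k (inv\<^bsub>\<Gamma>\<^esub> x \<otimes>\<^bsub>\<Gamma>\<^esub> g))"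
  proof (intro infsum_cong arg_cong[of _ _ "(*) _"])
    fix x assume x: "x \<in> carrier \<Gamma>"
    have "ell2_inner ?I (tensor k g) (left_regular W (base x) (u n))
        = ell2_inner ?I (left_regular W (base (inv\<^bsub>\<Gamma>\<^esub> x)) (tensor k g)) (u n)"
      by (simp only: W.inner_left_regular[OF base_closed[OF x]] base.hom_inv[OF x])
    also have "left_regular W (base (inv\<^bsub>\<Gamma>\<^esub> x)) (tensor k g) = tensor k (inv\<^bsub>\<Gamma>\<^esub> x \<otimes>\<^bsub>\<Gamma>\<^esub> g)"
      using x g by (intro tensor_translate) auto
    finally show "ell2_inner ?I (tensor k g) (left_regular W (base x) (u n)) = T n k (inv\<^bsub>\<Gamma>\<^esub> x \<otimes>\<^bsub>\<Gamma>\<^esub> g)"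
      by (simp only: T_def)
  qed
  finally show ?thesis .
qed

end

section \<open>Random Schroedinger operators\<close>

lemma ell2_norm_triangle:
  assumes f: "f \<in> ell2 I" and g: "g \<in> ell2 I"
  shows "ell2_norm I (\<lambda>x. f x + g x) \<le> ell2_norm I f + ell2_norm I g"
proof -
  have "(ell2_norm I (\<lambda>x. f x + g x))\<^sup>2 = Re (ell2_inner I (\<lambda>x. f x + g x) (\<lambda>x. f x + g x))"
    by (subst ell2_inner_self) simp
  also have "\<dots> = (ell2_norm I f)\<^sup>2 + 2 * Re (ell2_inner I f g) + (ell2_norm I g)\<^sup>2"
    using f g Re_ell2_inner_commute[of I g f]
    by (simp add: ell2_inner_add_left ell2_inner_add_right ell2_add) (simp add: ell2_inner_self)
  also have "\<dots> \<le> (ell2_norm I f + ell2_norm I g)\<^sup>2"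
    using Re_ell2_inner_bound[OF f g] by (simp add: power2_sum abs_le_iff)
  finally show ?thesis by (rule power2_le_imp_le) simp
qed

lemma diag_op_ell2:
  assumes f: "f \<in> ell2 I" and v: "\<And>x. x \<in> I \<Longrightarrow> \<bar>v x\<bar> \<le> R" and R: "0 \<le> R"
  shows "diag_op v f \<in> ell2 I" "ell2_norm I (diag_op v f) \<le> R * ell2_norm I f"
proof -
  have s: "(\<lambda>x. R\<^sup>2 * (cmod (f x))\<^sup>2) summable_on I"
    using ell2D[OF f] by (rule summable_on_cmult_right)
  have le: "(cmod (diag_op v f x))\<^sup>2 \<le> R\<^sup>2 * (cmod (f x))\<^sup>2" if "x \<in> I" for x
    using power_mono[OF v[OF that], of 2]
    by (simp add: diag_op_def norm_mult power_mult_distrib mult_right_mono)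
  have s': "(\<lambda>x. (cmod (diag_op v f x))\<^sup>2) summable_on I"
    by (rule summable_on_comparison_test[OF s]) (use le in auto)
  then show "diag_op v f \<in> ell2 I" using f by (auto simp: ell2_def diag_op_def)
  have "(\<Sum>\<^sub>\<infinity>x\<in>I. (cmod (diag_op v f x))\<^sup>2) \<le> R\<^sup>2 * (\<Sum>\<^sub>\<infinity>x\<in>I. (cmod (f x))\<^sup>2)"
    unfolding infsum_cmult_right'[symmetric] using s s' le by (rule_tac infsum_mono)
  then have "sqrt (\<Sum>\<^sub>\<infinity>x\<in>I. (cmod (diag_op v f x))\<^sup>2) \<le> sqrt (R\<^sup>2 * (\<Sum>\<^sub>\<infinity>x\<in>I. (cmod (f x))\<^sup>2))"
    by (rule real_sqrt_le_mono)
  then show "ell2_norm I (diag_op v f) \<le> R * ell2_norm I f"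
    using R by (simp add: ell2_norm_def real_sqrt_mult)
qed

lemma schroedinger_selfadjoint:
  assumes A: "selfadjoint_op I A" and K: "\<forall>f\<in>ell2 I. ell2_norm I (A f) \<le> K * ell2_norm I f"
    and v: "\<And>x. x \<in> I \<Longrightarrow> \<bar>v x\<bar> \<le> R" and R: "0 \<le> R"
  shows "selfadjoint_op I (schroedinger_op A v)"
    and "\<forall>f\<in>ell2 I. ell2_norm I (schroedinger_op A v f) \<le> (K + R) * ell2_norm I f"
proof -
  interpret A: selfadjoint_operator I A by unfold_locales (rule A)
  note d = diag_op_ell2[OF _ v R]
  have b: "ell2_norm I (schroedinger_op A v f) \<le> (K + R) * ell2_norm I f" if f: "f \<in> ell2 I" for f
  proof -
    have "ell2_norm I (schroedinger_op A v f) \<le> ell2_norm I (A f) + ell2_norm I (diag_op v f)"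
      unfolding schroedinger_op_def by (intro ell2_norm_triangle A.closed f d(1))
    also have "\<dots> \<le> K * ell2_norm I f + R * ell2_norm I f" using K d(2)[OF f] f by (intro add_mono) auto
    finally show ?thesis by (simp add: distrib_right)
  qed
  then show "\<forall>f\<in>ell2 I. ell2_norm I (schroedinger_op A v f) \<le> (K + R) * ell2_norm I f" by blast
  have adj: "ell2_inner I f (diag_op v g) = ell2_inner I (diag_op v f) g" for f g
    by (simp add: ell2_inner_def diag_op_def mult_ac)
  show "selfadjoint_op I (schroedinger_op A v)"
    unfolding selfadjoint_op_def bounded_op_def
  proof (intro conjI ballI allI)
    show "\<exists>K. \<forall>f\<in>ell2 I. ell2_norm I (schroedinger_op A v f) \<le> K * ell2_norm I f" using b by blast
    fix f assume f: "f \<in> ell2 I"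
    show "schroedinger_op A v f \<in> ell2 I"
      unfolding schroedinger_op_def by (intro ell2_add A.closed f d(1))
    show "schroedinger_op A v (\<lambda>x. c * f x) = (\<lambda>x. c * schroedinger_op A v f x)" for c
      by (simp add: schroedinger_op_def A.scale[OF f] diag_op_def algebra_simps)
    fix g assume g: "g \<in> ell2 I"
    show "schroedinger_op A v (\<lambda>x. f x + g x) = (\<lambda>x. schroedinger_op A v f x + schroedinger_op A v g x)"
      by (simp add: schroedinger_op_def A.add[OF f g] diag_op_def algebra_simps)
    show "ell2_inner I f (schroedinger_op A v g) = ell2_inner I (schroedinger_op A v f) g"
      unfolding schroedinger_op_def using f g
      by (simp add: ell2_inner_add_left ell2_inner_add_right A.closed d(1) A.adjoint adj)
  qed
qed

lemma borel_measurable_complex_of_real: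
  "f \<in> borel_measurable P \<Longrightarrow> (\<lambda>x. complex_of_real (f x)) \<in> borel_measurable P"
  by (rule measurable_compose[OF _ borel_measurable_of_real])

lemma borel_measurable_infsum:
  fixes f :: "'w \<Rightarrow> 'a \<Rightarrow> complex"
  assumes S: "countable S" and f: "\<And>x. x \<in> S \<Longrightarrow> (\<lambda>\<omega>. f \<omega> x) \<in> borel_measurable P"
    and sm: "\<And>\<omega>. \<omega> \<in> space P \<Longrightarrow> (\<lambda>x. cmod (f \<omega> x)) summable_on S"
  shows "(\<lambda>\<omega>. \<Sum>\<^sub>\<infinity>x\<in>S. f \<omega> x) \<in> borel_measurable P"
proof -
  interpret sigma_finite_measure "count_space S" by (rule sigma_finite_measure_count_space_countable[OF S])
  have "case_prod f \<in> borel_measurable (P \<Otimes>\<^sub>M count_space S)"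
    unfolding case_prod_unfold
    by (rule measurable_compose_countable'[where f = "\<lambda>x p. f (fst p) x" and g = snd and I = S])
      (use S measurable_compose[OF measurable_fst f] in auto)
  then have "(\<lambda>\<omega>. infsetsum (f \<omega>) S) \<in> borel_measurable P"
    unfolding infsetsum_def by (rule borel_measurable_lebesgue_integral)
  moreover have "infsetsum (f \<omega>) S = (\<Sum>\<^sub>\<infinity>x\<in>S. f \<omega> x)" if "\<omega> \<in> space P" for \<omega>
    using sm[OF that] by (intro infsetsum_infsum) (simp add: abs_summable_equivalent[symmetric])
  ultimately show ?thesis by (subst measurable_cong[where g = "\<lambda>\<omega>. infsetsum (f \<omega>) S"]) auto
qed

text \<open>
  The expectations of the partial sums converge because the remainders are bounded by those of \<open>c\<close>,
  uniformly in \<open>\<omega>\<close>.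
\<close>

lemma (in prob_space) expectation_infsum:
  fixes f :: "'a \<Rightarrow> 'b \<Rightarrow> complex"
  assumes S: "countable S" and f: "\<And>x. x \<in> S \<Longrightarrow> (\<lambda>\<omega>. f \<omega> x) \<in> borel_measurable M"
    and le: "\<And>\<omega> x. \<omega> \<in> space M \<Longrightarrow> x \<in> S \<Longrightarrow> cmod (f \<omega> x) \<le> c x" and c: "c summable_on S"
  shows "expectation (\<lambda>\<omega>. \<Sum>\<^sub>\<infinity>x\<in>S. f \<omega> x) = (\<Sum>\<^sub>\<infinity>x\<in>S. expectation (\<lambda>\<omega>. f \<omega> x))"
    and "integrable M (\<lambda>\<omega>. \<Sum>\<^sub>\<infinity>x\<in>S. f \<omega> x)"
proof -
  have sm: "(\<lambda>x. cmod (f \<omega> x)) summable_on S" if "\<omega> \<in> space M" for \<omega>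
    by (rule summable_on_comparison_test[OF c]) (use le that in auto)
  have bound: "cmod (\<Sum>\<^sub>\<infinity>x\<in>F. f \<omega> x) \<le> (\<Sum>\<^sub>\<infinity>x\<in>F. c x)" if "\<omega> \<in> space M" "F \<subseteq> S" for \<omega> F
  proof (rule norm_infsum_le[where f = "f \<omega>" and X = F and g = c])
    show "(f \<omega> has_sum infsum (f \<omega>) F) F"
      by (rule has_sum_infsum[OF summable_on_subset_banach[OF abs_summable_summable[OF sm[OF that(1)]] that(2)]])
    show "(c has_sum infsum c F) F" by (rule has_sum_infsum[OF summable_on_subset_banach[OF c that(2)]])
  qed (use le that in auto)
  have meas: "(\<lambda>\<omega>. \<Sum>\<^sub>\<infinity>x\<in>S. f \<omega> x) \<in> borel_measurable M"
    by (rule borel_measurable_infsum[OF S f sm])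
  show int: "integrable M (\<lambda>\<omega>. \<Sum>\<^sub>\<infinity>x\<in>S. f \<omega> x)"
    using bound meas by (intro integrable_const_bound[where B = "\<Sum>\<^sub>\<infinity>x\<in>S. c x"]) auto
  have intf: "integrable M (\<lambda>\<omega>. f \<omega> x)" if "x \<in> S" for x
    using le f that by (intro integrable_const_bound[where B = "c x"]) auto
  have "((\<lambda>x. expectation (\<lambda>\<omega>. f \<omega> x)) has_sum expectation (\<lambda>\<omega>. \<Sum>\<^sub>\<infinity>x\<in>S. f \<omega> x)) S"
    unfolding has_sum_def
  proof (rule LIM_zero_cancel, rule Lim_null_comparison)
    have "((\<lambda>F. (\<Sum>\<^sub>\<infinity>x\<in>S. c x) - sum c F) \<longlongrightarrow> (\<Sum>\<^sub>\<infinity>x\<in>S. c x) - (\<Sum>\<^sub>\<infinity>x\<in>S. c x)) (finite_subsets_at_top S)"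
      by (intro tendsto_diff tendsto_const infsum_tendsto c)
    then show "((\<lambda>F. (\<Sum>\<^sub>\<infinity>x\<in>S. c x) - sum c F) \<longlongrightarrow> 0) (finite_subsets_at_top S)" by simp
    show "\<forall>\<^sub>F F in finite_subsets_at_top S.
        norm ((\<Sum>x\<in>F. expectation (\<lambda>\<omega>. f \<omega> x)) - expectation (\<lambda>\<omega>. \<Sum>\<^sub>\<infinity>x\<in>S. f \<omega> x))
        \<le> (\<Sum>\<^sub>\<infinity>x\<in>S. c x) - sum c F"
    proof (rule eventually_finite_subsets_at_top_weakI)
      fix F assume F: "finite F" "F \<subseteq> S"
      have "(\<Sum>x\<in>F. expectation (\<lambda>\<omega>. f \<omega> x)) - expectation (\<lambda>\<omega>. \<Sum>\<^sub>\<infinity>x\<in>S. f \<omega> x)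
          = expectation (\<lambda>\<omega>. (\<Sum>x\<in>F. f \<omega> x) - (\<Sum>\<^sub>\<infinity>x\<in>S. f \<omega> x))"
        using F intf int by (subst Bochner_Integration.integral_diff) (auto intro!: Bochner_Integration.integrable_sum Bochner_Integration.integral_sum[symmetric])
      also have "norm \<dots> \<le> expectation (\<lambda>\<omega>. norm ((\<Sum>x\<in>F. f \<omega> x) - (\<Sum>\<^sub>\<infinity>x\<in>S. f \<omega> x)))"
        by (rule integral_norm_bound)
      also have "\<dots> \<le> expectation (\<lambda>_. (\<Sum>\<^sub>\<infinity>x\<in>S - F. c x))"
      proof (rule integral_mono)
        show "integrable M (\<lambda>\<omega>. norm ((\<Sum>x\<in>F. f \<omega> x) - (\<Sum>\<^sub>\<infinity>x\<in>S. f \<omega> x)))"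
          using F intf int by (intro integrable_norm Bochner_Integration.integrable_diff Bochner_Integration.integrable_sum) auto
        fix \<omega> assume w: "\<omega> \<in> space M"
        have "(\<Sum>\<^sub>\<infinity>x\<in>S - F. f \<omega> x) = (\<Sum>\<^sub>\<infinity>x\<in>S. f \<omega> x) - (\<Sum>\<^sub>\<infinity>x\<in>F. f \<omega> x)"
          using F abs_summable_summable[OF sm[OF w]] by (intro infsum_Diff) auto
        then have "norm ((\<Sum>x\<in>F. f \<omega> x) - (\<Sum>\<^sub>\<infinity>x\<in>S. f \<omega> x)) = norm (\<Sum>\<^sub>\<infinity>x\<in>S - F. f \<omega> x)"
          using F by (simp add: norm_minus_commute)
        then show "norm ((\<Sum>x\<in>F. f \<omega> x) - (\<Sum>\<^sub>\<infinity>x\<in>S. f \<omega> x)) \<le> (\<Sum>\<^sub>\<infinity>x\<in>S - F. c x)"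
          using bound[OF w, of "S - F"] by simp
      qed simp
      also have "\<dots> = (\<Sum>\<^sub>\<infinity>x\<in>S. c x) - sum c F"
        using F c by (simp add: prob_space infsum_Diff)
      finally show "norm ((\<Sum>x\<in>F. expectation (\<lambda>\<omega>. f \<omega> x)) - expectation (\<lambda>\<omega>. \<Sum>\<^sub>\<infinity>x\<in>S. f \<omega> x))
        \<le> (\<Sum>\<^sub>\<infinity>x\<in>S. c x) - sum c F" .
    qed
  qed
  then show "expectation (\<lambda>\<omega>. \<Sum>\<^sub>\<infinity>x\<in>S. f \<omega> x) = (\<Sum>\<^sub>\<infinity>x\<in>S. expectation (\<lambda>\<omega>. f \<omega> x))"
    by (simp add: infsumI)
qed

text \<open>
  The bound on the potential holds for every \<open>\<omega>\<close>, so that all realizations are self-adjoint with a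
  common norm bound and no exceptional set interferes with measurability.
\<close>

locale bounded_potential = P: prob_space P
  for P :: "'w measure" +
  fixes \<Gamma> :: "('g, 'c) monoid_scheme" and m\<^sub>\<Gamma> :: "'g \<Rightarrow> complex" and v :: "'g \<Rightarrow> 'w \<Rightarrow> real" and R :: real
  assumes grp: "group \<Gamma>" and count: "countable (carrier \<Gamma>)"
    and m: "finite_complex_measure \<Gamma> m\<^sub>\<Gamma>"
    and A: "selfadjoint_op (carrier \<Gamma>) (convolution_op \<Gamma> m\<^sub>\<Gamma>)"
    and R: "0 < R"
    and v_meas: "\<And>x. x \<in> carrier \<Gamma> \<Longrightarrow> v x \<in> borel_measurable P"
    and v_bound: "\<And>x \<omega>. x \<in> carrier \<Gamma> \<Longrightarrow> \<bar>v x \<omega>\<bar> \<le> R"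
begin

interpretation G: group \<Gamma> by (rule grp)

definition H :: "'w \<Rightarrow> ('g \<Rightarrow> complex) \<Rightarrow> 'g \<Rightarrow> complex" where
  "H \<omega> = schroedinger_op (convolution_op \<Gamma> m\<^sub>\<Gamma>) (\<lambda>x. v x \<omega>)"

definition K :: real where
  "K = (\<Sum>\<^sub>\<infinity>x\<in>carrier \<Gamma>. cmod (m\<^sub>\<Gamma> x)) + R"

lemma K_pos: "0 < K"
  using R by (simp add: K_def add_nonneg_pos infsum_nonneg)

lemma H_selfadjoint: "selfadjoint_op (carrier \<Gamma>) (H \<omega>)"
  and H_bound: "\<forall>f\<in>ell2 (carrier \<Gamma>). ell2_norm (carrier \<Gamma>) (H \<omega> f) \<le> K * ell2_norm (carrier \<Gamma>) f"
  unfolding H_def K_def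
  by (rule schroedinger_selfadjoint[OF A, of "\<Sum>\<^sub>\<infinity>x\<in>carrier \<Gamma>. cmod (m\<^sub>\<Gamma> x)" _ R];
      use v_bound G.convolution_ell2(2)[OF m] R in simp)+

definition w :: "nat \<Rightarrow> 'w \<Rightarrow> 'g \<Rightarrow> complex" where
  "w n \<omega> = (H \<omega> ^^ n) (delta \<one>\<^bsub>\<Gamma>\<^esub>)"

lemma w_ell2: "w n \<omega> \<in> ell2 (carrier \<Gamma>)"
  unfolding w_def
  by (intro selfadjoint_operator.pow_closed[OF selfadjoint_operator.intro[OF H_selfadjoint]] ell2_delta) simp

lemma w_bound: "y \<in> carrier \<Gamma> \<Longrightarrow> cmod (w n \<omega> y) \<le> K ^ n"
proof -
  have "ell2_norm (carrier \<Gamma>) (w n \<omega>) \<le> K ^ n"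
  proof (induction n)
    case 0
    then show ?case by (simp add: w_def ell2_norm_delta)
  next
    case (Suc n)
    have "ell2_norm (carrier \<Gamma>) (w (Suc n) \<omega>) \<le> K * ell2_norm (carrier \<Gamma>) (w n \<omega>)"
      using H_bound[of \<omega>] w_ell2[of n \<omega>] by (simp add: w_def)
    also have "\<dots> \<le> K * K ^ n" using Suc K_pos by simp
    finally show ?case by simp
  qed
  then show "y \<in> carrier \<Gamma> \<Longrightarrow> cmod (w n \<omega> y) \<le> K ^ n"
    using cmod_le_ell2_norm[OF w_ell2] order_trans by blast
qed

lemma w_Suc:
  assumes y: "y \<in> carrier \<Gamma>"
  shows "w (Suc n) \<omega> y = (\<Sum>\<^sub>\<infinity>x\<in>carrier \<Gamma>. m\<^sub>\<Gamma> x * w n \<omega> (inv\<^bsub>\<Gamma>\<^esub> x \<otimes>\<^bsub>\<Gamma>\<^esub> y)) + of_real (v y \<omega>) * w n \<omega> y"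
  using y by (simp add: w_def H_def schroedinger_op_def diag_op_def convolution_op_def left_regular_def)

lemma summand_bound:
  "x \<in> carrier \<Gamma> \<Longrightarrow> y \<in> carrier \<Gamma> \<Longrightarrow> cmod (m\<^sub>\<Gamma> x * w n \<omega> (inv\<^bsub>\<Gamma>\<^esub> x \<otimes>\<^bsub>\<Gamma>\<^esub> y)) \<le> cmod (m\<^sub>\<Gamma> x) * K ^ n"
  by (simp add: norm_mult mult_left_mono w_bound)

lemma summand_bound_summable: "(\<lambda>x. cmod (m\<^sub>\<Gamma> x) * c) summable_on carrier \<Gamma>"
  using m by (intro summable_on_cmult_left) (simp add: finite_complex_measure_def)

lemma w_measurable: "y \<in> carrier \<Gamma> \<Longrightarrow> (\<lambda>\<omega>. w n \<omega> y) \<in> borel_measurable P"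
proof (induction n arbitrary: y)
  case 0
  then show ?case by (simp add: w_def)
next
  case (Suc n)
  have "(\<lambda>\<omega>. \<Sum>\<^sub>\<infinity>x\<in>carrier \<Gamma>. m\<^sub>\<Gamma> x * w n \<omega> (inv\<^bsub>\<Gamma>\<^esub> x \<otimes>\<^bsub>\<Gamma>\<^esub> y)) \<in> borel_measurable P"
  proof (rule borel_measurable_infsum[OF count])
    show "(\<lambda>\<omega>. m\<^sub>\<Gamma> x * w n \<omega> (inv\<^bsub>\<Gamma>\<^esub> x \<otimes>\<^bsub>\<Gamma>\<^esub> y)) \<in> borel_measurable P" if "x \<in> carrier \<Gamma>" for x
      using Suc that by (intro borel_measurable_times) auto
    show "(\<lambda>x. cmod (m\<^sub>\<Gamma> x * w n \<omega> (inv\<^bsub>\<Gamma>\<^esub> x \<otimes>\<^bsub>\<Gamma>\<^esub> y))) summable_on carrier \<Gamma>" for \<omega>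
      by (rule summable_on_comparison_test[OF summand_bound_summable[of "K ^ n"]]) (use summand_bound Suc in auto)
  qed
  moreover have "(\<lambda>\<omega>. of_real (v y \<omega>) * w n \<omega> y) \<in> borel_measurable P"
    using Suc v_meas by (intro borel_measurable_times borel_measurable_complex_of_real) auto
  ultimately show ?case using Suc by (simp add: w_Suc)
qed

definition V :: "'g multiset \<Rightarrow> 'w \<Rightarrow> real" where
  "V k \<omega> = (\<Prod>x\<in>#k. v x \<omega>)"

lemma V_measurable: "set_mset k \<subseteq> carrier \<Gamma> \<Longrightarrow> V k \<in> borel_measurable P"
  unfolding V_def by (induction k) (auto intro!: borel_measurable_times v_meas)

lemma V_bound: "set_mset k \<subseteq> carrier \<Gamma> \<Longrightarrow> \<bar>V k \<omega>\<bar> \<le> R ^ size k"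
  unfolding V_def using R
  by (induction k) (auto simp: abs_mult intro!: mult_mono v_bound)

definition S :: "nat \<Rightarrow> 'g multiset \<Rightarrow> 'g \<Rightarrow> complex" where
  "S n k g = P.expectation (\<lambda>\<omega>. of_real (V k \<omega>) * w n \<omega> g)"

text \<open>
  Evaluating \<open>H\<close> at \<open>g\<close> produces the translates of the base measure and the factor \<open>v(g)\<close>, which joins
  the monomial.
\<close>

lemma S_Suc:
  assumes k: "set_mset k \<subseteq> carrier \<Gamma>" and g: "g \<in> carrier \<Gamma>"
  shows "S (Suc n) k g = (\<Sum>\<^sub>\<infinity>x\<in>carrier \<Gamma>. m\<^sub>\<Gamma> x * S n k (inv\<^bsub>\<Gamma>\<^esub> x \<otimes>\<^bsub>\<Gamma>\<^esub> g)) + S n (add_mset g k) g"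
proof -
  let ?f = "\<lambda>\<omega> x. of_real (V k \<omega>) * (m\<^sub>\<Gamma> x * w n \<omega> (inv\<^bsub>\<Gamma>\<^esub> x \<otimes>\<^bsub>\<Gamma>\<^esub> g))"
  have Vm: "(\<lambda>\<omega>. complex_of_real (V k \<omega>)) \<in> borel_measurable P"
    by (rule borel_measurable_complex_of_real[OF V_measurable[OF k]])
  have meas: "(\<lambda>\<omega>. ?f \<omega> x) \<in> borel_measurable P" if "x \<in> carrier \<Gamma>" for x
    using g that by (intro borel_measurable_times Vm borel_measurable_const w_measurable) auto
  have bound: "cmod (?f \<omega> x) \<le> cmod (m\<^sub>\<Gamma> x) * (R ^ size k * K ^ n)" if x: "x \<in> carrier \<Gamma>" for \<omega> x
  proof -
    have "cmod (?f \<omega> x) \<le> R ^ size k * (cmod (m\<^sub>\<Gamma> x) * K ^ n)"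
      unfolding norm_mult[of "of_real (V k \<omega>)"] norm_of_real using R
      by (intro mult_mono V_bound k summand_bound x g) auto
    then show ?thesis by (simp add: mult_ac)
  qed
  note 1 = P.expectation_infsum[of "carrier \<Gamma>" ?f, OF count meas bound summand_bound_summable]
  have k': "set_mset (add_mset g k) \<subseteq> carrier \<Gamma>" using k g by simp
  have 2: "integrable P (\<lambda>\<omega>. of_real (V (add_mset g k) \<omega>) * w n \<omega> g)"
  proof (rule P.integrable_const_bound[where B = "R ^ size (add_mset g k) * K ^ n"])
    show "AE \<omega> in P. norm (of_real (V (add_mset g k) \<omega>) * w n \<omega> g) \<le> R ^ size (add_mset g k) * K ^ n"
      unfolding norm_mult norm_of_real using R by (intro AE_I2 mult_mono V_bound k' w_bound g) auto
    show "(\<lambda>\<omega>. of_real (V (add_mset g k) \<omega>) * w n \<omega> g) \<in> borel_measurable P"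
      by (intro borel_measurable_times borel_measurable_complex_of_real V_measurable k' w_measurable g)
  qed
  have "of_real (V k \<omega>) * w (Suc n) \<omega> g
      = (\<Sum>\<^sub>\<infinity>x\<in>carrier \<Gamma>. ?f \<omega> x) + of_real (V (add_mset g k) \<omega>) * w n \<omega> g" for \<omega>
  proof -
    have "(\<Sum>\<^sub>\<infinity>x\<in>carrier \<Gamma>. ?f \<omega> x)
        = of_real (V k \<omega>) * (\<Sum>\<^sub>\<infinity>x\<in>carrier \<Gamma>. m\<^sub>\<Gamma> x * w n \<omega> (inv\<^bsub>\<Gamma>\<^esub> x \<otimes>\<^bsub>\<Gamma>\<^esub> g))"
      by (rule infsum_cmult_right')
    then show ?thesis by (simp add: w_Suc[OF g] distrib_left V_def)
  qed
  then have "S (Suc n) k g = (\<Sum>\<^sub>\<infinity>x\<in>carrier \<Gamma>. P.expectation (\<lambda>\<omega>. ?f \<omega> x)) + S n (add_mset g k) g"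
    unfolding S_def by (simp only: Bochner_Integration.integral_add[OF 1(2) 2] 1(1))
  also have "(\<Sum>\<^sub>\<infinity>x\<in>carrier \<Gamma>. P.expectation (\<lambda>\<omega>. ?f \<omega> x))
      = (\<Sum>\<^sub>\<infinity>x\<in>carrier \<Gamma>. m\<^sub>\<Gamma> x * S n k (inv\<^bsub>\<Gamma>\<^esub> x \<otimes>\<^bsub>\<Gamma>\<^esub> g))"
    by (intro infsum_cong) (simp add: S_def mult.left_commute[of "of_real _"])
  finally show ?thesis .
qed

lemma S_0: "S 0 k g = (if g = \<one>\<^bsub>\<Gamma>\<^esub> then of_real (P.expectation (V k)) else 0)"
  by (simp add: S_def w_def delta_def)

lemma expectation_V:
  assumes indep: "P.indep_vars (\<lambda>_. borel) v (carrier \<Gamma>)" and k: "set_mset k \<subseteq> carrier \<Gamma>"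
  shows "P.expectation (V k) = (\<Prod>x\<in>set_mset k. P.expectation (\<lambda>\<omega>. v x \<omega> ^ count k x))"
proof -
  have "P.indep_vars (\<lambda>_. borel) v (set_mset k)" by (rule P.indep_vars_subset[OF indep k])
  then have "P.indep_vars (\<lambda>_. borel) (\<lambda>x \<omega>. v x \<omega> ^ count k x) (set_mset k)"
    by (rule P.indep_vars_compose2) simp
  moreover have "integrable P (\<lambda>\<omega>. v x \<omega> ^ count k x)" if "x \<in> set_mset k" for x
  proof (rule P.integrable_const_bound[where B = "R ^ count k x"])
    show "AE \<omega> in P. norm (v x \<omega> ^ count k x) \<le> R ^ count k x"
      using v_bound k that by (intro AE_I2) (auto simp: power_abs intro!: power_mono)
    show "(\<lambda>\<omega>. v x \<omega> ^ count k x) \<in> borel_measurable P"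
      using v_meas k that by (intro borel_measurable_power) auto
  qed
  ultimately show ?thesis
    unfolding V_def image_prod_mset_multiplicity by (intro P.indep_vars_lebesgue_integral) auto
qed

end

section \<open>The averaged spectral measure\<close>

text \<open>
  Measurability has to be checked on half-lines, whose measure is a pointwise limit of integrals of
  polynomials.
\<close>

lemma measurable_moment_kernel:
  fixes \<kappa> :: "'w \<Rightarrow> real measure"
  assumes prob: "\<And>\<omega>. \<omega> \<in> space P \<Longrightarrow> prob_space (\<kappa> \<omega>)"
    and sets: "\<And>\<omega>. \<omega> \<in> space P \<Longrightarrow> sets (\<kappa> \<omega>) = sets borel"
    and K: "\<And>\<omega>. \<omega> \<in> space P \<Longrightarrow> AE t in \<kappa> \<omega>. \<bar>t\<bar> \<le> K"
    and meas: "\<And>n. (\<lambda>\<omega>. \<integral>t. t ^ n \<partial>\<kappa> \<omega>) \<in> borel_measurable P"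
  shows "\<kappa> \<in> P \<rightarrow>\<^sub>M prob_algebra borel"
proof (rule measurable_prob_algebra_generated[where \<Omega> = UNIV and G = "range (\<lambda>a. {..a})"])
  show "sets borel = sigma_sets UNIV (range (\<lambda>a :: real. {..a}))"
    by (simp add: borel_eq_atMost sets_measure_of_conv)
  show "Int_stable (range (\<lambda>a :: real. {..a}))" by (auto simp: Int_stable_def)
  have bm: "(borel_measurable (\<kappa> \<omega>) :: (real \<Rightarrow> real) set) = borel_measurable borel" if "\<omega> \<in> space P" for \<omega>
    by (rule measurable_cong_sets[OF sets[OF that] refl])
  have poly: "(\<lambda>\<omega>. \<integral>t. poly p t \<partial>\<kappa> \<omega>) \<in> borel_measurable P" for p
  proof -
    have "(\<integral>t. poly p t \<partial>\<kappa> \<omega>) = (\<Sum>i\<le>degree p. coeff p i * (\<integral>t. t ^ i \<partial>\<kappa> \<omega>))"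
      if w: "\<omega> \<in> space P" for \<omega>
    proof -
      interpret prob_space "\<kappa> \<omega>" using w by (rule prob)
      have "integrable (\<kappa> \<omega>) (\<lambda>t. t ^ i)" for i
      proof (rule integrable_const_bound[where B = "K ^ i"])
        show "AE t in \<kappa> \<omega>. norm (t ^ i) \<le> K ^ i"
          using K[OF w] by eventually_elim (simp add: power_abs power_mono)
        show "(\<lambda>t. t ^ i) \<in> borel_measurable (\<kappa> \<omega>)" by (simp add: bm[OF w])
      qed
      then show ?thesis unfolding poly_altdef by (subst Bochner_Integration.integral_sum) auto
    qed
    moreover have "(\<lambda>\<omega>. \<Sum>i\<le>degree p. coeff p i * (\<integral>t. t ^ i \<partial>\<kappa> \<omega>)) \<in> borel_measurable P"
      by (intro borel_measurable_sum borel_measurable_times borel_measurable_const meas)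
    ultimately show ?thesis by (subst measurable_cong[where g = "\<lambda>\<omega>. \<Sum>i\<le>degree p. coeff p i * (\<integral>t. t ^ i \<partial>\<kappa> \<omega>)"]) auto
  qed
  fix S assume "S \<in> range (\<lambda>a :: real. {..a})"
  then obtain a where S: "S = {..a}" by auto
  obtain p where p: "\<And>t. \<bar>t\<bar> \<le> K \<Longrightarrow> (\<lambda>j. poly (p j) t) \<longlonglongrightarrow> (indicator {..a} t :: real)"
      "\<And>j t. \<bar>t\<bar> \<le> K \<Longrightarrow> \<bar>poly (p j) t\<bar> \<le> 2"
    by (rule halfline_poly_approx[of K a]) blast
  have lim: "(\<lambda>j. \<integral>t. poly (p j) t \<partial>\<kappa> \<omega>) \<longlonglongrightarrow> measure (\<kappa> \<omega>) {..a}" if w: "\<omega> \<in> space P" for \<omega>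
  proof -
    interpret prob_space "\<kappa> \<omega>" using w by (rule prob)
    have sp: "space (\<kappa> \<omega>) = UNIV" using sets_eq_imp_space_eq[OF sets[OF w]] by simp
    have "(\<lambda>j. \<integral>t. poly (p j) t \<partial>\<kappa> \<omega>) \<longlonglongrightarrow> (\<integral>t. indicator {..a} t \<partial>\<kappa> \<omega>)"
    proof (rule integral_dominated_convergence[where w = "\<lambda>_. 2"])
      show "AE t in \<kappa> \<omega>. (\<lambda>j. poly (p j) t) \<longlonglongrightarrow> indicator {..a} t"
        using K[OF w] by eventually_elim (rule p)
      show "AE t in \<kappa> \<omega>. norm (poly (p j) t) \<le> 2" for j
        using K[OF w] by eventually_elim (simp add: p)
    qed (simp_all add: bm[OF w] poly_measurable)
    then show ?thesis by (simp add: sp)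
  qed
  have "(\<lambda>\<omega>. measure (\<kappa> \<omega>) {..a}) \<in> borel_measurable P"
    by (rule borel_measurable_LIMSEQ_real[where u = "\<lambda>j \<omega>. \<integral>t. poly (p j) t \<partial>\<kappa> \<omega>", OF lim poly])
  then have "(\<lambda>\<omega>. ennreal (measure (\<kappa> \<omega>) {..a})) \<in> borel_measurable P" by simp
  moreover have "emeasure (\<kappa> \<omega>) {..a} = ennreal (measure (\<kappa> \<omega>) {..a})" if "\<omega> \<in> space P" for \<omega>
    using finite_measure.emeasure_eq_measure[OF prob_space.finite_measure[OF prob[OF that]]] .
  ultimately show "(\<lambda>\<omega>. emeasure (\<kappa> \<omega>) S) \<in> borel_measurable P"
    unfolding S by (subst measurable_cong[where g = "\<lambda>\<omega>. ennreal (measure (\<kappa> \<omega>) {..a})"]) auto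
qed (use prob sets in auto)

lemma expected_measure_eq_bind:
  assumes "prob_space P" and \<kappa>: "\<kappa> \<in> P \<rightarrow>\<^sub>M subprob_algebra borel"
  shows "expected_measure P \<kappa> = P \<bind> \<kappa>"
proof -
  interpret prob_space P by fact
  have sets: "sets (P \<bind> \<kappa>) = sets borel" by (rule sets_bind_measurable[OF \<kappa> not_empty])
  have sp: "space (P \<bind> \<kappa>) = UNIV" using sets_eq_imp_space_eq[OF sets] by simp
  have "expected_measure P \<kappa> = measure_of UNIV (sets borel) (emeasure (P \<bind> \<kappa>))"
    unfolding expected_measure_def
  proof (rule measure_of_eq)
    fix S assume "S \<in> sigma_sets UNIV (sets (borel :: real measure))"
    then have S: "S \<in> sets borel" using sets.sigma_sets_eq[of "borel :: real measure"] by simp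
    have sub: "subprob_space (\<kappa> \<omega>)" if "\<omega> \<in> space P" for \<omega> using \<kappa> that by (rule subprob_space_kernel)
    have m: "(\<lambda>\<omega>. measure (\<kappa> \<omega>) S) \<in> borel_measurable P"
      unfolding measure_def using S
      by (intro borel_measurable_enn2real measurable_compose[OF \<kappa> measurable_emeasure_subprob_algebra])
    have int: "integrable P (\<lambda>\<omega>. measure (\<kappa> \<omega>) S)"
      using m sub by (intro integrable_const_bound[where B = 1] AE_I2) (auto intro: subprob_space.subprob_measure_le_1)
    have "emeasure (P \<bind> \<kappa>) S = (\<integral>\<^sup>+\<omega>. emeasure (\<kappa> \<omega>) S \<partial>P)"
      by (rule emeasure_bind[OF not_empty \<kappa> S])
    also have "\<dots> = (\<integral>\<^sup>+\<omega>. ennreal (measure (\<kappa> \<omega>) S) \<partial>P)"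
      using sub by (intro nn_integral_cong) (simp add: finite_measure.emeasure_eq_measure subprob_space_def)
    also have "\<dots> = ennreal (expectation (\<lambda>\<omega>. measure (\<kappa> \<omega>) S))"
      using int by (intro nn_integral_eq_integral) auto
    finally show "ennreal (expectation (\<lambda>\<omega>. measure (\<kappa> \<omega>) S)) = emeasure (P \<bind> \<kappa>) S" ..
  qed simp
  then show ?thesis using measure_of_of_measure[of "P \<bind> \<kappa>"] by (simp add: sets sp)
qed

context bounded_potential
begin

interpretation G: group \<Gamma> by (rule grp)

abbreviation \<kappa> :: "'w \<Rightarrow> real measure" where
  "\<kappa> \<omega> \<equiv> spectral_measure (carrier \<Gamma>) (H \<omega>) \<one>\<^bsub>\<Gamma>\<^esub>"

lemma \<kappa>: "represents_powers (carrier \<Gamma>) (H \<omega>) (delta \<one>\<^bsub>\<Gamma>\<^esub>) K (\<kappa> \<omega>)"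
  by (rule spectral_measure_represents_powers[OF H_selfadjoint _ K_pos H_bound]) simp

lemma \<kappa>_moment: "(\<integral>t. t ^ n \<partial>\<kappa> \<omega>) = Re (w n \<omega> \<one>\<^bsub>\<Gamma>\<^esub>)"
  using \<kappa>[of \<omega>] by (simp add: represents_powers_def w_def ell2_inner_delta_left)

lemma \<kappa>_sets: "sets (\<kappa> \<omega>) = sets borel"
  and \<kappa>_support: "AE t in \<kappa> \<omega>. \<bar>t\<bar> \<le> K"
  using \<kappa>[of \<omega>] by (auto simp: represents_powers_def)

lemma \<kappa>_prob: "prob_space (\<kappa> \<omega>)"
proof -
  interpret finite_measure "\<kappa> \<omega>" using \<kappa>[of \<omega>] by (simp add: represents_powers_def)
  have "measure (\<kappa> \<omega>) (space (\<kappa> \<omega>)) = 1"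
    using \<kappa>_moment[where n = 0 and \<omega> = \<omega>] by (simp add: w_def delta_def)
  then show ?thesis by (intro prob_spaceI) (simp add: emeasure_eq_measure)
qed

lemma \<kappa>_measurable: "\<kappa> \<in> P \<rightarrow>\<^sub>M prob_algebra borel"
proof (rule measurable_moment_kernel[where K = K])
  show "(\<lambda>\<omega>. \<integral>t. t ^ n \<partial>\<kappa> \<omega>) \<in> borel_measurable P" for n
    unfolding \<kappa>_moment using w_measurable[of "\<one>\<^bsub>\<Gamma>\<^esub>" n]
    by (intro measurable_compose[OF _ borel_measurable_Re]) simp
qed (rule \<kappa>_prob \<kappa>_sets \<kappa>_support)+

lemma bind_\<kappa>_support: "AE t in P \<bind> \<kappa>. \<bar>t\<bar> \<le> K"
  by (subst AE_bind[where B = borel]) (use \<kappa>_measurable \<kappa>_support in \<open>auto intro: measurable_prob_algebraD\<close>)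

lemma bind_\<kappa>_sets: "sets (P \<bind> \<kappa>) = sets borel"
  by (rule sets_bind_measurable[OF measurable_prob_algebraD[OF \<kappa>_measurable] P.not_empty])

lemma bind_\<kappa>_moment: "(\<integral>t. t ^ n \<partial>(P \<bind> \<kappa>)) = Re (S n {#} \<one>\<^bsub>\<Gamma>\<^esub>)"
proof -
  \<comment> \<open>a globally bounded function that agrees with the power on the support of the measures\<close>
  define \<phi> where "\<phi> t = (max (- K) (min K t)) ^ n" for t :: real
  have \<phi>m: "\<phi> \<in> borel_measurable borel" unfolding \<phi>_def by measurable
  have \<phi>_eq: "\<phi> t = t ^ n" if "\<bar>t\<bar> \<le> K" for t using that by (auto simp: \<phi>_def)
  have "(\<integral>t. t ^ n \<partial>(P \<bind> \<kappa>)) = (\<integral>t. \<phi> t \<partial>(P \<bind> \<kappa>))"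
  proof (rule integral_cong_AE)
    show "AE t in P \<bind> \<kappa>. t ^ n = \<phi> t" using bind_\<kappa>_support by eventually_elim (simp add: \<phi>_eq)
  qed (use \<phi>m measurable_cong_sets[OF bind_\<kappa>_sets refl, of "borel :: real measure"] in auto)
  also have "\<dots> = P.expectation (\<lambda>\<omega>. \<integral>t. \<phi> t \<partial>\<kappa> \<omega>)"
  proof (rule integral_bind[where K = borel and B = "K ^ n" and B' = 1])
    show "\<bar>\<phi> t\<bar> \<le> K ^ n" for t
      using K_pos by (auto simp: \<phi>_def power_abs intro!: power_mono)
    show "AE \<omega> in P. emeasure (\<kappa> \<omega>) (space (\<kappa> \<omega>)) \<le> ennreal 1"
      by (simp add: prob_space.emeasure_space_1[OF \<kappa>_prob])
  qed (use \<phi>m \<kappa>_measurable P.finite_measure_axioms in \<open>auto intro: measurable_prob_algebraD\<close>)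
  also have "\<dots> = P.expectation (\<lambda>\<omega>. Re (w n \<omega> \<one>\<^bsub>\<Gamma>\<^esub>))"
  proof (intro arg_cong[of _ _ "integral\<^sup>L P"] ext)
    fix \<omega>
    have "(\<integral>t. \<phi> t \<partial>\<kappa> \<omega>) = (\<integral>t. t ^ n \<partial>\<kappa> \<omega>)"
    proof (rule integral_cong_AE)
      show "AE t in \<kappa> \<omega>. \<phi> t = t ^ n" using \<kappa>_support by eventually_elim (simp add: \<phi>_eq)
    qed (use \<phi>m measurable_cong_sets[OF \<kappa>_sets refl, of \<omega> "borel :: real measure"] in auto)
    then show "(\<integral>t. \<phi> t \<partial>\<kappa> \<omega>) = Re (w n \<omega> \<one>\<^bsub>\<Gamma>\<^esub>)" by (simp add: \<kappa>_moment)
  qed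
  also have "\<dots> = Re (P.expectation (\<lambda>\<omega>. w n \<omega> \<one>\<^bsub>\<Gamma>\<^esub>))"
    using w_bound[of "\<one>\<^bsub>\<Gamma>\<^esub>" n] w_measurable[of "\<one>\<^bsub>\<Gamma>\<^esub>" n]
    by (intro integral_Re P.integrable_const_bound[where B = "K ^ n"]) auto
  finally show ?thesis by (simp add: S_def V_def)
qed

end

section \<open>Comparison of the moments\<close>

lemma (in selfadjoint_operator) inner_pow_real:
  assumes f: "f \<in> ell2 I"
  shows "of_real (Re (ell2_inner I f ((L ^^ n) f))) = ell2_inner I f ((L ^^ n) f)"
proof -
  have "ell2_inner I f ((L ^^ n) f) = ell2_inner I ((L ^^ n) f) f"
    using pcalc_adjoint[OF f f, of "monom 1 n"] by (simp add: pcalc_monom)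
  also have "\<dots> = cnj (ell2_inner I f ((L ^^ n) f))" by (rule ell2_inner_cnj[symmetric])
  finally show ?thesis by (simp add: complex_eq_iff)
qed

locale random_potential = wreath_pair \<Gamma> \<Lambda> m\<^sub>\<Gamma> m\<^sub>\<Lambda> + bounded_potential P \<Gamma> m\<^sub>\<Gamma> v R
  for \<Gamma> :: "('g, 'c) monoid_scheme" and \<Lambda> :: "('l, 'd) monoid_scheme"
    and m\<^sub>\<Gamma> m\<^sub>\<Lambda> and P :: "'w measure" and v R +
  assumes indep: "P.indep_vars (\<lambda>_. borel) v (carrier \<Gamma>)"
    and moments: "\<And>x n. x \<in> carrier \<Gamma> \<Longrightarrow> of_real (P.expectation (\<lambda>\<omega>. v x \<omega> ^ n)) = b n \<one>\<^bsub>\<Lambda>\<^esub>"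
begin

text \<open>
  The two families satisfy the same recursion. At \<open>n = 0\<close> both reduce to products over the sites in \<open>k\<close>,
  on one side by independence and on the other because the vector is a tensor product.
\<close>

lemma S_eq_T:
  "set_mset k \<subseteq> carrier \<Gamma> \<Longrightarrow> g \<in> carrier \<Gamma> \<Longrightarrow> S n k g = T n k g"
proof (induction n arbitrary: k g)
  case 0
  have real: "cnj (b n \<one>\<^bsub>\<Lambda>\<^esub>) = b n \<one>\<^bsub>\<Lambda>\<^esub>" for n
    using moments[OF 0(2), of n] by (metis complex_cnj_complex_of_real)
  have "of_real (P.expectation (V k)) = (\<Prod>x\<in>set_mset k. b (count k x) \<one>\<^bsub>\<Lambda>\<^esub>)"
    unfolding expectation_V[OF indep 0(1)] of_real_prod using 0(1) by (intro prod.cong moments) auto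
  then show ?case by (simp add: S_0 T_0[OF 0] real)
next
  case (Suc n)
  have "(\<Sum>\<^sub>\<infinity>x\<in>carrier \<Gamma>. m\<^sub>\<Gamma> x * S n k (inv\<^bsub>\<Gamma>\<^esub> x \<otimes>\<^bsub>\<Gamma>\<^esub> g))
      = (\<Sum>\<^sub>\<infinity>x\<in>carrier \<Gamma>. m\<^sub>\<Gamma> x * T n k (inv\<^bsub>\<Gamma>\<^esub> x \<otimes>\<^bsub>\<Gamma>\<^esub> g))"
    using Suc by (intro infsum_cong) simp
  then show ?case using Suc.IH[of "add_mset g k" g] Suc.prems by (simp add: S_Suc T_Suc)
qed

theorem bind_\<kappa>_eq: "P \<bind> \<kappa> = spectral_measure (carrier W) M \<one>\<^bsub>W\<^esub>"
proof -
  have d: "delta \<one>\<^bsub>W\<^esub> \<in> ell2 (carrier W)" by (intro ell2_delta W.one_closed)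
  have "Re (S n {#} \<one>\<^bsub>\<Gamma>\<^esub>) = Re (ell2_inner (carrier W) (delta \<one>\<^bsub>W\<^esub>) ((M ^^ n) (delta \<one>\<^bsub>W\<^esub>)))" for n
    using S_eq_T[of "{#}" "\<one>\<^bsub>\<Gamma>\<^esub>" n] by (simp add: T_def u_def tensor_empty one_W)
  moreover have "finite_measure (P \<bind> \<kappa>)"
    by (rule subprob_space.axioms(1)[OF subprob_space_bind[OF prob_space_imp_subprob_space[OF P.prob_space_axioms]
      measurable_prob_algebraD[OF \<kappa>_measurable]]])
  ultimately have "represents_powers (carrier W) M (delta \<one>\<^bsub>W\<^esub>) K (P \<bind> \<kappa>)"
    by (simp add: represents_powers_def bind_\<kappa>_sets bind_\<kappa>_support bind_\<kappa>_moment)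
  moreover obtain K' where "0 < K'" "\<forall>f\<in>ell2 (carrier W). ell2_norm (carrier W) (M f) \<le> K' * ell2_norm (carrier W) f"
    using M.ex_norm_bound by blast
  then have "represents_powers (carrier W) M (delta \<one>\<^bsub>W\<^esub>) K' (spectral_measure (carrier W) M \<one>\<^bsub>W\<^esub>)"
    using spectral_measure_represents_powers[OF M_selfadjoint W.one_closed] by blast
  ultimately show ?thesis by (rule M.represents_powers_unique[OF d])
qed

end

section \<open>Almost surely bounded potentials\<close>

text \<open>
  The diagonal entries \<open>\<langle>\<delta>\<^sub>x, V \<delta>\<^sub>x\<rangle>\<close> are differences of those of two bounded operators.
\<close>

lemma schroedinger_selfadjointD:
  assumes A: "selfadjoint_op I A" and H: "selfadjoint_op I (schroedinger_op A v)"
  shows "\<exists>R. \<forall>x\<in>I. \<bar>v x\<bar> \<le> R"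
proof -
  interpret A: selfadjoint_operator I A by unfold_locales (rule A)
  interpret H: selfadjoint_operator I "schroedinger_op A v" by unfold_locales (rule H)
  obtain a h where a: "\<forall>f\<in>ell2 I. ell2_norm I (A f) \<le> a * ell2_norm I f"
    and h: "\<forall>f\<in>ell2 I. ell2_norm I (schroedinger_op A v f) \<le> h * ell2_norm I f"
    using A.ex_norm_bound H.ex_norm_bound by blast
  have "\<bar>v x\<bar> \<le> h + a" if x: "x \<in> I" for x
  proof -
    have d: "delta x \<in> ell2 I" using x by (rule ell2_delta)
    have "of_real (v x) = schroedinger_op A v (delta x) x - A (delta x) x"
      by (simp add: schroedinger_op_def diag_op_def delta_def)
    then have "\<bar>v x\<bar> \<le> cmod (schroedinger_op A v (delta x) x) + cmod (A (delta x) x)"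
      by (metis norm_of_real norm_triangle_ineq4)
    also have "\<dots> \<le> ell2_norm I (schroedinger_op A v (delta x)) + ell2_norm I (A (delta x))"
      by (intro add_mono cmod_le_ell2_norm H.closed A.closed d x)
    also have "\<dots> \<le> h + a"
      using a h d by (intro add_mono) (auto simp: ell2_norm_delta[OF x] dest!: bspec[OF _ d])
    finally show ?thesis .
  qed
  then show ?thesis by blast
qed

text \<open>
  Values outside \<open>I\<close> are kept, so that a potential bounded by \<open>r\<close> on \<open>I\<close> equals its cutoff as a function.
\<close>

definition cutoff :: "'g set \<Rightarrow> real \<Rightarrow> ('g \<Rightarrow> 'w \<Rightarrow> real) \<Rightarrow> 'g \<Rightarrow> 'w \<Rightarrow> real" where
  "cutoff I r v = (\<lambda>x \<omega>. if x \<in> I then max (- r) (min r (v x \<omega>)) else v x \<omega>)"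

lemma cutoff_eq: "(\<And>x. x \<in> I \<Longrightarrow> \<bar>v x \<omega>\<bar> \<le> r) \<Longrightarrow> (\<lambda>x. cutoff I r v x \<omega>) = (\<lambda>x. v x \<omega>)"
  by (fastforce simp: cutoff_def abs_le_iff max_def min_def fun_eq_iff)

lemma bounded_potential_cutoff:
  assumes "prob_space P" "group \<Gamma>" "countable (carrier \<Gamma>)" "finite_complex_measure \<Gamma> m"
    and "selfadjoint_op (carrier \<Gamma>) (convolution_op \<Gamma> m)"
    and v: "\<And>x. x \<in> carrier \<Gamma> \<Longrightarrow> v x \<in> borel_measurable P" and r: "0 < r"
  shows "bounded_potential P \<Gamma> m (cutoff (carrier \<Gamma>) r v) r"
proof -
  show ?thesis
  proof (intro bounded_potential.intro bounded_potential_axioms.intro assms)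
    show "cutoff (carrier \<Gamma>) r v x \<in> borel_measurable P" if "x \<in> carrier \<Gamma>" for x
      using v[OF that] that by (simp add: cutoff_def)
    show "\<bar>cutoff (carrier \<Gamma>) r v x \<omega>\<bar> \<le> r" if "x \<in> carrier \<Gamma>" for x \<omega>
      using that r by (auto simp: cutoff_def abs_le_iff)
  qed
qed

text \<open>
  On the event \<open>N j\<close> that \<open>\<bar>v\<bar> \<le> j + 1\<close> the operator is the one with the potential cut off at \<open>j + 1\<close>,
  to which the bounded case applies. Outside the union of these events the operator is not
  self-adjoint, and the spectral measure is zero by convention; hence the supremum over \<open>j\<close> in the
  proof.
\<close>

lemma spectral_kernel_measurable:
  fixes v :: "'g \<Rightarrow> 'w \<Rightarrow> real"
  assumes "prob_space P" "group \<Gamma>" "countable (carrier \<Gamma>)" "finite_complex_measure \<Gamma> m"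
    and A: "selfadjoint_op (carrier \<Gamma>) (convolution_op \<Gamma> m)"
    and v: "\<And>x. x \<in> carrier \<Gamma> \<Longrightarrow> v x \<in> borel_measurable P"
  shows "(\<lambda>\<omega>. spectral_measure (carrier \<Gamma>) (schroedinger_op (convolution_op \<Gamma> m) (\<lambda>x. v x \<omega>)) \<one>\<^bsub>\<Gamma>\<^esub>)
    \<in> P \<rightarrow>\<^sub>M subprob_algebra borel" (is "?g \<in> _")
proof (rule measurable_subprob_algebra)
  interpret prob_space P by fact
  let ?k = "\<lambda>r \<omega>. spectral_measure (carrier \<Gamma>) (schroedinger_op (convolution_op \<Gamma> m)
      (\<lambda>x. cutoff (carrier \<Gamma>) r v x \<omega>)) \<one>\<^bsub>\<Gamma>\<^esub>"
  have bp: "bounded_potential P \<Gamma> m (cutoff (carrier \<Gamma>) r v) r" if "0 < r" for r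
    by (rule bounded_potential_cutoff[OF assms that])
  have k: "?k r \<in> P \<rightarrow>\<^sub>M prob_algebra borel" "prob_space (?k r \<omega>)" "sets (?k r \<omega>) = sets borel" if "0 < r" for r \<omega>
    using bounded_potential.\<kappa>_measurable[OF bp[OF that]] bounded_potential.\<kappa>_prob[OF bp[OF that]]
      bounded_potential.\<kappa>_sets[OF bp[OF that]]
    by (simp_all add: bounded_potential.H_def[OF bp[OF that]])
  have eq: "?g \<omega> = ?k r \<omega>" if "\<And>x. x \<in> carrier \<Gamma> \<Longrightarrow> \<bar>v x \<omega>\<bar> \<le> r" for r \<omega>
    by (simp only: cutoff_eq[where I = "carrier \<Gamma>" and v = v, OF that])
  have null: "?g \<omega> = null_measure borel" if "\<not> (\<exists>r. \<forall>x\<in>carrier \<Gamma>. \<bar>v x \<omega>\<bar> \<le> r)" for \<omega>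
    using schroedinger_selfadjointD[OF A, of "\<lambda>x. v x \<omega>"] that by (auto simp: spectral_measure_def)
  fix \<omega> assume "\<omega> \<in> space P"
  show "subprob_space (?g \<omega>)" "sets (?g \<omega>) = sets borel"
  proof -
    have "subprob_space (?g \<omega>) \<and> sets (?g \<omega>) = sets borel"
    proof (cases "\<exists>r. \<forall>x\<in>carrier \<Gamma>. \<bar>v x \<omega>\<bar> \<le> r")
      case True
      then obtain r where "\<forall>x\<in>carrier \<Gamma>. \<bar>v x \<omega>\<bar> \<le> r" by blast
      then have "\<And>x. x \<in> carrier \<Gamma> \<Longrightarrow> \<bar>v x \<omega>\<bar> \<le> max r 1" by fastforce
      then have "?g \<omega> = ?k (max r 1) \<omega>" by (rule eq)
      then show ?thesis using k(2,3)[of "max r 1" \<omega>] by (simp add: prob_space_imp_subprob_space)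
    next
      case False
      then show ?thesis by (auto simp: null intro!: subprob_spaceI)
    qed
    then show "subprob_space (?g \<omega>)" "sets (?g \<omega>) = sets borel" by auto
  qed
next
  interpret prob_space P by fact
  fix S :: "real set" assume S: "S \<in> sets borel"
  let ?k = "\<lambda>r \<omega>. spectral_measure (carrier \<Gamma>) (schroedinger_op (convolution_op \<Gamma> m)
      (\<lambda>x. cutoff (carrier \<Gamma>) r v x \<omega>)) \<one>\<^bsub>\<Gamma>\<^esub>"
  define N where "N j = {\<omega> \<in> space P. \<forall>x\<in>carrier \<Gamma>. \<bar>v x \<omega>\<bar> \<le> real (Suc j)}" for j
  have N: "N j \<in> sets P" for j
    unfolding N_def using assms(3) v by measurable
  have k: "(\<lambda>\<omega>. emeasure (?k (real (Suc j)) \<omega>) S) \<in> borel_measurable P" for j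
  proof -
    have bp: "bounded_potential P \<Gamma> m (cutoff (carrier \<Gamma>) (real (Suc j)) v) (real (Suc j))"
      by (rule bounded_potential_cutoff[OF assms]) (simp only: of_nat_0_less_iff zero_less_Suc)+
    show ?thesis
      using measurable_compose[OF measurable_prob_algebraD[OF bounded_potential.\<kappa>_measurable[OF bp]]
          measurable_emeasure_subprob_algebra[OF S]]
      by (simp only: bounded_potential.H_def[OF bp])
  qed
  have "emeasure (?g \<omega>) S = (SUP j. emeasure (?k (real (Suc j)) \<omega>) S * indicator (N j) \<omega>)"
    if w: "\<omega> \<in> space P" for \<omega>
  proof -
    have on: "emeasure (?k (real (Suc j)) \<omega>) S * indicator (N j) \<omega> = emeasure (?g \<omega>) S * indicator (N j) \<omega>" for j
      using cutoff_eq[of "carrier \<Gamma>" v \<omega> "real (Suc j)"] by (cases "\<omega> \<in> N j") (simp_all add: N_def)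
    show ?thesis
    proof (cases "\<exists>r. \<forall>x\<in>carrier \<Gamma>. \<bar>v x \<omega>\<bar> \<le> r")
      case True
      then obtain r where r: "\<forall>x\<in>carrier \<Gamma>. \<bar>v x \<omega>\<bar> \<le> r" by blast
      obtain j :: nat where "r \<le> real j" using real_arch_simple by blast
      then have "\<omega> \<in> N j" using r w by (fastforce simp: N_def)
      then have "emeasure (?g \<omega>) S \<le> (SUP j. emeasure (?g \<omega>) S * indicator (N j) \<omega>)"
        by (intro SUP_upper2[of j]) auto
      moreover have "(SUP j. emeasure (?g \<omega>) S * indicator (N j) \<omega>) \<le> emeasure (?g \<omega>) S"
        by (intro SUP_least) (auto split: split_indicator)
      ultimately show ?thesis unfolding on by (rule antisym)
    next
      case False
      then have "\<omega> \<notin> N j" for j by (auto simp: N_def)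
      moreover have "?g \<omega> = null_measure borel"
        using schroedinger_selfadjointD[OF A, of "\<lambda>x. v x \<omega>"] False by (auto simp: spectral_measure_def)
      ultimately show ?thesis unfolding on by simp
    qed
  qed
  moreover have "(\<lambda>\<omega>. SUP j. emeasure (?k (real (Suc j)) \<omega>) S * indicator (N j) \<omega>) \<in> borel_measurable P"
    by (intro borel_measurable_SUP borel_measurable_times_ennreal k borel_measurable_indicator N) auto
  ultimately show "(\<lambda>\<omega>. emeasure (?g \<omega>) S) \<in> borel_measurable P"
    by (subst measurable_cong[where g = "\<lambda>\<omega>. SUP j. emeasure (?k (real (Suc j)) \<omega>) S * indicator (N j) \<omega>"]) auto
qed

theorem theorem1p1:
  fixes \<Gamma> :: "('g, 'c) monoid_scheme" and \<Lambda> :: "('l, 'd) monoid_scheme"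
    and m\<^sub>\<Gamma> :: "'g \<Rightarrow> complex" and m\<^sub>\<Lambda> :: "'l \<Rightarrow> complex"
    and P :: "'w measure" and v :: "'g \<Rightarrow> 'w \<Rightarrow> real"
  defines "A \<equiv> convolution_op \<Gamma> m\<^sub>\<Gamma>"
    and "B \<equiv> convolution_op \<Lambda> m\<^sub>\<Lambda>"
    and "M \<equiv> convolution_op (wreath \<Lambda> \<Gamma>)
               (\<lambda>z. push_forward \<Gamma> (embed_base \<Lambda> \<Gamma>) m\<^sub>\<Gamma> z + push_forward \<Lambda> (embed_lamp \<Lambda> \<Gamma>) m\<^sub>\<Lambda> z)"
  assumes "group \<Gamma>" and "countable (carrier \<Gamma>)"
    and "group \<Lambda>" and "countable (carrier \<Lambda>)"
    and "finite_complex_measure \<Gamma> m\<^sub>\<Gamma>" and "finite_complex_measure \<Lambda> m\<^sub>\<Lambda>"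
    and "selfadjoint_op (carrier \<Gamma>) A" and "selfadjoint_op (carrier \<Lambda>) B"
    and "prob_space P"
    and "prob_space.indep_vars P (\<lambda>_. borel) v (carrier \<Gamma>)"
    and "\<And>x. x \<in> carrier \<Gamma> \<Longrightarrow> distr P borel (v x) = spectral_measure (carrier \<Lambda>) B \<one>\<^bsub>\<Lambda>\<^esub>"
  shows "expected_measure P (\<lambda>\<omega>. spectral_measure (carrier \<Gamma>) (schroedinger_op A (\<lambda>x. v x \<omega>)) \<one>\<^bsub>\<Gamma>\<^esub>)
       = spectral_measure (carrier (wreath \<Lambda> \<Gamma>)) M \<one>\<^bsub>wreath \<Lambda> \<Gamma>\<^esub>"
proof -
  interpret P: prob_space P by fact
  interpret G: group \<Gamma> by fact
  interpret L: group \<Lambda> by fact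
  interpret B: selfadjoint_operator "carrier \<Lambda>" B by unfold_locales fact
  obtain R where R: "0 < R" "\<forall>f\<in>ell2 (carrier \<Lambda>). ell2_norm (carrier \<Lambda>) (B f) \<le> R * ell2_norm (carrier \<Lambda>) f"
    using B.ex_norm_bound by blast
  define \<mu> where "\<mu> = spectral_measure (carrier \<Lambda>) B \<one>\<^bsub>\<Lambda>\<^esub>"
  have dL: "delta \<one>\<^bsub>\<Lambda>\<^esub> \<in> ell2 (carrier \<Lambda>)" by (intro ell2_delta L.one_closed)
  have \<mu>: "represents_powers (carrier \<Lambda>) B (delta \<one>\<^bsub>\<Lambda>\<^esub>) R \<mu>"
    unfolding \<mu>_def by (rule spectral_measure_represents_powers[OF B.selfadjoint L.one_closed R])
  have v: "v x \<in> borel_measurable P" if "x \<in> carrier \<Gamma>" for x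
    using assms(13) that by (simp add: P.indep_vars_def2)
  have dist: "distr P borel (v x) = \<mu>" if "x \<in> carrier \<Gamma>" for x
    using assms(14)[OF that] by (simp add: \<mu>_def)
  let ?v = "cutoff (carrier \<Gamma>) R v"
  have A: "selfadjoint_op (carrier \<Gamma>) (convolution_op \<Gamma> m\<^sub>\<Gamma>)" using assms by simp
  have B': "selfadjoint_op (carrier \<Lambda>) (convolution_op \<Lambda> m\<^sub>\<Lambda>)" using assms by simp
  interpret bp: bounded_potential P \<Gamma> m\<^sub>\<Gamma> ?v R
    by (rule bounded_potential_cutoff) (use assms A v R in auto)
  have vb: "AE \<omega> in P. \<bar>v x \<omega>\<bar> \<le> R" if "x \<in> carrier \<Gamma>" for x
  proof -
    have "AE t in distr P borel (v x). \<bar>t\<bar> \<le> R"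
      unfolding dist[OF that] using \<mu> by (simp add: represents_powers_def)
    then show ?thesis using v[OF that] by (subst (asm) AE_distr_iff) auto
  qed
  interpret wp: wreath_pair \<Gamma> \<Lambda> m\<^sub>\<Gamma> m\<^sub>\<Lambda>
  proof
    show "m\<^sub>\<Gamma> (inv\<^bsub>\<Gamma>\<^esub> x) = cnj (m\<^sub>\<Gamma> x)" if "x \<in> carrier \<Gamma>" for x
      using A that by (rule G.selfadjoint_convolutionD)
    show "m\<^sub>\<Lambda> (inv\<^bsub>\<Lambda>\<^esub> x) = cnj (m\<^sub>\<Lambda> x)" if "x \<in> carrier \<Lambda>" for x
      using B' that by (rule L.selfadjoint_convolutionD)
  qed fact+
  interpret random_potential \<Gamma> \<Lambda> m\<^sub>\<Gamma> m\<^sub>\<Lambda> P ?v R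
  proof
    have "P.indep_vars (\<lambda>_. borel) (\<lambda>x \<omega>. max (- R) (min R (v x \<omega>))) (carrier \<Gamma>)"
      by (rule P.indep_vars_compose2[OF assms(13)]) measurable
    then show "P.indep_vars (\<lambda>_. borel) ?v (carrier \<Gamma>)"
      by (subst P.indep_vars_cong[OF refl _ refl, where Y = "\<lambda>x \<omega>. max (- R) (min R (v x \<omega>))"])
        (auto simp: cutoff_def)
    fix x n assume x: "x \<in> carrier \<Gamma>"
    have "P.expectation (\<lambda>\<omega>. ?v x \<omega> ^ n) = P.expectation (\<lambda>\<omega>. v x \<omega> ^ n)"
    proof (rule integral_cong_AE)
      show "AE \<omega> in P. ?v x \<omega> ^ n = v x \<omega> ^ n"
        using vb[OF x] by eventually_elim (auto simp: cutoff_def abs_le_iff max_def min_def)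
    qed (use bp.v_meas[OF x] v[OF x] in \<open>auto intro: borel_measurable_power\<close>)
    also have "\<dots> = (\<integral>t. t ^ n \<partial>\<mu>)"
      using v[OF x] by (simp add: dist[OF x, symmetric] integral_distr)
    also have "\<dots> = Re (ell2_inner (carrier \<Lambda>) (delta \<one>\<^bsub>\<Lambda>\<^esub>) ((B ^^ n) (delta \<one>\<^bsub>\<Lambda>\<^esub>)))"
      using \<mu> by (simp add: represents_powers_def)
    finally show "of_real (P.expectation (\<lambda>\<omega>. ?v x \<omega> ^ n)) = wp.b n \<one>\<^bsub>\<Lambda>\<^esub>"
      using B.inner_pow_real[OF dL, of n] by (simp add: ell2_inner_delta_left wp.b_def B_def)
  qed
  let ?g = "\<lambda>\<omega>. spectral_measure (carrier \<Gamma>) (schroedinger_op A (\<lambda>x. v x \<omega>)) \<one>\<^bsub>\<Gamma>\<^esub>"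
  have g: "?g \<in> P \<rightarrow>\<^sub>M subprob_algebra borel"
    unfolding A_def by (rule spectral_kernel_measurable) (use assms A v in auto)
  have "AE \<omega> in P. \<forall>x\<in>carrier \<Gamma>. \<bar>v x \<omega>\<bar> \<le> R"
    using vb assms(5) by (subst AE_ball_countable) auto
  then have "AE \<omega> in P. ?g \<omega> = bp.\<kappa> \<omega>"
  proof eventually_elim
    case (elim \<omega>)
    then have "(\<lambda>x. ?v x \<omega>) = (\<lambda>x. v x \<omega>)" by (intro cutoff_eq) blast
    then show ?case by (simp only: bp.H_def A_def)
  qed
  then have "P \<bind> ?g = P \<bind> bp.\<kappa>"
    by (intro bind_cong_AE[OF refl g measurable_prob_algebraD[OF bp.\<kappa>_measurable]])
  also have "\<dots> = spectral_measure (carrier wp.W) wp.M \<one>\<^bsub>wp.W\<^esub>" by (rule bind_\<kappa>_eq)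
  also have "wp.M = M" by (simp add: wp.M_def M_def wp.m\<^sub>1_def wp.m\<^sub>2_def)
  finally show ?thesis using expected_measure_eq_bind[OF assms(12) g] by simp
qed

end
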